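(* Let $k$ be an algebraically closed field of characteristic $p>0$ and let $\pi:Y\to X$ be a morphism between algebraic varieties over $k$. If $\pi$ is a homeomorphism (for the Zariski topology), then $\pi$ is radicial.
   Context: An algebraic variety over $k$ is a reduced and separated scheme of finite type over $k$ (not necessarily irreducible); morphisms are $k$-morphisms. A dominant morphism $\pi:Y\to X$ is radicial if it is injective and residually purely inseparable, the latter meaning that for every $y\in Y$ the residue field extension $k(\pi(y))\to k(y)$ is purely inseparable (isomorphisms being allowed). *)

theory Defs
  imports "HOL-Analysis.Abstract_Topology" "HOL-Algebra.Generated_Rings"
    "HOL-Algebra.Algebraic_Closure"
begin

section \<open>Ring-theoretic notions\<close>

definition ring_char :: "('a, 'm) ring_scheme \<Rightarrow> nat" where
  "ring_char R = (if \<exists>n::nat. n > 0 \<and> [n] \<cdot>\<^bsub>R\<^esub> \<one>\<^bsub>R\<^esub> = \<zero>\<^bsub>R\<^esub>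
     then LEAST n. n > 0 \<and> [n] \<cdot>\<^bsub>R\<^esub> \<one>\<^bsub>R\<^esub> = \<zero>\<^bsub>R\<^esub> else 0)"

text \<open>The extension is presented by the homomorphism \<open>h\<close> from \<open>K\<close> to \<open>L\<close>. The number
  \<open>max 1 (ring_char L)\<close> is the characteristic exponent, so in characteristic zero only
  isomorphisms qualify; the exponent \<open>n = 0\<close> allows isomorphisms in every characteristic.\<close>

definition purely_inseparable ::
    "('a, 'm) ring_scheme \<Rightarrow> ('b, 'n) ring_scheme \<Rightarrow> ('a \<Rightarrow> 'b) \<Rightarrow> bool" where
  "purely_inseparable K L h \<longleftrightarrow>
     field K \<and> field L \<and> h \<in> ring_hom K L \<and>
     (\<forall>a\<in>carrier L. \<exists>n::nat. a [^]\<^bsub>L\<^esub> ((max 1 (ring_char L)) ^ n) \<in> h ` carrier K)"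

definition reduced_ring :: "('a, 'm) ring_scheme \<Rightarrow> bool" where
  "reduced_ring R \<longleftrightarrow>
     (\<forall>a\<in>carrier R. \<forall>n::nat. a [^]\<^bsub>R\<^esub> n = \<zero>\<^bsub>R\<^esub> \<longrightarrow> a = \<zero>\<^bsub>R\<^esub>)"

definition finitely_generated_algebra ::
    "('a, 'm) ring_scheme \<Rightarrow> ('b, 'n) ring_scheme \<Rightarrow> ('a \<Rightarrow> 'b) \<Rightarrow> bool" where
  "finitely_generated_algebra A B h \<longleftrightarrow>
     (\<exists>F. finite F \<and> F \<subseteq> carrier B \<and> generate_ring B (h ` carrier A \<union> F) = carrier B)"

definition is_local_ring :: "('a, 'm) ring_scheme \<Rightarrow> bool" where
  "is_local_ring R \<longleftrightarrow> cring R \<and> (\<exists>!m. maximalideal m R)"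

definition max_ideal :: "('a, 'm) ring_scheme \<Rightarrow> 'a set" where
  "max_ideal R = (THE m. maximalideal m R)"

definition local_hom ::
    "('a, 'm) ring_scheme \<Rightarrow> ('b, 'n) ring_scheme \<Rightarrow> ('a \<Rightarrow> 'b) \<Rightarrow> bool" where
  "local_hom A B h \<longleftrightarrow>
     h \<in> ring_hom A B \<and> {a \<in> carrier A. h a \<in> max_ideal B} = max_ideal A"


section \<open>Localization\<close>

text \<open>The fraction \<open>a / s\<close> is the class of \<open>(a, s)\<close> for the usual equivalence relation
  on \<open>carrier R \<times> S\<close>; the operations on classes are computed on all representatives.\<close>

definition fraction :: "('a, 'm) ring_scheme \<Rightarrow> 'a set \<Rightarrow> 'a \<Rightarrow> 'a \<Rightarrow> ('a \<times> 'a) set" where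
  "fraction R S a s =
     {(b, t). b \<in> carrier R \<and> t \<in> S \<and>
        (\<exists>u\<in>S. u \<otimes>\<^bsub>R\<^esub> (a \<otimes>\<^bsub>R\<^esub> t \<ominus>\<^bsub>R\<^esub> b \<otimes>\<^bsub>R\<^esub> s) = \<zero>\<^bsub>R\<^esub>)}"

definition localization :: "('a, 'm) ring_scheme \<Rightarrow> 'a set \<Rightarrow> ('a \<times> 'a) set ring" where
  "localization R S =
    \<lparr>carrier = {fraction R S a s | a s. a \<in> carrier R \<and> s \<in> S},
     monoid.mult = (\<lambda>A B. \<Union>(a, s)\<in>A. \<Union>(b, t)\<in>B. fraction R S (a \<otimes>\<^bsub>R\<^esub> b) (s \<otimes>\<^bsub>R\<^esub> t)),
     one = fraction R S \<one>\<^bsub>R\<^esub> \<one>\<^bsub>R\<^esub>,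
     zero = fraction R S \<zero>\<^bsub>R\<^esub> \<one>\<^bsub>R\<^esub>,
     add = (\<lambda>A B. \<Union>(a, s)\<in>A. \<Union>(b, t)\<in>B.
              fraction R S (a \<otimes>\<^bsub>R\<^esub> t \<oplus>\<^bsub>R\<^esub> b \<otimes>\<^bsub>R\<^esub> s) (s \<otimes>\<^bsub>R\<^esub> t))\<rparr>"


section \<open>Ringed spaces and stalks\<close>

text \<open>\<open>rs_res \<X> U V\<close> is the restriction from \<open>U\<close> to \<open>V\<close>. The values of \<open>rs_sec \<X>\<close> and
  \<open>rs_res \<X>\<close> matter only on open sets (with \<open>V \<subseteq> U\<close>) and on elements of the carriers.\<close>

record ('x, 'r) rspace =
  rs_top :: "'x topology"
  rs_sec :: "'x set \<Rightarrow> 'r ring"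
  rs_res :: "'x set \<Rightarrow> 'x set \<Rightarrow> 'r \<Rightarrow> 'r"

abbreviation rs_points :: "('x, 'r) rspace \<Rightarrow> 'x set" where
  "rs_points \<X> \<equiv> topspace (rs_top \<X>)"

text \<open>The empty family \<open>C\<close> is allowed in both sheaf axioms, so the sections over the empty
  set form the zero ring.\<close>

locale ringed_space =
  fixes \<X> :: "('x, 'r) rspace"
  assumes sec_cring: "openin (rs_top \<X>) U \<Longrightarrow> cring (rs_sec \<X> U)"
    and res_hom: "openin (rs_top \<X>) U \<Longrightarrow> openin (rs_top \<X>) V \<Longrightarrow> V \<subseteq> U \<Longrightarrow>
      rs_res \<X> U V \<in> ring_hom (rs_sec \<X> U) (rs_sec \<X> V)"
    and res_id: "openin (rs_top \<X>) U \<Longrightarrow> s \<in> carrier (rs_sec \<X> U) \<Longrightarrow> rs_res \<X> U U s = s"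
    and res_comp: "openin (rs_top \<X>) U \<Longrightarrow> openin (rs_top \<X>) V \<Longrightarrow> openin (rs_top \<X>) W \<Longrightarrow>
      W \<subseteq> V \<Longrightarrow> V \<subseteq> U \<Longrightarrow> s \<in> carrier (rs_sec \<X> U) \<Longrightarrow>
      rs_res \<X> V W (rs_res \<X> U V s) = rs_res \<X> U W s"
    and locality: "(\<And>V. V \<in> C \<Longrightarrow> openin (rs_top \<X>) V) \<Longrightarrow>
      s \<in> carrier (rs_sec \<X> (\<Union>C)) \<Longrightarrow> t \<in> carrier (rs_sec \<X> (\<Union>C)) \<Longrightarrow>
      (\<And>V. V \<in> C \<Longrightarrow> rs_res \<X> (\<Union>C) V s = rs_res \<X> (\<Union>C) V t) \<Longrightarrow> s = t"
    and gluing: "(\<And>V. V \<in> C \<Longrightarrow> openin (rs_top \<X>) V) \<Longrightarrow>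
      (\<And>V. V \<in> C \<Longrightarrow> f V \<in> carrier (rs_sec \<X> V)) \<Longrightarrow>
      (\<And>V W. V \<in> C \<Longrightarrow> W \<in> C \<Longrightarrow> rs_res \<X> V (V \<inter> W) (f V) = rs_res \<X> W (V \<inter> W) (f W)) \<Longrightarrow>
      \<exists>s\<in>carrier (rs_sec \<X> (\<Union>C)). \<forall>V\<in>C. rs_res \<X> (\<Union>C) V s = f V"

text \<open>\<open>germ \<X> x U s\<close> is the class of all pairs that agree with \<open>(U, s)\<close> on a neighbourhood
  of \<open>x\<close>; the stalk is thus the direct limit of the sections over the neighbourhoods of \<open>x\<close>.\<close>

definition germ :: "('x, 'r) rspace \<Rightarrow> 'x \<Rightarrow> 'x set \<Rightarrow> 'r \<Rightarrow> ('x set \<times> 'r) set" where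
  "germ \<X> x U s =
     {(V, t). openin (rs_top \<X>) V \<and> x \<in> V \<and> t \<in> carrier (rs_sec \<X> V) \<and>
        (\<exists>W. openin (rs_top \<X>) W \<and> x \<in> W \<and> W \<subseteq> U \<inter> V \<and> rs_res \<X> U W s = rs_res \<X> V W t)}"

definition stalk :: "('x, 'r) rspace \<Rightarrow> 'x \<Rightarrow> ('x set \<times> 'r) set ring" where
  "stalk \<X> x =
    \<lparr>carrier = {germ \<X> x U s | U s. openin (rs_top \<X>) U \<and> x \<in> U \<and> s \<in> carrier (rs_sec \<X> U)},
     monoid.mult = (\<lambda>A B. \<Union>(U, s)\<in>A. \<Union>(V, t)\<in>B. germ \<X> x (U \<inter> V)
        (rs_res \<X> U (U \<inter> V) s \<otimes>\<^bsub>rs_sec \<X> (U \<inter> V)\<^esub> rs_res \<X> V (U \<inter> V) t)),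
     one = germ \<X> x (rs_points \<X>) \<one>\<^bsub>rs_sec \<X> (rs_points \<X>)\<^esub>,
     zero = germ \<X> x (rs_points \<X>) \<zero>\<^bsub>rs_sec \<X> (rs_points \<X>)\<^esub>,
     add = (\<lambda>A B. \<Union>(U, s)\<in>A. \<Union>(V, t)\<in>B. germ \<X> x (U \<inter> V)
        (rs_res \<X> U (U \<inter> V) s \<oplus>\<^bsub>rs_sec \<X> (U \<inter> V)\<^esub> rs_res \<X> V (U \<inter> V) t))\<rparr>"

locale locally_ringed_space = ringed_space +
  assumes stalk_local: "x \<in> rs_points \<X> \<Longrightarrow> is_local_ring (stalk \<X> x)"

definition residue_field :: "('x, 'r) rspace \<Rightarrow> 'x \<Rightarrow> ('x set \<times> 'r) set set ring" where
  "residue_field \<X> x = stalk \<X> x Quot max_ideal (stalk \<X> x)"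

definition open_subspace :: "('x, 'r) rspace \<Rightarrow> 'x set \<Rightarrow> ('x, 'r) rspace" where
  "open_subspace \<X> U = \<X>\<lparr>rs_top := subtopology (rs_top \<X>) U\<rparr>"


section \<open>Morphisms\<close>

text \<open>For \<open>f\<close> from \<open>\<X>\<close> to \<open>\<Y>\<close> and \<open>V\<close> open in \<open>\<Y>\<close>, the map \<open>rm_pull f V\<close> goes from the
  sections of \<open>\<Y>\<close> over \<open>V\<close> to the sections of \<open>\<X>\<close> over the preimage of \<open>V\<close>.\<close>

record ('x, 'r, 'y, 's) rmorph =
  rm_base :: "'x \<Rightarrow> 'y"
  rm_pull :: "'y set \<Rightarrow> 's \<Rightarrow> 'r"

definition preim :: "('x, 'r) rspace \<Rightarrow> ('x, 'r, 'y, 's) rmorph \<Rightarrow> 'y set \<Rightarrow> 'x set" where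
  "preim \<X> f V = {x \<in> rs_points \<X>. rm_base f x \<in> V}"

definition stalk_map ::
    "('x, 'r) rspace \<Rightarrow> ('x, 'r, 'y, 's) rmorph \<Rightarrow> 'x \<Rightarrow> ('y set \<times> 's) set \<Rightarrow> ('x set \<times> 'r) set"
  where
  "stalk_map \<X> f x A = (\<Union>(V, t)\<in>A. germ \<X> x (preim \<X> f V) (rm_pull f V t))"

locale lrs_morphism =
  source: locally_ringed_space \<X> + target: locally_ringed_space \<Y>
  for \<X> :: "('x, 'r) rspace" and \<Y> :: "('y, 's) rspace" +
  fixes f :: "('x, 'r, 'y, 's) rmorph"
  assumes base_continuous: "continuous_map (rs_top \<X>) (rs_top \<Y>) (rm_base f)"
    and pull_hom: "openin (rs_top \<Y>) V \<Longrightarrow>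
      rm_pull f V \<in> ring_hom (rs_sec \<Y> V) (rs_sec \<X> (preim \<X> f V))"
    and pull_natural: "openin (rs_top \<Y>) V \<Longrightarrow> openin (rs_top \<Y>) W \<Longrightarrow> W \<subseteq> V \<Longrightarrow>
      t \<in> carrier (rs_sec \<Y> V) \<Longrightarrow>
      rm_pull f W (rs_res \<Y> V W t) = rs_res \<X> (preim \<X> f V) (preim \<X> f W) (rm_pull f V t)"
    and stalk_map_local: "x \<in> rs_points \<X> \<Longrightarrow>
      local_hom (stalk \<Y> (rm_base f x)) (stalk \<X> x) (stalk_map \<X> f x)"

text \<open>Equality of morphisms: HOL functions carry irrelevant values outside the points, open
  sets and sections, so the comparison is restricted to those.\<close>

definition rm_eq ::
    "('x, 'r) rspace \<Rightarrow> ('y, 's) rspace \<Rightarrow>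
     ('x, 'r, 'y, 's) rmorph \<Rightarrow> ('x, 'r, 'y, 's) rmorph \<Rightarrow> bool" where
  "rm_eq \<X> \<Y> f g \<longleftrightarrow>
     (\<forall>x\<in>rs_points \<X>. rm_base f x = rm_base g x) \<and>
     (\<forall>V. openin (rs_top \<Y>) V \<longrightarrow> (\<forall>t\<in>carrier (rs_sec \<Y> V). rm_pull f V t = rm_pull g V t))"

definition rm_id :: "('x, 'r, 'x, 'r) rmorph" where
  "rm_id = \<lparr>rm_base = (\<lambda>x. x), rm_pull = (\<lambda>V s. s)\<rparr>"

text \<open>\<open>rm_comp \<Y> g f\<close> is the composite of \<open>f\<close> into \<open>\<Y>\<close> followed by \<open>g\<close> out of \<open>\<Y>\<close>.\<close>

definition rm_comp ::
    "('y, 's) rspace \<Rightarrow> ('y, 's, 'z, 't) rmorph \<Rightarrow> ('x, 'r, 'y, 's) rmorph \<Rightarrow>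
     ('x, 'r, 'z, 't) rmorph" where
  "rm_comp \<Y> g f =
     \<lparr>rm_base = rm_base g \<circ> rm_base f,
      rm_pull = (\<lambda>W. rm_pull f (preim \<Y> g W) \<circ> rm_pull g W)\<rparr>"

definition lrs_isomorphic :: "('x, 'r) rspace \<Rightarrow> ('y, 's) rspace \<Rightarrow> bool" where
  "lrs_isomorphic \<X> \<Y> \<longleftrightarrow>
     (\<exists>f g. lrs_morphism \<X> \<Y> f \<and> lrs_morphism \<Y> \<X> g \<and>
        rm_eq \<X> \<X> (rm_comp \<Y> g f) rm_id \<and> rm_eq \<Y> \<Y> (rm_comp \<X> f g) rm_id)"


section \<open>Spectra and schemes\<close>

definition prime_spectrum :: "('a, 'm) ring_scheme \<Rightarrow> 'a set set" where
  "prime_spectrum R = {P. primeideal P R}"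

text \<open>The Zariski topology, generated by the distinguished open sets.\<close>

definition zariski :: "('a, 'm) ring_scheme \<Rightarrow> 'a set topology" where
  "zariski R = topology_generated_by {{P \<in> prime_spectrum R. f \<notin> P} | f. f \<in> carrier R}"

abbreviation local_at :: "('a, 'm) ring_scheme \<Rightarrow> 'a set \<Rightarrow> ('a \<times> 'a) set ring" where
  "local_at R P \<equiv> localization R (carrier R - P)"

text \<open>Sections over \<open>U\<close> are the functions with value in the localization at \<open>P\<close> for each
  \<open>P \<in> U\<close> that are locally given by one fraction.\<close>

definition spec_sec ::
    "('a, 'm) ring_scheme \<Rightarrow> 'a set set \<Rightarrow> ('a set \<Rightarrow> ('a \<times> 'a) set) ring" where
  "spec_sec R U =
    \<lparr>carrier = {s \<in> (\<Pi>\<^sub>E P\<in>U. carrier (local_at R P)).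
        \<forall>P\<in>U. \<exists>V. openin (zariski R) V \<and> P \<in> V \<and> V \<subseteq> U \<and>
          (\<exists>a\<in>carrier R. \<exists>b\<in>carrier R. \<forall>Q\<in>V. b \<notin> Q \<and> s Q = fraction R (carrier R - Q) a b)},
     monoid.mult = (\<lambda>s t. \<lambda>P\<in>U. s P \<otimes>\<^bsub>local_at R P\<^esub> t P),
     one = (\<lambda>P\<in>U. \<one>\<^bsub>local_at R P\<^esub>),
     zero = (\<lambda>P\<in>U. \<zero>\<^bsub>local_at R P\<^esub>),
     add = (\<lambda>s t. \<lambda>P\<in>U. s P \<oplus>\<^bsub>local_at R P\<^esub> t P)\<rparr>"

definition Spec ::
    "('a, 'm) ring_scheme \<Rightarrow> ('a set, 'a set \<Rightarrow> ('a \<times> 'a) set) rspace" where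
  "Spec R = \<lparr>rs_top = zariski R, rs_sec = spec_sec R, rs_res = (\<lambda>U V s. restrict s V)\<rparr>"

text \<open>The ring \<open>A\<close> may be taken over the type of sections, since it is isomorphic to the ring
  of global sections of \<open>\<X>\<close>.\<close>

definition affine_scheme :: "('x, 'r) rspace \<Rightarrow> bool" where
  "affine_scheme \<X> \<longleftrightarrow> (\<exists>A :: 'r ring. cring A \<and> lrs_isomorphic \<X> (Spec A))"

definition affine_open :: "('x, 'r) rspace \<Rightarrow> 'x set \<Rightarrow> bool" where
  "affine_open \<X> U \<longleftrightarrow> openin (rs_top \<X>) U \<and> affine_scheme (open_subspace \<X> U)"

locale scheme = locally_ringed_space +
  assumes locally_affine: "x \<in> rs_points \<X> \<Longrightarrow> \<exists>U. x \<in> U \<and> affine_open \<X> U"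


section \<open>Properties of schemes and morphisms\<close>

definition reduced_scheme :: "('x, 'r) rspace \<Rightarrow> bool" where
  "reduced_scheme \<X> \<longleftrightarrow> (\<forall>U. openin (rs_top \<X>) U \<longrightarrow> reduced_ring (rs_sec \<X> U))"

definition finite_type ::
    "('x, 'r) rspace \<Rightarrow> ('y, 's) rspace \<Rightarrow> ('x, 'r, 'y, 's) rmorph \<Rightarrow> bool" where
  "finite_type \<X> \<Y> f \<longleftrightarrow>
     (\<exists>\<V>. (\<forall>V\<in>\<V>. affine_open \<Y> V) \<and> \<Union>\<V> = rs_points \<Y> \<and>
       (\<forall>V\<in>\<V>. \<exists>\<U>. finite \<U> \<and> (\<forall>U\<in>\<U>. affine_open \<X> U) \<and> \<Union>\<U> = preim \<X> f V \<and>
         (\<forall>U\<in>\<U>. finitely_generated_algebra (rs_sec \<Y> V) (rs_sec \<X> U)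
                    (rs_res \<X> (preim \<X> f V) U \<circ> rm_pull f V))))"

text \<open>\<open>P\<close>, with projections \<open>p\<close> and \<open>q\<close>, is a fibre product of \<open>\<X>\<close> and \<open>\<Y>\<close> over \<open>S\<close>. The
  universal property is tested on the schemes with the same carrier types as \<open>P\<close>; as soon as
  these types are large enough to contain a copy of the fibre product, it determines that
  fibre product up to isomorphism.\<close>

definition fibre_product ::
    "('s, 't) rspace \<Rightarrow> ('x, 'r) rspace \<Rightarrow> ('x, 'r, 's, 't) rmorph \<Rightarrow>
     ('y, 'q) rspace \<Rightarrow> ('y, 'q, 's, 't) rmorph \<Rightarrow>
     ('p, 'u) rspace \<Rightarrow> ('p, 'u, 'x, 'r) rmorph \<Rightarrow> ('p, 'u, 'y, 'q) rmorph \<Rightarrow> bool" where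
  "fibre_product S \<X> f \<Y> g P p q \<longleftrightarrow>
     scheme P \<and> lrs_morphism P \<X> p \<and> lrs_morphism P \<Y> q \<and>
     rm_eq P S (rm_comp \<X> f p) (rm_comp \<Y> g q) \<and>
     (\<forall>(T :: ('p, 'u) rspace) a b.
        scheme T \<and> lrs_morphism T \<X> a \<and> lrs_morphism T \<Y> b \<and>
        rm_eq T S (rm_comp \<X> f a) (rm_comp \<Y> g b) \<longrightarrow>
        (\<exists>h. lrs_morphism T P h \<and> rm_eq T \<X> (rm_comp P p h) a \<and> rm_eq T \<Y> (rm_comp P q h) b \<and>
           (\<forall>h'. lrs_morphism T P h' \<and>
                 rm_eq T \<X> (rm_comp P p h') a \<and> rm_eq T \<Y> (rm_comp P q h') b \<longrightarrow>
                 rm_eq T P h' h)))"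

text \<open>A homeomorphism onto a closed subset such that the map of sheaves on the target is an
  epimorphism, i.e. every section upstairs locally lifts.\<close>

definition closed_immersion ::
    "('x, 'r) rspace \<Rightarrow> ('y, 's) rspace \<Rightarrow> ('x, 'r, 'y, 's) rmorph \<Rightarrow> bool" where
  "closed_immersion \<X> \<Y> f \<longleftrightarrow>
     lrs_morphism \<X> \<Y> f \<and>
     embedding_map (rs_top \<X>) (rs_top \<Y>) (rm_base f) \<and>
     closedin (rs_top \<Y>) (rm_base f ` rs_points \<X>) \<and>
     (\<forall>V s y. openin (rs_top \<Y>) V \<and> s \<in> carrier (rs_sec \<X> (preim \<X> f V)) \<and> y \<in> V \<longrightarrow>
        (\<exists>W t. openin (rs_top \<Y>) W \<and> y \<in> W \<and> W \<subseteq> V \<and> t \<in> carrier (rs_sec \<Y> W) \<and>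
           rm_pull f W t = rs_res \<X> (preim \<X> f V) (preim \<X> f W) s))"

text \<open>The diagonal into the fibre product of \<open>\<X>\<close> with itself is a closed immersion. The carrier
  type used for the fibre product is large enough: with \<open>c\<close> the (infinite) cardinality of
  \<open>'x \<times> 'r \<times> nat\<close>, the stalks of \<open>\<X>\<close> have at most \<open>c\<close> elements, hence so do
  the tensor products of pairs of residue fields or stalks. A point of the fibre product is
  given by two points of \<open>\<X>\<close> and a prime of such a tensor product, so there are at most \<open>2^c\<close>
  points, and the sections, being functions from points to stalks, number at most \<open>2^2^c\<close>.\<close>

definition separated ::
    "('x, 'r) rspace \<Rightarrow> ('s, 't) rspace \<Rightarrow> ('x, 'r, 's, 't) rmorph \<Rightarrow> bool" where
  "separated \<X> S f \<longleftrightarrow>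
     (\<exists>(P :: (('x \<times> 'r \<times> nat) set set, ('x \<times> 'r \<times> nat) set set) rspace) p q \<Delta>.
        fibre_product S \<X> f \<X> f P p q \<and> lrs_morphism \<X> P \<Delta> \<and>
        rm_eq \<X> \<X> (rm_comp P p \<Delta>) rm_id \<and> rm_eq \<X> \<X> (rm_comp P q \<Delta>) rm_id \<and>
        closed_immersion \<X> P \<Delta>)"


section \<open>Varieties and radicial morphisms\<close>

text \<open>A variety is a scheme \<open>\<X>\<close> together with its structure morphism \<open>a\<close> to \<open>Spec k\<close>.\<close>

definition algebraic_variety ::
    "('k, 'm) ring_scheme \<Rightarrow> ('x, 'r) rspace \<Rightarrow>
     ('x, 'r, 'k set, 'k set \<Rightarrow> ('k \<times> 'k) set) rmorph \<Rightarrow> bool" where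
  "algebraic_variety k \<X> a \<longleftrightarrow>
     scheme \<X> \<and> lrs_morphism \<X> (Spec k) a \<and>
     reduced_scheme \<X> \<and> separated \<X> (Spec k) a \<and> finite_type \<X> (Spec k) a"

definition morphism_over ::
    "('s, 't) rspace \<Rightarrow> ('y, 'q) rspace \<Rightarrow> ('y, 'q, 's, 't) rmorph \<Rightarrow>
     ('x, 'r) rspace \<Rightarrow> ('x, 'r, 's, 't) rmorph \<Rightarrow> ('y, 'q, 'x, 'r) rmorph \<Rightarrow> bool" where
  "morphism_over S \<Y> b \<X> a \<pi> \<longleftrightarrow> lrs_morphism \<Y> \<X> \<pi> \<and> rm_eq \<Y> S (rm_comp \<X> a \<pi>) b"

text \<open>The map that sends the class of a germ \<open>g\<close> at the image of \<open>y\<close> to the class of the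
  image of \<open>g\<close> under the stalk map, for \<open>\<pi>\<close> with source \<open>\<Y>\<close>.\<close>

definition residue_map ::
    "('y, 'q) rspace \<Rightarrow> ('y, 'q, 'x, 'r) rmorph \<Rightarrow> 'y \<Rightarrow>
     ('x set \<times> 'r) set set \<Rightarrow> ('y set \<times> 'q) set set" where
  "residue_map \<Y> \<pi> y A =
     (\<Union>g\<in>A. max_ideal (stalk \<Y> y) +>\<^bsub>stalk \<Y> y\<^esub> stalk_map \<Y> \<pi> y g)"

definition dominant ::
    "('y, 'q) rspace \<Rightarrow> ('x, 'r) rspace \<Rightarrow> ('y, 'q, 'x, 'r) rmorph \<Rightarrow> bool" where
  "dominant \<Y> \<X> \<pi> \<longleftrightarrow> rs_top \<X> closure_of (rm_base \<pi> ` rs_points \<Y>) = rs_points \<X>"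

definition residually_purely_inseparable ::
    "('y, 'q) rspace \<Rightarrow> ('x, 'r) rspace \<Rightarrow> ('y, 'q, 'x, 'r) rmorph \<Rightarrow> bool" where
  "residually_purely_inseparable \<Y> \<X> \<pi> \<longleftrightarrow>
     (\<forall>y\<in>rs_points \<Y>. purely_inseparable
        (residue_field \<X> (rm_base \<pi> y)) (residue_field \<Y> y) (residue_map \<Y> \<pi> y))"

definition radicial ::
    "('y, 'q) rspace \<Rightarrow> ('x, 'r) rspace \<Rightarrow> ('y, 'q, 'x, 'r) rmorph \<Rightarrow> bool" where
  "radicial \<Y> \<X> \<pi> \<longleftrightarrow>
     dominant \<Y> \<X> \<pi> \<and> inj_on (rm_base \<pi>) (rs_points \<Y>) \<and> residually_purely_inseparable \<Y> \<X> \<pi>"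

end

theory Submission
  imports Defs "HOL-Algebra.UnivPoly"
begin

text \<open>
  A homeomorphism is onto and one-to-one, so only the residue field extensions need an argument. Let
  \<open>\<pi>\<close> map \<open>y\<close> to \<open>x\<close>, let \<open>L\<close> be the residue field of \<open>y\<close> and \<open>K\<close> the image in \<open>L\<close> of the
  residue field of \<open>x\<close>. Suppose that \<open>\<alpha> \<in> L\<close> has no power \<open>\<alpha> [^] (p ^ n)\<close> in \<open>K\<close>. Geometrically, \<open>\<pi>\<close>
  restricted to the closure of \<open>y\<close> then has at least two points in a general fibre, because \<open>\<alpha>\<close> takes
  several values there. The proof exhibits two such points, which contradicts injectivity.

  The algebraic half is \<open>separating_points\<close>: for finite sets \<open>E \<subseteq> K\<close> and \<open>M \<subseteq> L\<close> with \<open>\<alpha> \<in> M\<close>, the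
  algebra generated over \<open>k\<close> by \<open>E\<close> and \<open>M\<close> has two \<open>k\<close>-homomorphisms to \<open>k\<close> that agree on \<open>E\<close> and
  differ at \<open>\<alpha>\<close>. It rests on the extension principle behind the Nullstellensatz, proved here in
  \<open>extend_one_step\<close>: if \<open>v\<close> is a nonzero element of \<open>A[x]\<close>, then some nonzero \<open>u \<in> A\<close> has the
  property that every homomorphism from \<open>A\<close> to \<open>k\<close> that does not kill \<open>u\<close> extends to \<open>A[x]\<close> without
  killing \<open>v\<close>. If \<open>x\<close> is transcendental over \<open>A\<close>, or separable of degree at least two, there
  are two extensions with distinct values at \<open>x\<close> (\<open>extend_transcendental\<close>, \<open>extend_separable\<close>);
  by \<open>exists_separable_power\<close> some \<open>\<alpha> [^] (p ^ n)\<close> is of one of these two kinds.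

  The geometric half turns these homomorphisms into points. By \<open>affine_chart\<close>, an affine open set \<open>U\<close>
  has three properties: sections near a point are fractions of sections over \<open>U\<close>, every prime
  ideal of the ring of sections over \<open>U\<close> is the set of sections that vanish at some point, and a point
  is determined by the sections that vanish at it. Let \<open>U\<close> be an affine neighbourhood of \<open>y\<close>, with
  generators of its sections over \<open>k\<close>, and write the pullbacks of the generators of the sections over
  an affine neighbourhood of \<open>x\<close> as fractions of sections over \<open>U\<close>. The two homomorphisms to \<open>k\<close>, chosen to
  agree at the values of these fractions, define two points of \<open>U\<close> (\<open>k_point_of_chart\<close>). All functions
  on the chart of \<open>x\<close> have equal values at the images of the two points, so the images
  coincide, and by injectivity so do the two points; but then the two homomorphisms agree
  on the sections over \<open>U\<close>, hence on their fraction \<open>\<alpha>\<close>.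
\<close>

section \<open>Evaluation, derivatives and roots of polynomials\<close>

text \<open>The unqualified name \<open>eval\<close> denotes the evaluation of coefficient lists.\<close>

abbreviation "ueval \<equiv> UnivPoly.eval"

lemma (in UP_pre_univ_prop) eval_upto:
  assumes "s \<in> carrier S" "p \<in> carrier P" "deg R p \<le> N"
  shows "ueval R S h s p = (\<Oplus>\<^bsub>S\<^esub>i\<in>{..N}. h (up_ring.coeff P p i) \<otimes>\<^bsub>S\<^esub> s [^]\<^bsub>S\<^esub> i)"
proof -
  have "(\<Oplus>\<^bsub>S\<^esub>i\<in>{..deg R p}. h (up_ring.coeff P p i) \<otimes>\<^bsub>S\<^esub> s [^]\<^bsub>S\<^esub> i)
      = (\<Oplus>\<^bsub>S\<^esub>i\<in>{..N}. h (up_ring.coeff P p i) \<otimes>\<^bsub>S\<^esub> s [^]\<^bsub>S\<^esub> i)"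
    using assms by (intro S.add.finprod_mono_neutral_cong_left) (auto simp: deg_aboveD)
  then show ?thesis using eval_on_carrier[OF assms(2), of S h s] by simp
qed

lemma UP_coeff: "p \<in> carrier (UP R) \<Longrightarrow> up_ring.coeff (UP R) p = p"
  by (simp add: UP_def)

lemma UP_memI:
  assumes "\<And>i. f i \<in> carrier R" and "\<And>i. i > n \<Longrightarrow> f i = \<zero>\<^bsub>R\<^esub>"
  shows "f \<in> carrier (UP R)"
  using assms by (auto simp: UP_def up_def bound_def)

lemma (in UP_pre_univ_prop) map_coeffs:
  assumes p: "p \<in> carrier P" and s: "s \<in> carrier S"
  shows "(\<lambda>i. h (up_ring.coeff P p i)) \<in> carrier (UP S)"
    and "deg S (\<lambda>i. h (up_ring.coeff P p i)) \<le> deg R p"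
    and "ueval S S id s (\<lambda>i. h (up_ring.coeff P p i)) = ueval R S h s p"
proof -
  let ?q = "\<lambda>i. h (up_ring.coeff P p i)"
  show q: "?q \<in> carrier (UP S)"
    by (rule UP_memI[of _ _ "deg R p"]) (use p in \<open>auto simp: deg_aboveD\<close>)
  interpret T: UP_pre_univ_prop S S id "UP S"
    by (rule UP_pre_univ_propI) (auto intro: S.cring_axioms)
  show d: "deg S ?q \<le> deg R p"
    using q p by (intro T.deg_aboveI) (auto simp: UP_coeff deg_aboveD)
  show "ueval S S id s ?q = ueval R S h s p"
    using T.eval_upto[OF s q d] eval_upto[OF s p order_refl] by (simp add: UP_coeff[OF q])
qed

lemma (in UP_cring) eval_linear_factor:
  assumes q: "q \<in> carrier P" and s: "s \<in> carrier R" "t \<in> carrier R"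
  shows "ueval R R id t ((up_ring.monom P \<one> 1 \<ominus>\<^bsub>P\<^esub> up_ring.monom P s 0) \<otimes>\<^bsub>P\<^esub> q) = (t \<ominus> s) \<otimes> ueval R R id t q"
proof -
  interpret T: UP_pre_univ_prop R R id P
    unfolding P_def by (rule UP_pre_univ_propI) (auto intro: R.cring_axioms)
  interpret E: ring_hom_cring P R "ueval R R id t"
    by (rule T.ring_homD, rule T.eval_ring_hom, rule s)
  show ?thesis
    using q s T.eval_monom1[of t] T.eval_const[of t s]
    by (simp add: a_minus_def)
qed

definition (in ring) formal_deriv :: "(nat \<Rightarrow> 'a) \<Rightarrow> nat \<Rightarrow> 'a" where
  "formal_deriv f i = [Suc i] \<cdot> f (Suc i)"

lemma (in UP_ring) formal_deriv:
  assumes "f \<in> carrier P"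
  shows "R.formal_deriv f \<in> carrier P" and "deg R (R.formal_deriv f) \<le> deg R f - 1"
    and "up_ring.coeff P (R.formal_deriv f) i = [Suc i] \<cdot> up_ring.coeff P f (Suc i)"
proof -
  have c: "up_ring.coeff P f = f" using assms UP_coeff unfolding P_def by blast
  have cl: "f i \<in> carrier R" for i using coeff_closed[OF assms] c by metis
  have z: "f i = \<zero>" if "i > deg R f" for i using deg_aboveD[OF _ assms] that c by metis
  show 1: "R.formal_deriv f \<in> carrier P"
    unfolding P_def by (rule UP_memI[of _ _ "deg R f"]) (auto simp: R.formal_deriv_def cl z)
  show 2: "up_ring.coeff P (R.formal_deriv f) i = [Suc i] \<cdot> up_ring.coeff P f (Suc i)" for i
    using 1 UP_coeff unfolding P_def by (metis R.formal_deriv_def c P_def)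
  show "deg R (R.formal_deriv f) \<le> deg R f - 1"
    by (rule deg_aboveI) (simp_all add: 1 2 deg_aboveD[OF _ assms])
qed

text \<open>The product rule at a root: only the derivative of the linear factor survives. The sum over
  the coefficients telescopes.\<close>

lemma (in UP_cring) eval_formal_deriv_linear_factor:
  assumes q: "q \<in> carrier P" and s: "s \<in> carrier R"
  shows "ueval R R id s (R.formal_deriv ((up_ring.monom P \<one> 1 \<ominus>\<^bsub>P\<^esub> up_ring.monom P s 0) \<otimes>\<^bsub>P\<^esub> q))
    = ueval R R id s q"
proof -
  interpret T: UP_pre_univ_prop R R id P
    unfolding P_def by (rule UP_pre_univ_propI) (auto intro: R.cring_axioms)
  let ?f = "(up_ring.monom P \<one> 1 \<ominus>\<^bsub>P\<^esub> up_ring.monom P s 0) \<otimes>\<^bsub>P\<^esub> q"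
  have f: "?f \<in> carrier P" using q s by simp
  let ?q = "up_ring.coeff P q"
  have cq: "?q i \<in> carrier R" for i using q by simp
  have fc: "up_ring.coeff P ?f (Suc i) = ?q i \<ominus> s \<otimes> ?q (Suc i)" for i
  proof -
    have "?f = up_ring.monom P \<one> 1 \<otimes>\<^bsub>P\<^esub> q \<ominus>\<^bsub>P\<^esub> s \<odot>\<^bsub>P\<^esub> q"
      using q s by (simp add: a_minus_def l_distr monom_mult_is_smult[symmetric] l_minus)
    then show ?thesis
      using q s coeff_monom_mult[OF R.one_closed q, of 1 i] by simp
  qed
  have ind: "(\<Oplus>i\<in>{..N}. [Suc i] \<cdot> (?q i \<ominus> s \<otimes> ?q (Suc i)) \<otimes> s [^] i)
     = (\<Oplus>i\<in>{..N}. ?q i \<otimes> s [^] i) \<ominus> [Suc N] \<cdot> (?q (Suc N) \<otimes> s [^] Suc N)" for N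
  proof (induction N)
    case 0
    then show ?case using cq s
      by (simp add: R.m_comm[of s "?q (Suc 0)"])
  next
    case (Suc N)
    define A where "A = (\<Oplus>i\<in>{..N}. ?q i \<otimes> s [^] i)"
    define b where "b = ?q (Suc N) \<otimes> s [^] Suc N"
    define c where "c = ?q (Suc (Suc N)) \<otimes> s [^] Suc (Suc N)"
    have cl: "A \<in> carrier R" "b \<in> carrier R" "c \<in> carrier R"
      unfolding A_def b_def c_def using cq s by auto
    have "(\<Oplus>i\<in>{..Suc N}. [Suc i] \<cdot> (?q i \<ominus> s \<otimes> ?q (Suc i)) \<otimes> s [^] i)
       = [Suc (Suc N)] \<cdot> (?q (Suc N) \<ominus> s \<otimes> ?q (Suc (Suc N))) \<otimes> s [^] Suc N
         \<oplus> (A \<ominus> [Suc N] \<cdot> b)"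
      using cq s Suc.IH unfolding A_def b_def
      by (subst R.finsum_Suc) (auto simp: R.a_comm)
    also have "[Suc (Suc N)] \<cdot> (?q (Suc N) \<ominus> s \<otimes> ?q (Suc (Suc N))) \<otimes> s [^] Suc N
       = [Suc (Suc N)] \<cdot> (b \<ominus> c)"
    proof -
      have "(?q (Suc N) \<ominus> s \<otimes> ?q (Suc (Suc N))) \<otimes> s [^] Suc N = b \<ominus> c"
      proof -
        have "x \<in> carrier R \<Longrightarrow> y \<in> carrier R \<Longrightarrow> z \<in> carrier R \<Longrightarrow>
          (x \<ominus> s \<otimes> y) \<otimes> (z \<otimes> s) = x \<otimes> (z \<otimes> s) \<ominus> y \<otimes> (z \<otimes> s \<otimes> s)" for x y z
          using s by algebra
        then show ?thesis unfolding b_def c_def using cq s by simp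
      qed
      then show ?thesis using cq s by (subst R.add_pow_ldistr) (simp_all del: R.add.nat_pow_Suc nat_pow_Suc)
    qed
    also have "\<dots> = [Suc N] \<cdot> b \<oplus> b \<ominus> [Suc (Suc N)] \<cdot> c"
    proof -
      have "[n] \<cdot> (b \<ominus> c) = [n] \<cdot> b \<ominus> [n] \<cdot> c" for n :: nat
        using cl by (simp add: a_minus_def R.add.nat_pow_distrib R.add.nat_pow_inv)
      then show ?thesis using R.add.nat_pow_Suc[of "Suc N" b] by (simp del: R.add.nat_pow_Suc)
    qed
    also have "([Suc N] \<cdot> b \<oplus> b \<ominus> [Suc (Suc N)] \<cdot> c) \<oplus> (A \<ominus> [Suc N] \<cdot> b)
       = (A \<oplus> b) \<ominus> [Suc (Suc N)] \<cdot> c"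
    proof -
      have "x \<in> carrier R \<Longrightarrow> y \<in> carrier R \<Longrightarrow> (x \<oplus> b \<ominus> y) \<oplus> (A \<ominus> x) = (A \<oplus> b) \<ominus> y" for x y
        using cl by algebra
      then show ?thesis using cl by simp
    qed
    also have "A \<oplus> b = (\<Oplus>i\<in>{..Suc N}. ?q i \<otimes> s [^] i)"
      unfolding A_def b_def using cq s by (subst R.finsum_Suc) (auto simp: R.a_comm)
    finally show ?case unfolding c_def .
  qed
  let ?N = "deg R ?f + deg R q"
  have "ueval R R id s (R.formal_deriv ?f)
     = (\<Oplus>i\<in>{..?N}. [Suc i] \<cdot> (?q i \<ominus> s \<otimes> ?q (Suc i)) \<otimes> s [^] i)"
  proof -
    have "deg R (R.formal_deriv ?f) \<le> ?N" using formal_deriv(2)[OF f] by linarith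
    from T.eval_upto[OF s formal_deriv(1)[OF f] this] show ?thesis
      by (simp only: formal_deriv(3)[OF f] fc id_apply)
  qed
  also have "\<dots> = (\<Oplus>i\<in>{..?N}. ?q i \<otimes> s [^] i)"
    unfolding ind using cq s q by (simp add: deg_aboveD a_minus_def)
  also have "\<dots> = ueval R R id s q"
    using s q by (subst T.eval_upto[where N="?N"]) auto
  finally show ?thesis .
qed

text \<open>Algebraic closedness is defined through coefficient lists, leading coefficient first; this
  restates it for polynomials as coefficient functions.\<close>

lemma (in algebraically_closed) exists_root:
  assumes f: "f \<in> carrier (UP L)" and d: "deg L f \<ge> 1"
  shows "\<exists>x\<in>carrier L. ueval L L id x f = \<zero>"
proof -
  interpret T: UP_pre_univ_prop L L id "UP L"
    by (rule UP_pre_univ_propI) (auto intro: cring_axioms)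
  have cl: "f i \<in> carrier L" for i using T.coeff_closed[OF f] UP_coeff[OF f] by metis
  have ev: "eval (map f (rev [0..<n])) x = (\<Oplus>i\<in>{..<n}. f i \<otimes> x [^] i)" if "x \<in> carrier L" for n x
  proof (induction n)
    case (Suc n)
    then show ?case using that cl by (simp add: lessThan_Suc)
  qed simp
  define p where "p = map f (rev [0..<Suc (deg L f)])"
  have lc: "f (deg L f) \<noteq> \<zero>"
    using T.lcoeff_nonzero_deg[OF _ f] d UP_coeff[OF f] by auto
  have p: "p \<in> carrier (poly_ring L)"
    unfolding univ_poly_carrier[symmetric] polynomial_def p_def using cl lc by auto
  have "splitted p" using roots_over_carrier[OF p] .
  moreover have "degree p = deg L f" unfolding p_def by simp
  ultimately have "roots p \<noteq> {#}" using d unfolding splitted_def by auto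
  then obtain x where "x \<in># roots p" by blast
  then have "is_root p x" using roots_mem_iff_is_root[OF p] by simp
  then have x: "x \<in> carrier L" "eval p x = \<zero>" unfolding is_root_def by auto
  have "ueval L L id x f = eval p x"
    unfolding p_def ev[OF x(1)] using T.eval_upto[OF x(1) f order_refl]
    by (simp add: UP_coeff[OF f] lessThan_Suc_atMost)
  with x show ?thesis by auto
qed

text \<open>A root \<open>x\<close> of \<open>(X - s) f + 1\<close> satisfies \<open>(x - s) f(x) = -1\<close>, so it differs from \<open>s\<close> and is not a
  root of \<open>f\<close>. Two choices of \<open>s\<close> give two non-roots; this replaces the infinitude of the field.\<close>

lemma (in algebraically_closed) exists_two_nonroots:
  assumes f: "f \<in> carrier (UP L)" and nz: "f \<noteq> \<zero>\<^bsub>UP L\<^esub>"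
  obtains x y where "x \<in> carrier L" "y \<in> carrier L" "x \<noteq> y"
    "ueval L L id x f \<noteq> \<zero>" "ueval L L id y f \<noteq> \<zero>"
proof -
  interpret T: UP_pre_univ_prop L L id "UP L"
    by (rule UP_pre_univ_propI) (auto intro: cring_axioms)
  interpret D: UP_domain L "UP L" by unfold_locales
  let ?X = "\<lambda>s. up_ring.monom (UP L) \<one> 1 \<ominus>\<^bsub>UP L\<^esub> up_ring.monom (UP L) s 0"
  have nt: "carrier L \<noteq> {\<zero>}" using one_closed one_not_zero by blast
  have one: "\<exists>x\<in>carrier L. x \<noteq> s \<and> ueval L L id x g \<noteq> \<zero>"
    if g: "g \<in> carrier (UP L)" "g \<noteq> \<zero>\<^bsub>UP L\<^esub>" and s: "s \<in> carrier L" for g s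
  proof -
    let ?h = "?X s \<otimes>\<^bsub>UP L\<^esub> g"
    have X: "?X s \<in> carrier (UP L)" using s by simp
    have dX: "deg L (?X s) = 1" using T.deg_minus_monom[OF s nt] .
    have Xnz: "?X s \<noteq> \<zero>\<^bsub>UP L\<^esub>" using T.deg_nzero_nzero[of "?X s"] dX by simp
    have dh: "deg L ?h = 1 + deg L g" using D.deg_mult[OF Xnz g(2) X g(1)] dX by simp
    let ?F = "?h \<oplus>\<^bsub>UP L\<^esub> \<one>\<^bsub>UP L\<^esub>"
    have F: "?F \<in> carrier (UP L)" using X g by simp
    have "up_ring.coeff (UP L) ?F (deg L ?h) \<noteq> \<zero>"
    proof -
      have h0: "?h \<noteq> \<zero>\<^bsub>UP L\<^esub>" using dh T.deg_nzero_nzero[of ?h] by simp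
      have "up_ring.coeff (UP L) ?F (deg L ?h)
          = up_ring.coeff (UP L) ?h (deg L ?h) \<oplus> up_ring.coeff (UP L) \<one>\<^bsub>UP L\<^esub> (deg L ?h)"
        using X g by (intro T.coeff_add) auto
      also have "\<dots> = up_ring.coeff (UP L) ?h (deg L ?h)"
        using dh X g by (subst T.coeff_one) (auto simp del: T.coeff_mult)
      finally show ?thesis
        using T.lcoeff_nonzero[OF h0] X g by simp
    qed
    then have "deg L ?F \<ge> 1" using T.deg_belowI[of "deg L ?h" ?F] F dh by linarith
    then obtain x where x: "x \<in> carrier L" "ueval L L id x ?F = \<zero>"
      using exists_root[OF F] by blast
    interpret E: ring_hom_cring "UP L" L "ueval L L id x"
      by (rule T.ring_homD, rule T.eval_ring_hom, rule x)
    have eg: "ueval L L id x g \<in> carrier L" using g by simp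
    have "(x \<ominus> s) \<otimes> ueval L L id x g \<oplus> \<one> = \<zero>"
      using x(2) X g T.eval_linear_factor[OF g(1) s x(1)] by simp
    then have "x \<noteq> s" "ueval L L id x g \<noteq> \<zero>"
      using x s eg one_not_zero by (auto simp: a_minus_def r_neg)
    with x show ?thesis by blast
  qed
  obtain x where x: "x \<in> carrier L" "ueval L L id x f \<noteq> \<zero>"
    using one[OF f nz zero_closed] by blast
  obtain y where "y \<in> carrier L" "y \<noteq> x" "ueval L L id y f \<noteq> \<zero>"
    using one[OF f nz x(1)] by blast
  with x that show thesis by blast
qed

text \<open>Split off \<open>X - x\<close>. The cofactor is not constant, so it has a root, and this root is not \<open>x\<close>
  because the value of the cofactor at \<open>x\<close> is the derivative of \<open>f\<close> there.\<close>

lemma (in algebraically_closed) simple_root_imp_another_root: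
  assumes f: "f \<in> carrier (UP L)" and d: "deg L f \<ge> 2" and x: "x \<in> carrier L"
    and root: "ueval L L id x f = \<zero>"
    and simple: "ueval L L id x (formal_deriv f) \<noteq> \<zero>"
  obtains y where "y \<in> carrier L" "y \<noteq> x" "ueval L L id y f = \<zero>"
proof -
  interpret T: UP_pre_univ_prop L L id "UP L"
    by (rule UP_pre_univ_propI) (auto intro: cring_axioms)
  interpret D: UP_domain L "UP L" by unfold_locales
  let ?X = "up_ring.monom (UP L) \<one> 1 \<ominus>\<^bsub>UP L\<^esub> up_ring.monom (UP L) x 0"
  have nt: "carrier L \<noteq> {\<zero>}" using one_closed one_not_zero by blast
  obtain q where q: "q \<in> carrier (UP L)" and fq: "f = ?X \<otimes>\<^bsub>UP L\<^esub> q"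
  proof -
    obtain q r where "q \<in> carrier (UP L)"
      "f = ?X \<otimes>\<^bsub>UP L\<^esub> q \<oplus>\<^bsub>UP L\<^esub> up_ring.monom (UP L) (ueval L L id x f) 0"
      using T.remainder_theorem[OF f x nt] by blast
    then show thesis using that root x by simp
  qed
  have X: "?X \<in> carrier (UP L)" using x by simp
  have "deg L q \<ge> 1"
  proof -
    have "q \<noteq> \<zero>\<^bsub>UP L\<^esub>" using fq d T.deg_nzero_nzero[of f] X by auto
    moreover have "?X \<noteq> \<zero>\<^bsub>UP L\<^esub>" using T.deg_nzero_nzero[of ?X] T.deg_minus_monom[OF x nt] by simp
    ultimately show ?thesis
      using D.deg_mult[OF _ _ X q] T.deg_minus_monom[OF x nt] fq d by simp
  qed
  then obtain y where y: "y \<in> carrier L" "ueval L L id y q = \<zero>"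
    using exists_root[OF q] by blast
  have "ueval L L id x q \<noteq> \<zero>"
    using T.eval_formal_deriv_linear_factor[OF q x] simple fq by simp
  then have "y \<noteq> x" using y by auto
  moreover have "ueval L L id y f = \<zero>"
    using T.eval_linear_factor[OF q x y(1)] y x fq by simp
  ultimately show thesis using that y by blast
qed

lemma (in UP_pre_univ_prop) eval_pseudo_division:
  assumes "f \<in> carrier P" "g \<in> carrier P" "q \<in> carrier P" "r \<in> carrier P" "s \<in> carrier S"
    and "a \<in> carrier R" and "a [^] (m::nat) \<odot>\<^bsub>P\<^esub> f = g \<otimes>\<^bsub>P\<^esub> q \<oplus>\<^bsub>P\<^esub> r"
  shows "h a [^]\<^bsub>S\<^esub> m \<otimes>\<^bsub>S\<^esub> ueval R S h s f
    = ueval R S h s g \<otimes>\<^bsub>S\<^esub> ueval R S h s q \<oplus>\<^bsub>S\<^esub> ueval R S h s r"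
proof -
  interpret E: ring_hom_cring P S "ueval R S h s"
    by (rule ring_homD, rule eval_ring_hom, rule assms)
  have "h a [^]\<^bsub>S\<^esub> m \<otimes>\<^bsub>S\<^esub> ueval R S h s f
      = ueval R S h s (up_ring.monom P (a [^] m) 0 \<otimes>\<^bsub>P\<^esub> f)"
    using assms eval_const[of s "a [^] m"] by (simp del: monom_mult_is_smult)
  also have "up_ring.monom P (a [^] m) 0 \<otimes>\<^bsub>P\<^esub> f = g \<otimes>\<^bsub>P\<^esub> q \<oplus>\<^bsub>P\<^esub> r"
    using assms by (simp add: monom_mult_is_smult)
  finally show ?thesis using assms by simp
qed

section \<open>Extending homomorphisms into an algebraically closed field\<close>

lemma (in domain) nat_pow_nonzero:
  "a \<in> carrier R \<Longrightarrow> a \<noteq> \<zero> \<Longrightarrow> a [^] (n::nat) \<noteq> \<zero>"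
  by (induction n) (auto simp: integral_iff)

text \<open>The setting is a subring \<open>A\<close> of a field \<open>L\<close>. Polynomials over \<open>A\<close> are evaluated in \<open>L\<close> by
  \<open>ev x\<close> and, along a homomorphism \<open>\<phi>\<close> from \<open>A\<close> to \<open>k\<close>, in \<open>k\<close> by \<open>ueval R k \<phi> \<xi>\<close>. Denominators are
  cleared by pseudo-division, so that no field of fractions of \<open>A\<close> is needed.\<close>

locale subring_adjoin = field L + k: algebraically_closed k
  for L (structure) and k (structure) +
  fixes A R P
  assumes subring: "subring A L"
  defines R_def: "R \<equiv> L\<lparr>carrier := A\<rparr>" and P_def: "P \<equiv> UP R"
begin

sublocale R: "domain" R
  using subring_is_domain[OF subring] by (simp add: R_def)

sublocale D: UP_domain R P
  by unfold_locales

sublocale T: UP_pre_univ_prop R L id P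
  by (unfold_locales, use subringE(1)[OF subring] in \<open>auto simp: R_def P_def ring_hom_def\<close>)

abbreviation ev where "ev x \<equiv> ueval R L id x"

definition adjoin where "adjoin x = ev x ` carrier P"

abbreviation adj where "adj x \<equiv> L\<lparr>carrier := adjoin x\<rparr>"

abbreviation two_ext where
  "two_ext x v \<phi> \<equiv> \<exists>\<psi>1\<in>ring_hom (adj x) k. \<exists>\<psi>2\<in>ring_hom (adj x) k.
    (\<forall>a\<in>A. \<psi>1 a = \<phi> a \<and> \<psi>2 a = \<phi> a) \<and> \<psi>1 x \<noteq> \<psi>2 x \<and> \<psi>1 v \<noteq> \<zero>\<^bsub>k\<^esub> \<and> \<psi>2 v \<noteq> \<zero>\<^bsub>k\<^esub>"

lemma R_simps [simp]: "carrier R = A" "\<one>\<^bsub>R\<^esub> = \<one>" "\<zero>\<^bsub>R\<^esub> = \<zero>"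
  "a \<otimes>\<^bsub>R\<^esub> b = a \<otimes> b" "a \<oplus>\<^bsub>R\<^esub> b = a \<oplus> b"
  by (simp_all add: R_def)

lemma R_pow: "a [^]\<^bsub>R\<^esub> (n::nat) = a [^] n"
  using nat_pow_consistent[of a n A] by (simp add: R_def)

lemma A_carrier: "a \<in> A \<Longrightarrow> a \<in> carrier L"
  using subringE(1)[OF subring] by blast

lemma ev_hom: "x \<in> carrier L \<Longrightarrow> ring_hom_cring P L (ev x)"
  by (rule T.ring_homD, rule T.eval_ring_hom)

lemma adjoin_eq_generate_ring:
  assumes x: "x \<in> carrier L"
  shows "adjoin x = generate_ring L (insert x A)"
proof -
  interpret E: ring_hom_cring P L "ev x" by (rule ev_hom[OF x])
  have sub: "insert x A \<subseteq> carrier L" using x A_carrier by blast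
  show ?thesis
  proof (rule generate_ringI[OF sub])
    show "subring (adjoin x) L"
      unfolding adjoin_def using E.ring.img_is_subring[OF D.P.carrier_is_subring] .
    have "ev x (up_ring.monom P a 0) = a" if "a \<in> A" for a using T.eval_const x that by simp
    moreover have "up_ring.monom P a 0 \<in> carrier P" if "a \<in> A" for a using that by simp
    ultimately have "A \<subseteq> adjoin x" unfolding adjoin_def by (metis image_eqI subsetI)
    moreover have "x \<in> adjoin x"
      using T.eval_monom1[OF x] D.monom_closed[of "\<one>\<^bsub>R\<^esub>" 1] unfolding adjoin_def
      by (metis image_eqI R.one_closed)
    ultimately show "insert x A \<subseteq> adjoin x" by blast
  next
    fix K assume K: "subring K L" "insert x A \<subseteq> K"
    have xK: "x [^] (i::nat) \<in> K" for i
      by (induction i) (use K subringE(3,6)[OF K(1)] in auto)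
    show "adjoin x \<subseteq> K"
    proof
      fix y assume "y \<in> adjoin x"
      then obtain g where g: "g \<in> carrier P" "y = ev x g" unfolding adjoin_def by blast
      have cl: "up_ring.coeff P g i \<in> A" for i using D.coeff_closed[OF g(1)] by simp
      have "(\<Oplus>i\<in>{..n}. id (up_ring.coeff P g i) \<otimes> x [^] i) \<in> K" for n
      proof (induction n)
        case 0
        then show ?case using cl K subringE(6)[OF K(1)] xK[of 0] x A_carrier by (auto simp: Pi_def)
      next
        case (Suc n)
        have "up_ring.coeff P g (Suc n) \<in> K" using cl K by blast
        from subringE(7)[OF K(1) subringE(6)[OF K(1) this xK[of "Suc n"]] Suc.IH] show ?case
          using cl x A_carrier by (subst finsum_Suc) (auto simp: Pi_def simp del: nat_pow_Suc)
      qed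
      then show "y \<in> K" using T.eval_upto[OF x g(1) order_refl] g(2) by simp
    qed
  qed
qed

text \<open>The extension sends \<open>g(x)\<close> to the value at \<open>\<xi>\<close> of the image of \<open>g\<close> under \<open>\<phi>\<close>; the hypothesis on the
  relations of \<open>x\<close> is exactly what makes this well defined.\<close>

lemma extend_to_adjoin:
  assumes x: "x \<in> carrier L" and \<phi>: "\<phi> \<in> ring_hom R k" and \<xi>: "\<xi> \<in> carrier k"
    and ker: "\<And>g. g \<in> carrier P \<Longrightarrow> ev x g = \<zero> \<Longrightarrow> ueval R k \<phi> \<xi> g = \<zero>\<^bsub>k\<^esub>"
  obtains \<psi> where "\<psi> \<in> ring_hom (adj x) k" "\<And>a. a \<in> A \<Longrightarrow> \<psi> a = \<phi> a" "\<psi> x = \<xi>"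
    "\<And>g. g \<in> carrier P \<Longrightarrow> \<psi> (ev x g) = ueval R k \<phi> \<xi> g"
proof -
  interpret E: ring_hom_cring P L "ev x" by (rule ev_hom[OF x])
  interpret K: UP_pre_univ_prop R k \<phi> P
    unfolding P_def by (rule UP_pre_univ_propI) (auto intro: R.cring_axioms k.cring_axioms \<phi>)
  interpret F: ring_hom_cring P k "ueval R k \<phi> \<xi>"
    by (rule K.ring_homD, rule K.eval_ring_hom, rule \<xi>)
  define \<psi> where "\<psi> y = ueval R k \<phi> \<xi> (SOME g. g \<in> carrier P \<and> ev x g = y)" for y
  have main: "\<psi> (ev x g) = ueval R k \<phi> \<xi> g" if g: "g \<in> carrier P" for g
  proof -
    define g' where "g' = (SOME g'. g' \<in> carrier P \<and> ev x g' = ev x g)"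
    have g': "g' \<in> carrier P" "ev x g' = ev x g"
      using someI[of "\<lambda>g'. g' \<in> carrier P \<and> ev x g' = ev x g" g] g unfolding g'_def by auto
    have "ev x (g' \<ominus>\<^bsub>P\<^esub> g) = \<zero>" using g g' by (simp add: a_minus_def r_neg)
    then have "ueval R k \<phi> \<xi> (g' \<ominus>\<^bsub>P\<^esub> g) = \<zero>\<^bsub>k\<^esub>" using g g' by (intro ker) auto
    then have "ueval R k \<phi> \<xi> g' \<ominus>\<^bsub>k\<^esub> ueval R k \<phi> \<xi> g = \<zero>\<^bsub>k\<^esub>"
      using g g' by (simp add: a_minus_def)
    then show ?thesis using g g' unfolding \<psi>_def g'_def[symmetric] by simp
  qed
  show thesis
  proof (rule that[OF _ _ _ main])
    show "\<psi> \<in> ring_hom (adj x) k"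
    proof (rule ring_hom_memI)
      fix y z
      assume "y \<in> carrier (adj x)" "z \<in> carrier (adj x)"
      then obtain g h where g: "g \<in> carrier P" "y = ev x g" and h: "h \<in> carrier P" "z = ev x h"
        unfolding adjoin_def by auto
      show "\<psi> (y \<otimes>\<^bsub>adj x\<^esub> z) = \<psi> y \<otimes>\<^bsub>k\<^esub> \<psi> z"
        using main[of "g \<otimes>\<^bsub>P\<^esub> h"] main[of g] main[of h] g h by simp
      show "\<psi> (y \<oplus>\<^bsub>adj x\<^esub> z) = \<psi> y \<oplus>\<^bsub>k\<^esub> \<psi> z"
        using main[of "g \<oplus>\<^bsub>P\<^esub> h"] main[of g] main[of h] g h by simp
    next
      fix y assume "y \<in> carrier (adj x)"
      then show "\<psi> y \<in> carrier k" using main unfolding adjoin_def by auto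
    next
      show "\<psi> \<one>\<^bsub>adj x\<^esub> = \<one>\<^bsub>k\<^esub>"
        using main[of "\<one>\<^bsub>P\<^esub>"] by simp
    qed
    show "\<psi> a = \<phi> a" if "a \<in> A" for a
      using main[of "up_ring.monom P a 0"] that T.eval_const[OF x, of a] K.eval_const[OF \<xi>, of a] by simp
    show "\<psi> x = \<xi>"
      using main[of "up_ring.monom P \<one>\<^bsub>R\<^esub> 1"] T.eval_monom1[OF x] K.eval_monom1[OF \<xi>]
        D.monom_closed[of "\<one>\<^bsub>R\<^esub>" 1] by (simp only: R.one_closed)
  qed
qed

text \<open>The minimal polynomial of \<open>x\<close> over the field of fractions of \<open>A\<close>, scaled to have coefficients
  in \<open>A\<close>; it is unique only up to such a scaling.\<close>

definition min_relation where
  "min_relation x f \<longleftrightarrow> f \<in> carrier P \<and> f \<noteq> \<zero>\<^bsub>P\<^esub> \<and> ev x f = \<zero> \<and>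
     (\<forall>g\<in>carrier P. g \<noteq> \<zero>\<^bsub>P\<^esub> \<longrightarrow> ev x g = \<zero> \<longrightarrow> deg R f \<le> deg R g)"

lemma min_relation_exists:
  assumes "f \<in> carrier P" "f \<noteq> \<zero>\<^bsub>P\<^esub>" "ev x f = \<zero>"
  obtains g where "min_relation x g" "deg R g \<le> deg R f"
proof -
  let ?Q = "\<lambda>g. g \<in> carrier P \<and> g \<noteq> \<zero>\<^bsub>P\<^esub> \<and> ev x g = \<zero>"
  have "?Q f" using assms by simp
  then have "?Q (arg_min (deg R) ?Q) \<and> (\<forall>g. ?Q g \<longrightarrow> deg R (arg_min (deg R) ?Q) \<le> deg R g)"
    using arg_min_nat_lemma[of ?Q f "deg R"] by blast
  then show thesis using that assms unfolding min_relation_def by blast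
qed

lemma min_relation_deg_pos:
  assumes "min_relation x f" "x \<in> carrier L"
  shows "deg R f > 0"
proof (rule ccontr)
  assume "\<not> deg R f > 0"
  moreover have f: "f \<in> carrier P" "f \<noteq> \<zero>\<^bsub>P\<^esub>" "ev x f = \<zero>"
    using assms unfolding min_relation_def by auto
  ultimately have fm: "f = up_ring.monom P (up_ring.coeff P f 0) 0"
    using D.deg_zero_impl_monom by simp
  have "ev x f = up_ring.coeff P f 0"
    using T.eval_const[OF assms(2), of "up_ring.coeff P f 0"] D.coeff_closed[OF f(1), of 0]
      arg_cong[OF fm, of "ev x"] by simp
  then show False using f fm D.monom_zero[of 0] by simp
qed

lemma pseudo_division:
  assumes "f \<in> carrier P" "g \<in> carrier P" "g \<noteq> \<zero>\<^bsub>P\<^esub>"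
  obtains q r m where "q \<in> carrier P" "r \<in> carrier P" "r = \<zero>\<^bsub>P\<^esub> \<or> deg R r < deg R g"
    "up_ring.coeff P g (deg R g) [^]\<^bsub>R\<^esub> (m::nat) \<odot>\<^bsub>P\<^esub> f = g \<otimes>\<^bsub>P\<^esub> q \<oplus>\<^bsub>P\<^esub> r"
  using D.long_div_theorem[OF assms(2,1,3)] by blast

text \<open>Pseudo-division of a relation \<open>g\<close> by \<open>f\<close> leaves remainder zero, by minimality. So \<open>f\<close> divides
  a multiple of \<open>g\<close> by a power of the leading coefficient, and that coefficient is invertible in \<open>k\<close>.\<close>

lemma relation_vanishes_at_root:
  assumes f: "min_relation x f" and x: "x \<in> carrier L" and \<phi>: "\<phi> \<in> ring_hom R k"
    and \<xi>: "\<xi> \<in> carrier k" and root: "ueval R k \<phi> \<xi> f = \<zero>\<^bsub>k\<^esub>"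
    and lc: "\<phi> (up_ring.coeff P f (deg R f)) \<noteq> \<zero>\<^bsub>k\<^esub>"
    and g: "g \<in> carrier P" "ev x g = \<zero>"
  shows "ueval R k \<phi> \<xi> g = \<zero>\<^bsub>k\<^esub>"
proof -
  interpret E: ring_hom_cring P L "ev x" by (rule ev_hom[OF x])
  interpret K: UP_pre_univ_prop R k \<phi> P
    unfolding P_def by (rule UP_pre_univ_propI) (auto intro: R.cring_axioms k.cring_axioms \<phi>)
  interpret F: ring_hom_cring P k "ueval R k \<phi> \<xi>"
    by (rule K.ring_homD, rule K.eval_ring_hom, rule \<xi>)
  have f': "f \<in> carrier P" "f \<noteq> \<zero>\<^bsub>P\<^esub>" "ev x f = \<zero>" using f unfolding min_relation_def by auto
  let ?a = "up_ring.coeff P f (deg R f)"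
  have a: "?a \<in> carrier R" using f' by (intro D.coeff_closed)
  obtain q r m where qr: "q \<in> carrier P" "r \<in> carrier P" "r = \<zero>\<^bsub>P\<^esub> \<or> deg R r < deg R f"
    and div: "?a [^]\<^bsub>R\<^esub> (m::nat) \<odot>\<^bsub>P\<^esub> g = f \<otimes>\<^bsub>P\<^esub> q \<oplus>\<^bsub>P\<^esub> r"
    using pseudo_division[OF g(1) f'(1,2)] .
  have "ev x r = \<zero>"
    using T.eval_pseudo_division[OF g(1) f'(1) qr(1,2) x a div] g f' qr a A_carrier by simp
  then have "r = \<zero>\<^bsub>P\<^esub>" using qr f unfolding min_relation_def by force
  then have "\<phi> ?a [^]\<^bsub>k\<^esub> m \<otimes>\<^bsub>k\<^esub> ueval R k \<phi> \<xi> g = \<zero>\<^bsub>k\<^esub>"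
    using K.eval_pseudo_division[OF g(1) f'(1) qr(1,2) \<xi> a div] root qr by simp
  moreover have "\<phi> ?a [^]\<^bsub>k\<^esub> m \<noteq> \<zero>\<^bsub>k\<^esub>"
    using lc a K.hom_closed[of ?a] k.nat_pow_nonzero by blast
  ultimately show ?thesis using g a K.hom_closed[of ?a] by (simp add: k.integral_iff)
qed

text \<open>This replaces the inverse of \<open>w(x)\<close> in the field generated by \<open>x\<close>. Take a nonzero multiple \<open>g(x)\<close> of \<open>w(x)\<close> with \<open>g\<close> of least degree. Pseudo-division by \<open>f\<close> shows
  \<open>deg g < deg f\<close>. If \<open>g\<close> were not constant, pseudo-division of \<open>f\<close> by \<open>g\<close> would have remainder zero, by
  minimality of \<open>g\<close>, and then the quotient would be a relation of degree less than \<open>deg f\<close>.\<close>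

lemma algebraic_multiple_in_base:
  assumes f: "min_relation x f" and x: "x \<in> carrier L" and w: "w \<in> carrier P" "ev x w \<noteq> \<zero>"
  obtains h u where "h \<in> carrier P" "u \<in> A" "u \<noteq> \<zero>" "ev x h \<otimes> ev x w = u"
proof -
  interpret E: ring_hom_cring P L "ev x" by (rule ev_hom[OF x])
  have f': "f \<in> carrier P" "f \<noteq> \<zero>\<^bsub>P\<^esub>" "ev x f = \<zero>" using f unfolding min_relation_def by auto
  define Q where "Q g \<longleftrightarrow> g \<in> carrier P \<and> ev x g \<noteq> \<zero> \<and> (\<exists>h\<in>carrier P. ev x g = ev x h \<otimes> ev x w)" for g
  have "Q w"
    unfolding Q_def using w by (auto intro!: bexI[of _ "\<one>\<^bsub>P\<^esub>"])
  then obtain g where g: "Q g" and gmin: "\<And>g'. Q g' \<Longrightarrow> deg R g \<le> deg R g'"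
    using arg_min_nat_lemma[of Q w "deg R"] by blast
  then obtain h where g'': "g \<in> carrier P" "ev x g \<noteq> \<zero>"
    and h: "h \<in> carrier P" "ev x g = ev x h \<otimes> ev x w" unfolding Q_def by blast
  then have g': "g \<in> carrier P" "ev x g \<noteq> \<zero>" "g \<noteq> \<zero>\<^bsub>P\<^esub>" by auto
  have Qr: "Q r" if "r \<in> carrier P" "q \<in> carrier P" "ev x r \<noteq> \<zero>" "ev x r = ev x q \<otimes> ev x g" for r q
    unfolding Q_def using that h w by (auto intro!: bexI[of _ "q \<otimes>\<^bsub>P\<^esub> h"] simp: m_assoc)
  have lt: "deg R g < deg R f"
  proof (rule ccontr)
    assume ge: "\<not> deg R g < deg R f"
    let ?a = "up_ring.coeff P f (deg R f)"
    have a: "?a \<in> carrier R" "?a \<noteq> \<zero>" using f' D.lcoeff_nonzero[OF f'(2,1)] D.coeff_closed[OF f'(1)] by auto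
    obtain q r m where qr: "q \<in> carrier P" "r \<in> carrier P" "r = \<zero>\<^bsub>P\<^esub> \<or> deg R r < deg R f"
      and div: "?a [^]\<^bsub>R\<^esub> (m::nat) \<odot>\<^bsub>P\<^esub> g = f \<otimes>\<^bsub>P\<^esub> q \<oplus>\<^bsub>P\<^esub> r"
      using pseudo_division[OF g'(1) f'(1,2)] .
    have a': "?a [^] m \<in> carrier L" "?a [^] m \<noteq> \<zero>" using a A_carrier nat_pow_nonzero by auto
    have er: "ev x r = ?a [^] m \<otimes> ev x g"
      using T.eval_pseudo_division[OF g'(1) f'(1) qr(1,2) x a(1) div] f' qr by simp
    have "ev x r \<noteq> \<zero>" using er a' g' by (simp add: integral_iff)
    moreover have "?a [^] m = ev x (up_ring.monom P (?a [^]\<^bsub>R\<^esub> m) 0)"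
      using T.eval_const[OF x, of "?a [^]\<^bsub>R\<^esub> m"] R.nat_pow_closed[OF a(1), of m] by (simp add: R_pow)
    ultimately have "Q r" using Qr[OF qr(2) _ _ ] er a by (metis R.nat_pow_closed D.monom_closed)
    moreover have "r \<noteq> \<zero>\<^bsub>P\<^esub>" using \<open>ev x r \<noteq> \<zero>\<close> by auto
    ultimately show False using gmin[of r] qr(3) ge by linarith
  qed
  have "deg R g = 0"
  proof (rule ccontr)
    assume pos: "deg R g \<noteq> 0"
    let ?a = "up_ring.coeff P g (deg R g)"
    have a: "?a \<in> carrier R" "?a \<noteq> \<zero>" using g' D.lcoeff_nonzero[OF g'(3,1)] D.coeff_closed[OF g'(1)] by auto
    obtain q r m where qr: "q \<in> carrier P" "r \<in> carrier P" "r = \<zero>\<^bsub>P\<^esub> \<or> deg R r < deg R g"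
      and div: "?a [^]\<^bsub>R\<^esub> (m::nat) \<odot>\<^bsub>P\<^esub> f = g \<otimes>\<^bsub>P\<^esub> q \<oplus>\<^bsub>P\<^esub> r"
      using pseudo_division[OF f'(1) g'(1,3)] .
    have a': "?a [^]\<^bsub>R\<^esub> m \<in> carrier R" "?a [^]\<^bsub>R\<^esub> m \<noteq> \<zero>"
      using a R.nat_pow_nonzero[of ?a m] R.nat_pow_closed[of ?a m] by auto
    have sum: "ev x g \<otimes> ev x q \<oplus> ev x r = \<zero>"
      using T.eval_pseudo_division[OF f'(1) g'(1) qr(1,2) x a(1) div] f' a A_carrier by simp
    have "ev x r = \<zero>"
    proof (rule ccontr)
      assume nz: "ev x r \<noteq> \<zero>"
      have "ev x r = \<ominus> (ev x g \<otimes> ev x q)"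
        using sum g' qr by (metis E.hom_closed add.m_comm m_closed minus_equality)
      then have "ev x r = ev x (\<ominus>\<^bsub>P\<^esub> q) \<otimes> ev x g"
        using g' qr by (simp add: m_comm r_minus l_minus)
      then have "Q r" using Qr[OF qr(2) _ nz] qr by (metis D.UP_a_inv_closed)
      then show False using gmin[of r] qr(3) nz by auto
    qed
    then have eq: "ev x q = \<zero>" using sum g' qr by (simp add: integral_iff)
    have "r = \<zero>\<^bsub>P\<^esub>" using f qr \<open>ev x r = \<zero>\<close> lt unfolding min_relation_def by force
    then have fq: "?a [^]\<^bsub>R\<^esub> m \<odot>\<^bsub>P\<^esub> f = g \<otimes>\<^bsub>P\<^esub> q" using div g' qr by simp
    have dgf: "deg R (g \<otimes>\<^bsub>P\<^esub> q) = deg R f"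
      using fq D.deg_smult[OF a'(1) f'(1)] a' by simp
    have "g \<otimes>\<^bsub>P\<^esub> q \<noteq> \<zero>\<^bsub>P\<^esub>"
      using dgf min_relation_deg_pos[OF f x] D.deg_nzero_nzero by auto
    then have "q \<noteq> \<zero>\<^bsub>P\<^esub>" using g' by auto
    then have "deg R f \<le> deg R q" "deg R f = deg R g + deg R q"
      using f eq qr D.deg_mult[OF g'(3) _ g'(1) qr(1)] dgf unfolding min_relation_def by auto
    then show False using pos by simp
  qed
  then have "g = up_ring.monom P (up_ring.coeff P g 0) 0"
    using D.deg_zero_impl_monom[OF g'(1)] by simp
  then have "ev x g = up_ring.coeff P g 0"
    using T.eval_const[OF x, of "up_ring.coeff P g 0"] D.coeff_closed[OF g'(1)] by simp
  moreover have "up_ring.coeff P g 0 \<in> A" using D.coeff_closed[OF g'(1)] by simp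
  ultimately show thesis using that[OF h(1), of "up_ring.coeff P g 0"] g' h by metis
qed

end

context subring_adjoin
begin

text \<open>The witness \<open>u\<close> is the product of the leading coefficient of \<open>f\<close> with a multiple of \<open>v\<close> that
  lies in \<open>A\<close>: if \<open>\<phi>\<close> does not kill it, every root \<open>\<xi>\<close> of the image of \<open>f\<close> gives an extension, and the
  extension cannot kill the divisor \<open>v\<close> of \<open>u\<close>. The last conjunct computes the extension on
  polynomials in \<open>x\<close>; \<open>extend_separable\<close> applies it to the derivative of \<open>f\<close>.\<close>

lemma extend_algebraic:
  assumes f: "min_relation x f" and x: "x \<in> carrier L" and v: "v \<in> adjoin x" "v \<noteq> \<zero>"
  obtains u where "u \<in> A" "u \<noteq> \<zero>"
    "\<And>\<phi>. \<phi> \<in> ring_hom R k \<Longrightarrow> \<phi> u \<noteq> \<zero>\<^bsub>k\<^esub> \<Longrightarrow> \<phi> (up_ring.coeff P f (deg R f)) \<noteq> \<zero>\<^bsub>k\<^esub>"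
    "\<And>\<phi> \<xi>. \<phi> \<in> ring_hom R k \<Longrightarrow> \<phi> u \<noteq> \<zero>\<^bsub>k\<^esub> \<Longrightarrow> \<xi> \<in> carrier k \<Longrightarrow>
      ueval R k \<phi> \<xi> f = \<zero>\<^bsub>k\<^esub> \<Longrightarrow>
      \<exists>\<psi>\<in>ring_hom (adj x) k. (\<forall>a\<in>A. \<psi> a = \<phi> a) \<and> \<psi> x = \<xi> \<and> \<psi> v \<noteq> \<zero>\<^bsub>k\<^esub> \<and>
        (\<forall>g\<in>carrier P. \<psi> (ev x g) = ueval R k \<phi> \<xi> g)"
proof -
  let ?a = "up_ring.coeff P f (deg R f)"
  have f': "f \<in> carrier P" "f \<noteq> \<zero>\<^bsub>P\<^esub>" "ev x f = \<zero>" using f unfolding min_relation_def by auto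
  have a: "?a \<in> A" "?a \<noteq> \<zero>" using f' D.lcoeff_nonzero[OF f'(2,1)] D.coeff_closed[OF f'(1)] by auto
  obtain w where w: "w \<in> carrier P" "v = ev x w" using v unfolding adjoin_def by blast
  obtain h u where h: "h \<in> carrier P" and u: "u \<in> A" "u \<noteq> \<zero>" "ev x h \<otimes> ev x w = u"
    using algebraic_multiple_in_base[OF f x w(1)] v(2) w(2) by metis
  have au: "?a \<otimes> u \<in> A" "?a \<otimes> u \<noteq> \<zero>"
    using a u R.m_closed[of ?a u] A_carrier by (auto simp: integral_iff)
  have hom: "\<phi> ?a \<noteq> \<zero>\<^bsub>k\<^esub> \<and> \<phi> u \<noteq> \<zero>\<^bsub>k\<^esub>"
    if "\<phi> \<in> ring_hom R k" "\<phi> (?a \<otimes> u) \<noteq> \<zero>\<^bsub>k\<^esub>" for \<phi>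
  proof -
    have "\<phi> (?a \<otimes> u) = \<phi> ?a \<otimes>\<^bsub>k\<^esub> \<phi> u" "\<phi> ?a \<in> carrier k" "\<phi> u \<in> carrier k"
      using ring_hom_mult[OF that(1), of ?a u] ring_hom_closed[OF that(1)] a u by auto
    then show ?thesis using that(2) by auto
  qed
  show thesis
  proof (rule that[OF au])
    fix \<phi> \<xi>
    assume \<phi>: "\<phi> \<in> ring_hom R k" "\<phi> (?a \<otimes> u) \<noteq> \<zero>\<^bsub>k\<^esub>" and \<xi>: "\<xi> \<in> carrier k"
      and root: "ueval R k \<phi> \<xi> f = \<zero>\<^bsub>k\<^esub>"
    obtain \<psi> where \<psi>: "\<psi> \<in> ring_hom (adj x) k" "\<And>a. a \<in> A \<Longrightarrow> \<psi> a = \<phi> a" "\<psi> x = \<xi>"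
      "\<And>g. g \<in> carrier P \<Longrightarrow> \<psi> (ev x g) = ueval R k \<phi> \<xi> g"
      by (rule extend_to_adjoin[OF x \<phi>(1) \<xi> relation_vanishes_at_root[OF f x \<phi>(1) \<xi> root]])
        (use hom[OF \<phi>] in auto)
    have "\<psi> (ev x h) \<otimes>\<^bsub>k\<^esub> \<psi> v = \<phi> u"
      using ring_hom_mult[OF \<psi>(1), of "ev x h" v] u w h \<psi>(2)[of u] unfolding adjoin_def by simp
    moreover have "\<psi> (ev x h) \<in> carrier k"
      using ring_hom_closed[OF \<psi>(1), of "ev x h"] h unfolding adjoin_def by simp
    ultimately have "\<psi> v \<noteq> \<zero>\<^bsub>k\<^esub>" using hom[OF \<phi>] by auto
    with \<psi> show "\<exists>\<psi>\<in>ring_hom (adj x) k. (\<forall>a\<in>A. \<psi> a = \<phi> a) \<and> \<psi> x = \<xi> \<and>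
        \<psi> v \<noteq> \<zero>\<^bsub>k\<^esub> \<and> (\<forall>g\<in>carrier P. \<psi> (ev x g) = ueval R k \<phi> \<xi> g)" by blast
  qed (use hom in blast)
qed

lemma mapped_polynomial:
  assumes \<phi>: "\<phi> \<in> ring_hom R k" and f: "f \<in> carrier P"
    and lc: "\<phi> (up_ring.coeff P f (deg R f)) \<noteq> \<zero>\<^bsub>k\<^esub>"
  obtains F where "F \<in> carrier (UP k)" "deg k F = deg R f" "F \<noteq> \<zero>\<^bsub>UP k\<^esub>"
    "\<And>\<xi>. \<xi> \<in> carrier k \<Longrightarrow> ueval k k id \<xi> F = ueval R k \<phi> \<xi> f"
    "\<And>\<xi>. \<xi> \<in> carrier k \<Longrightarrow>
      ueval k k id \<xi> (k.formal_deriv F) = ueval R k \<phi> \<xi> (R.formal_deriv f)"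
proof -
  interpret K: UP_pre_univ_prop R k \<phi> P
    unfolding P_def by (rule UP_pre_univ_propI) (auto intro: R.cring_axioms k.cring_axioms \<phi>)
  interpret U: UP_cring k "UP k" by unfold_locales
  let ?F = "\<lambda>i. \<phi> (up_ring.coeff P f i)"
  have F: "?F \<in> carrier (UP k)" using K.map_coeffs(1)[OF f, of "\<zero>\<^bsub>k\<^esub>"] by simp
  have cF: "up_ring.coeff (UP k) ?F = ?F" using UP_coeff[OF F] .
  have d: "deg k ?F = deg R f"
  proof (rule antisym)
    show "deg k ?F \<le> deg R f" using K.map_coeffs(2)[OF f, of "\<zero>\<^bsub>k\<^esub>"] by simp
    show "deg R f \<le> deg k ?F"
      by (rule U.deg_belowI[OF _ F]) (simp add: cF lc)
  qed
  have nz: "?F \<noteq> \<zero>\<^bsub>UP k\<^esub>" using lc cF U.coeff_zero by metis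
  have f'': "R.formal_deriv f \<in> carrier P" using D.formal_deriv(1)[OF f] .
  have "k.formal_deriv ?F = (\<lambda>i. \<phi> (up_ring.coeff P (R.formal_deriv f) i))"
  proof
    fix i
    have n: "\<phi> ([n] \<cdot>\<^bsub>R\<^esub> c) = [n] \<cdot>\<^bsub>k\<^esub> \<phi> c" if "c \<in> carrier R" for n :: nat and c
      using that by (induction n) (auto simp del: R_simps)
    show "k.formal_deriv ?F i = \<phi> (up_ring.coeff P (R.formal_deriv f) i)"
      unfolding k.formal_deriv_def D.formal_deriv(3)[OF f]
      using n[of "up_ring.coeff P f (Suc i)" "Suc i"] D.coeff_closed[OF f, of "Suc i"] by simp
  qed
  then show thesis
    using that[OF F d nz K.map_coeffs(3)[OF f]] K.map_coeffs(3)[OF f''] by presburger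
qed

text \<open>Every \<open>\<xi> \<in> k\<close> gives an extension with value \<open>\<xi>\<close> at \<open>x\<close>. Writing \<open>v = w(x)\<close>, it does not kill \<open>v\<close>
  if \<open>\<xi>\<close> is not a root of the image of \<open>w\<close>, which is a nonzero polynomial as soon as \<open>\<phi>\<close> does not kill the
  leading coefficient of \<open>w\<close>.\<close>

lemma extend_transcendental:
  assumes x: "x \<in> carrier L" and trans: "\<And>f. f \<in> carrier P \<Longrightarrow> ev x f = \<zero> \<Longrightarrow> f = \<zero>\<^bsub>P\<^esub>"
    and v: "v \<in> adjoin x" "v \<noteq> \<zero>"
  obtains u where "u \<in> A" "u \<noteq> \<zero>"
    "\<And>\<phi>. \<phi> \<in> ring_hom R k \<Longrightarrow> \<phi> u \<noteq> \<zero>\<^bsub>k\<^esub> \<Longrightarrow> two_ext x v \<phi>"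
proof -
  interpret E: ring_hom_cring P L "ev x" by (rule ev_hom[OF x])
  obtain w where w: "w \<in> carrier P" "v = ev x w" using v unfolding adjoin_def by blast
  have wnz: "w \<noteq> \<zero>\<^bsub>P\<^esub>" using w v by auto
  let ?a = "up_ring.coeff P w (deg R w)"
  have a: "?a \<in> A" "?a \<noteq> \<zero>" using w D.lcoeff_nonzero[OF wnz w(1)] D.coeff_closed[OF w(1)] by auto
  show thesis
  proof (rule that[OF a])
    fix \<phi> assume \<phi>: "\<phi> \<in> ring_hom R k" "\<phi> ?a \<noteq> \<zero>\<^bsub>k\<^esub>"
    interpret K: UP_pre_univ_prop R k \<phi> P
      unfolding P_def by (rule UP_pre_univ_propI) (auto intro: R.cring_axioms k.cring_axioms \<phi>)
    obtain F where F: "F \<in> carrier (UP k)" "F \<noteq> \<zero>\<^bsub>UP k\<^esub>"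
      "\<And>\<xi>. \<xi> \<in> carrier k \<Longrightarrow> ueval k k id \<xi> F = ueval R k \<phi> \<xi> w"
      by (rule mapped_polynomial[OF \<phi>(1) w(1) \<phi>(2)]) (rule that; blast)
    obtain \<xi>1 \<xi>2 where \<xi>: "\<xi>1 \<in> carrier k" "\<xi>2 \<in> carrier k" "\<xi>1 \<noteq> \<xi>2"
      "ueval R k \<phi> \<xi>1 w \<noteq> \<zero>\<^bsub>k\<^esub>" "ueval R k \<phi> \<xi>2 w \<noteq> \<zero>\<^bsub>k\<^esub>"
      by (rule k.exists_two_nonroots[OF F(1,2)]) (simp add: F(3))
    have ext: "\<exists>\<psi>\<in>ring_hom (adj x) k. (\<forall>a\<in>A. \<psi> a = \<phi> a) \<and> \<psi> x = \<xi> \<and>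
        \<psi> v = ueval R k \<phi> \<xi> w" if \<xi>: "\<xi> \<in> carrier k" for \<xi>
    proof -
      interpret F: ring_hom_cring P k "ueval R k \<phi> \<xi>"
        by (rule K.ring_homD, rule K.eval_ring_hom, rule \<xi>)
      obtain \<psi> where "\<psi> \<in> ring_hom (adj x) k" "\<And>a. a \<in> A \<Longrightarrow> \<psi> a = \<phi> a" "\<psi> x = \<xi>"
        "\<And>g. g \<in> carrier P \<Longrightarrow> \<psi> (ev x g) = ueval R k \<phi> \<xi> g"
        by (rule extend_to_adjoin[OF x \<phi>(1) \<xi>]) (use trans F.hom_zero in auto)
      then show ?thesis using w by blast
    qed
    show "two_ext x v \<phi>"
      using ext[OF \<xi>(1)] ext[OF \<xi>(2)] \<xi>(3-5) by metis
  qed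
qed

lemma extend_one_step:
  assumes x: "x \<in> carrier L" and v: "v \<in> adjoin x" "v \<noteq> \<zero>"
  obtains u where "u \<in> A" "u \<noteq> \<zero>"
    "\<And>\<phi>. \<phi> \<in> ring_hom R k \<Longrightarrow> \<phi> u \<noteq> \<zero>\<^bsub>k\<^esub> \<Longrightarrow>
      \<exists>\<psi>\<in>ring_hom (adj x) k. (\<forall>a\<in>A. \<psi> a = \<phi> a) \<and> \<psi> v \<noteq> \<zero>\<^bsub>k\<^esub>"
proof (cases "\<exists>f\<in>carrier P. f \<noteq> \<zero>\<^bsub>P\<^esub> \<and> ev x f = \<zero>")
  case False
  then have tr: "f = \<zero>\<^bsub>P\<^esub>" if "f \<in> carrier P" "ev x f = \<zero>" for f using that by blast
  obtain u where "u \<in> A" "u \<noteq> \<zero>" "\<And>\<phi>. \<phi> \<in> ring_hom R k \<Longrightarrow> \<phi> u \<noteq> \<zero>\<^bsub>k\<^esub> \<Longrightarrow> two_ext x v \<phi>"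
    by (rule extend_transcendental[OF x tr v]) (assumption+, (rule that; blast))
  then show thesis by (intro that[of u]) metis+
next
  case True
  then obtain f where f: "min_relation x f" using min_relation_exists by metis
  have f': "f \<in> carrier P" using f unfolding min_relation_def by auto
  obtain u where u: "u \<in> A" "u \<noteq> \<zero>"
    and lc: "\<And>\<phi>. \<phi> \<in> ring_hom R k \<Longrightarrow> \<phi> u \<noteq> \<zero>\<^bsub>k\<^esub> \<Longrightarrow> \<phi> (up_ring.coeff P f (deg R f)) \<noteq> \<zero>\<^bsub>k\<^esub>"
    and ext: "\<And>\<phi> \<xi>. \<phi> \<in> ring_hom R k \<Longrightarrow> \<phi> u \<noteq> \<zero>\<^bsub>k\<^esub> \<Longrightarrow> \<xi> \<in> carrier k \<Longrightarrow>
      ueval R k \<phi> \<xi> f = \<zero>\<^bsub>k\<^esub> \<Longrightarrow>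
      \<exists>\<psi>\<in>ring_hom (adj x) k. (\<forall>a\<in>A. \<psi> a = \<phi> a) \<and> \<psi> x = \<xi> \<and> \<psi> v \<noteq> \<zero>\<^bsub>k\<^esub> \<and>
        (\<forall>g\<in>carrier P. \<psi> (ev x g) = ueval R k \<phi> \<xi> g)"
    by (rule extend_algebraic[OF f x v]) (rule that; blast)
  show thesis
  proof (rule that[OF u])
    fix \<phi> assume \<phi>: "\<phi> \<in> ring_hom R k" "\<phi> u \<noteq> \<zero>\<^bsub>k\<^esub>"
    obtain F where F: "F \<in> carrier (UP k)" "deg k F = deg R f"
      "\<And>\<xi>. \<xi> \<in> carrier k \<Longrightarrow> ueval k k id \<xi> F = ueval R k \<phi> \<xi> f"
      by (rule mapped_polynomial[OF \<phi>(1) f' lc[OF \<phi>]]) (rule that; blast)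
    obtain \<xi> where "\<xi> \<in> carrier k" "ueval R k \<phi> \<xi> f = \<zero>\<^bsub>k\<^esub>"
      using k.exists_root[OF F(1)] F(2,3) min_relation_deg_pos[OF f x] by force
    then show "\<exists>\<psi>\<in>ring_hom (adj x) k. (\<forall>a\<in>A. \<psi> a = \<phi> a) \<and> \<psi> v \<noteq> \<zero>\<^bsub>k\<^esub>"
      using ext[OF \<phi>] by blast
  qed
qed

text \<open>Minimality of \<open>f\<close> gives \<open>f'(x) \<noteq> 0\<close>, so \<open>v f'(x)\<close> can be kept alive in place of \<open>v\<close>. Then a root
  of the image of \<open>f\<close> is simple, and as the degree is at least two there is another root, which gives
  the second extension.\<close>

lemma extend_separable:
  assumes f: "min_relation x f" and x: "x \<in> carrier L" and d: "deg R f \<ge> 2"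
    and sep: "R.formal_deriv f \<noteq> \<zero>\<^bsub>P\<^esub>" and v: "v \<in> adjoin x" "v \<noteq> \<zero>"
  obtains u where "u \<in> A" "u \<noteq> \<zero>"
    "\<And>\<phi>. \<phi> \<in> ring_hom R k \<Longrightarrow> \<phi> u \<noteq> \<zero>\<^bsub>k\<^esub> \<Longrightarrow> two_ext x v \<phi>"
proof -
  interpret E: ring_hom_cring P L "ev x" by (rule ev_hom[OF x])
  have f': "f \<in> carrier P" using f unfolding min_relation_def by auto
  let ?f' = "R.formal_deriv f"
  have f'': "?f' \<in> carrier P" "deg R ?f' < deg R f"
    using D.formal_deriv(1,2)[OF f'] d by auto
  have df: "ev x ?f' \<noteq> \<zero>" using f f'' sep unfolding min_relation_def by force
  obtain w where w: "w \<in> carrier P" "v = ev x w" using v unfolding adjoin_def by blast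
  define v' where "v' = v \<otimes> ev x ?f'"
  have v': "v' \<in> adjoin x" "v' \<noteq> \<zero>"
  proof -
    have eq: "v' = ev x (w \<otimes>\<^bsub>P\<^esub> ?f')" using w f'' unfolding v'_def by simp
    show "v' \<in> adjoin x" unfolding adjoin_def eq by (rule imageI) (use w f'' in simp)
    show "v' \<noteq> \<zero>" using v df w f'' unfolding v'_def by (simp add: integral_iff)
  qed
  obtain u where u: "u \<in> A" "u \<noteq> \<zero>"
    and lc: "\<And>\<phi>. \<phi> \<in> ring_hom R k \<Longrightarrow> \<phi> u \<noteq> \<zero>\<^bsub>k\<^esub> \<Longrightarrow> \<phi> (up_ring.coeff P f (deg R f)) \<noteq> \<zero>\<^bsub>k\<^esub>"
    and ext: "\<And>\<phi> \<xi>. \<phi> \<in> ring_hom R k \<Longrightarrow> \<phi> u \<noteq> \<zero>\<^bsub>k\<^esub> \<Longrightarrow> \<xi> \<in> carrier k \<Longrightarrow>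
      ueval R k \<phi> \<xi> f = \<zero>\<^bsub>k\<^esub> \<Longrightarrow>
      \<exists>\<psi>\<in>ring_hom (adj x) k. (\<forall>a\<in>A. \<psi> a = \<phi> a) \<and> \<psi> x = \<xi> \<and> \<psi> v' \<noteq> \<zero>\<^bsub>k\<^esub> \<and>
        (\<forall>g\<in>carrier P. \<psi> (ev x g) = ueval R k \<phi> \<xi> g)"
    by (rule extend_algebraic[OF f x v']) (rule that; blast)
  show thesis
  proof (rule that[OF u])
    fix \<phi> assume \<phi>: "\<phi> \<in> ring_hom R k" "\<phi> u \<noteq> \<zero>\<^bsub>k\<^esub>"
    obtain F where F: "F \<in> carrier (UP k)" "deg k F = deg R f"
      "\<And>\<xi>. \<xi> \<in> carrier k \<Longrightarrow> ueval k k id \<xi> F = ueval R k \<phi> \<xi> f"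
      "\<And>\<xi>. \<xi> \<in> carrier k \<Longrightarrow>
        ueval k k id \<xi> (k.formal_deriv F) = ueval R k \<phi> \<xi> ?f'"
      by (rule mapped_polynomial[OF \<phi>(1) f' lc[OF \<phi>]]) (rule that; blast)
    have split: "\<psi> v \<noteq> \<zero>\<^bsub>k\<^esub> \<and> \<psi> (ev x ?f') \<noteq> \<zero>\<^bsub>k\<^esub>"
      if "\<psi> \<in> ring_hom (adj x) k" "\<psi> v' \<noteq> \<zero>\<^bsub>k\<^esub>" for \<psi>
    proof -
      have e: "ev x ?f' \<in> adjoin x" using f'' unfolding adjoin_def by simp
      have "\<psi> v' = \<psi> v \<otimes>\<^bsub>k\<^esub> \<psi> (ev x ?f')" "\<psi> v \<in> carrier k" "\<psi> (ev x ?f') \<in> carrier k"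
        using ring_hom_mult[OF that(1), of v "ev x ?f'"] ring_hom_closed[OF that(1)] v e
        unfolding v'_def by auto
      then show ?thesis using that(2) by auto
    qed
    obtain \<xi>1 where \<xi>1: "\<xi>1 \<in> carrier k" "ueval R k \<phi> \<xi>1 f = \<zero>\<^bsub>k\<^esub>"
      using k.exists_root[OF F(1)] F(2,3) d by force
    obtain \<psi>1 where \<psi>1: "\<psi>1 \<in> ring_hom (adj x) k" "\<forall>a\<in>A. \<psi>1 a = \<phi> a" "\<psi>1 x = \<xi>1"
      "\<psi>1 v' \<noteq> \<zero>\<^bsub>k\<^esub>" "\<forall>g\<in>carrier P. \<psi>1 (ev x g) = ueval R k \<phi> \<xi>1 g"
      using ext[OF \<phi> \<xi>1] by blast
    have "ueval k k id \<xi>1 (k.formal_deriv F) \<noteq> \<zero>\<^bsub>k\<^esub>"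
      using split[OF \<psi>1(1,4)] \<psi>1(5) f'' F(4)[OF \<xi>1(1)] by auto
    then obtain \<xi>2 where \<xi>2: "\<xi>2 \<in> carrier k" "\<xi>2 \<noteq> \<xi>1" "ueval R k \<phi> \<xi>2 f = \<zero>\<^bsub>k\<^esub>"
      using k.simple_root_imp_another_root[OF F(1) _ \<xi>1(1)] F(2,3) \<xi>1 d by metis
    obtain \<psi>2 where \<psi>2: "\<psi>2 \<in> ring_hom (adj x) k" "\<forall>a\<in>A. \<psi>2 a = \<phi> a" "\<psi>2 x = \<xi>2"
      "\<psi>2 v' \<noteq> \<zero>\<^bsub>k\<^esub>"
      using ext[OF \<phi> \<xi>2(1,3)] by blast
    show "two_ext x v \<phi>"
      using \<psi>1 \<psi>2 \<xi>2(2) split[OF \<psi>1(1,4)] split[OF \<psi>2(1,4)] by metis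
  qed
qed

end

section \<open>Separating an element that is not purely inseparable\<close>

lemma (in field) ring_char_pos:
  assumes "ring_char R = p" "p > 0"
  shows "[n] \<cdot> \<one> = \<zero> \<longleftrightarrow> p dvd n" "p \<ge> 2"
proof -
  let ?Q = "\<lambda>n::nat. n > 0 \<and> [n] \<cdot> \<one> = \<zero>"
  have ex: "\<exists>n. ?Q n" and p: "p = Least ?Q"
    using assms unfolding ring_char_def by (auto split: if_splits)
  have p0: "[p] \<cdot> \<one> = \<zero>" using LeastI_ex[OF ex] p by simp
  have mult: "[(p * m)] \<cdot> \<one> = \<zero>" for m :: nat
    using p0 add.nat_pow_pow[of \<one> m p] add.nat_pow_one by (simp add: mult.commute)
  show "[n] \<cdot> \<one> = \<zero> \<longleftrightarrow> p dvd n"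
  proof
    assume n: "[n] \<cdot> \<one> = \<zero>"
    have "[n] \<cdot> \<one> = [(p * (n div p))] \<cdot> \<one> \<oplus> [(n mod p)] \<cdot> \<one>"
      using add.nat_pow_mult[of \<one> "p * (n div p)" "n mod p"] by simp
    then have "[(n mod p)] \<cdot> \<one> = \<zero>" using n mult by simp
    moreover have "n mod p < p" using assms(2) by simp
    ultimately have "n mod p = 0" using not_less_Least[of "n mod p" ?Q] p by auto
    then show "p dvd n" by auto
  qed (use mult in \<open>auto elim!: dvdE\<close>)
  have "p \<noteq> 1" using p0 by auto
  then show "p \<ge> 2" using assms(2) by simp
qed

lemma field_hom_inj:
  assumes "field k" "field L" "h \<in> ring_hom k L"
  shows "inj_on h (carrier k)"
  using assms non_trivial_field_hom_is_inj by blast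

lemma ring_char_field_hom:
  assumes "field k" "field L" "h \<in> ring_hom k L"
  shows "ring_char L = ring_char k"
proof -
  interpret k: field k by fact
  interpret L: field L by fact
  interpret h: ring_hom_cring k L h by unfold_locales (rule assms(3))
  have h1: "h ([n] \<cdot>\<^bsub>k\<^esub> \<one>\<^bsub>k\<^esub>) = [n] \<cdot>\<^bsub>L\<^esub> \<one>\<^bsub>L\<^esub>" for n :: nat
    by (induction n) auto
  have "[n] \<cdot>\<^bsub>k\<^esub> \<one>\<^bsub>k\<^esub> = \<zero>\<^bsub>k\<^esub> \<longleftrightarrow> [n] \<cdot>\<^bsub>L\<^esub> \<one>\<^bsub>L\<^esub> = \<zero>\<^bsub>L\<^esub>" for n :: nat
    using inj_onD[OF field_hom_inj[OF assms], of "[n] \<cdot>\<^bsub>k\<^esub> \<one>\<^bsub>k\<^esub>" "\<zero>\<^bsub>k\<^esub>"] h1[of n] by auto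
  then show ?thesis unfolding ring_char_def by presburger
qed

context subring_adjoin
begin

lemma add_pow_R: "a \<in> A \<Longrightarrow> [n] \<cdot>\<^bsub>R\<^esub> a = [(n::nat)] \<cdot> a"
  by (induction n) (simp_all add: A_carrier)

text \<open>If no power \<open>\<alpha> [^] (p ^ n)\<close> satisfies a relation, \<open>n = 0\<close> will do. Otherwise, among all relations of powers \<open>\<alpha> [^] (p ^ n)\<close>, take one of least degree, say \<open>f(x) = 0\<close>. Its degree is
  not one because \<open>x\<close> is not a fraction of elements of \<open>A\<close>. If the derivative of \<open>f\<close> vanished, \<open>f\<close> would be
  a polynomial in \<open>X ^ p\<close> and \<open>x [^] p\<close> would satisfy a relation of smaller degree.\<close>

lemma exists_separable_power:
  assumes \<alpha>: "\<alpha> \<in> carrier L" and char: "ring_char L = p" "p > 0"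
    and nfrac: "\<And>n a b. a \<in> A \<Longrightarrow> b \<in> A \<Longrightarrow> b \<noteq> \<zero> \<Longrightarrow> b \<otimes> \<alpha> [^] (p ^ n) \<noteq> a"
  obtains n where "\<And>f. f \<in> carrier P \<Longrightarrow> ev (\<alpha> [^] (p ^ n :: nat)) f = \<zero> \<Longrightarrow> f = \<zero>\<^bsub>P\<^esub>"
  | n f where "min_relation (\<alpha> [^] (p ^ n :: nat)) f" "deg R f \<ge> 2" "R.formal_deriv f \<noteq> \<zero>\<^bsub>P\<^esub>"
proof (cases "\<exists>n f. min_relation (\<alpha> [^] (p ^ n :: nat)) f")
  case False
  then have "f = \<zero>\<^bsub>P\<^esub>" if "f \<in> carrier P" "ev (\<alpha> [^] (p ^ 0 :: nat)) f = \<zero>" for f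
    using min_relation_exists[OF that(1) _ that(2)] by metis
  then show thesis using that(1)[of 0] by blast
next
  case True
  define Q where "Q = (\<lambda>(n, f). min_relation (\<alpha> [^] (p ^ n :: nat)) f)"
  obtain nf where "Q nf" using True unfolding Q_def by auto
  then obtain nf where nf: "Q nf" "\<And>z. Q z \<Longrightarrow> deg R (snd nf) \<le> deg R (snd z)"
    using arg_min_nat_lemma[of Q nf "\<lambda>z. deg R (snd z)"] by blast
  obtain n f where [simp]: "nf = (n, f)" by fastforce
  define x where "x = \<alpha> [^] (p ^ n :: nat)"
  have x: "x \<in> carrier L" unfolding x_def using \<alpha> by simp
  have f: "min_relation x f" using nf(1) unfolding Q_def x_def by simp
  have fmin: "deg R f \<le> deg R g" if "min_relation (\<alpha> [^] (p ^ m :: nat)) g" for m g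
    using nf(2)[of "(m, g)"] that unfolding Q_def by simp
  have f': "f \<in> carrier P" "f \<noteq> \<zero>\<^bsub>P\<^esub>" "ev x f = \<zero>" using f unfolding min_relation_def by auto
  let ?c = "up_ring.coeff P f"
  have c: "?c i \<in> A" for i using D.coeff_closed[OF f'(1), of i] by simp
  note p = field.ring_char_pos[OF field_axioms char]
  have "deg R f \<noteq> 1"
  proof
    assume d: "deg R f = 1"
    have "?c 1 \<noteq> \<zero>" using D.lcoeff_nonzero[OF f'(2,1)] d by simp
    moreover have "?c 0 \<oplus> ?c 1 \<otimes> x = \<zero>"
      using T.eval_upto[OF x f'(1), of 1] d f'(3) c A_carrier x
      by (simp add: add.m_comm)
    then have "?c 1 \<otimes> x = \<ominus> ?c 0" using c A_carrier x by (metis m_closed minus_equality minus_minus a_comm)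
    moreover have "\<ominus> ?c 0 \<in> A" using subringE(5)[OF subring] c by blast
    ultimately show False using nfrac[OF _ c, of _ 1 n] x_def by blast
  qed
  then have d: "deg R f \<ge> 2" using min_relation_deg_pos[OF f x] by simp
  have "R.formal_deriv f \<noteq> \<zero>\<^bsub>P\<^esub>"
  proof
    assume z: "R.formal_deriv f = \<zero>\<^bsub>P\<^esub>"
    have supp: "p dvd i" if "?c i \<noteq> \<zero>" for i
    proof (cases i)
      case (Suc j)
      have "[Suc j] \<cdot>\<^bsub>R\<^esub> ?c (Suc j) = \<zero>\<^bsub>R\<^esub>"
        using D.formal_deriv(3)[OF f'(1), of j] z D.coeff_zero[of j] by simp
      then have "[i] \<cdot> ?c i = \<zero>" using add_pow_R[OF c] Suc by (simp del: add.nat_pow_Suc)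
      moreover have "[i] \<cdot> ?c i = [i] \<cdot> \<one> \<otimes> ?c i"
        using c A_carrier add_pow_ldistr[of \<one> "?c i" i] by simp
      ultimately have "[i] \<cdot> \<one> = \<zero>" using that c A_carrier by (simp add: integral_iff)
      then show ?thesis using p by simp
    qed simp
    let ?h = "\<lambda>i. ?c (p * i)"
    have ch: "?c i = \<zero>" if "i > deg R f" for i using D.deg_aboveD[OF that f'(1)] by simp
    have le: "p * i > deg R f" if "i > deg R f div p" for i
      using that char(2) by (simp add: div_less_iff_less_mult mult.commute)
    have "?h \<in> carrier (UP R)"
      by (rule UP_memI[of _ _ "deg R f div p"]) (use c ch le in auto)
    then have h: "?h \<in> carrier P" by (simp only: P_def)
    have hc: "up_ring.coeff P ?h = ?h" using UP_coeff h unfolding P_def by blast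
    have dh: "deg R ?h \<le> deg R f div p"
      by (rule D.deg_aboveI[OF _ h]) (simp add: hc ch le)
    have hnz: "?h \<noteq> \<zero>\<^bsub>P\<^esub>"
    proof
      assume "?h = \<zero>\<^bsub>P\<^esub>"
      then have "?h (deg R f div p) = \<zero>" using hc D.coeff_zero by (metis R_simps(3))
      moreover have "p dvd deg R f" using supp D.lcoeff_nonzero[OF f'(2,1)] by simp
      ultimately show False using D.lcoeff_nonzero[OF f'(2,1)] by simp
    qed
    have xp: "x [^] p \<in> carrier L" using x by simp
    have "ev (x [^] p) ?h = (\<Oplus>i\<in>{..deg R f}. ?c (p * i) \<otimes> x [^] (p * i))"
      using T.eval_upto[OF xp h, of "deg R f"] dh x
      by (simp add: hc nat_pow_pow) (meson div_le_dividend le_trans)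
    also have "\<dots> = (\<Oplus>j\<in>(\<lambda>i. p * i) ` {..deg R f}. ?c j \<otimes> x [^] j)"
      using c A_carrier x char(2) by (subst add.finprod_reindex) (auto simp: inj_on_def)
    also have "\<dots> = (\<Oplus>j\<in>{..p * deg R f}. ?c j \<otimes> x [^] j)"
    proof (rule add.finprod_mono_neutral_cong_left)
      fix i assume i: "i \<in> {..p * deg R f} - (\<lambda>i. p * i) ` {..deg R f}"
      have "?c i = \<zero>"
      proof (rule ccontr)
        assume "?c i \<noteq> \<zero>"
        then obtain j where "i = p * j" using supp by blast
        then show False using i char(2) by auto
      qed
      then show "?c i \<otimes> x [^] i = \<zero>" using x by simp
    qed (use c A_carrier x in auto)
    also have "\<dots> = ev x f"
      using T.eval_upto[OF x f'(1), of "p * deg R f"] char(2) by simp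
    finally have "ev (x [^] p) ?h = \<zero>" using f' by simp
    then obtain g where g: "min_relation (x [^] p) g" "deg R g \<le> deg R ?h"
      using min_relation_exists[OF h hnz] by blast
    moreover have "x [^] p = \<alpha> [^] (p ^ Suc n)" unfolding x_def using \<alpha> by (simp add: nat_pow_pow mult.commute)
    ultimately have "deg R f \<le> deg R f div p" using fmin[of "Suc n" g] dh by simp
    moreover have "deg R f div p < deg R f" using p(2) d by (intro div_less_dividend) auto
    ultimately show False by simp
  qed
  then show thesis using that(2) f d x_def by blast
qed

end

lemma subring_adjoin_intro:
  assumes "field L" "algebraically_closed k" "subring A L"
  shows "subring_adjoin L k A"
  using assms unfolding subring_adjoin_def subring_adjoin_axioms_def by simp

lemma (in ring) generate_ring_union:
  assumes "H \<subseteq> carrier R" "K \<subseteq> carrier R"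
  shows "generate_ring R (generate_ring R H \<union> K) = generate_ring R (H \<union> K)"
proof
  have HK: "H \<union> K \<subseteq> carrier R" and gH: "generate_ring R H \<subseteq> carrier R"
    using assms generate_ring_incl by auto
  show "generate_ring R (generate_ring R H \<union> K) \<subseteq> generate_ring R (H \<union> K)"
    using assms HK gH mono_generate_ring[OF _ HK, of H] generate_ring.incl
    by (intro generate_ring_min_subring1 generate_ring_is_subring) (auto intro: generate_ring.incl)
  show "generate_ring R (H \<union> K) \<subseteq> generate_ring R (generate_ring R H \<union> K)"
    using gH assms by (intro mono_generate_ring) (auto intro: generate_ring.incl)
qed

lemma (in ring) generate_ring_subring: "subring A R \<Longrightarrow> generate_ring R A = A"
  by (metis subringE(1) generate_ringI order_refl)

text \<open>The one-step extension, iterated over a finite set of generators. With \<open>A\<close> a copy of \<open>k\<close>, it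
  says that a nonzero element of a finitely generated domain over \<open>k\<close> survives in some \<open>k\<close>-point.\<close>

theorem extend_to_finitely_generated:
  fixes L (structure) and k (structure)
  assumes L: "field L" and k: "algebraically_closed k" and A: "subring A L"
    and F: "finite F" "F \<subseteq> carrier L" and v: "v \<in> generate_ring L (A \<union> F)" "v \<noteq> \<zero>\<^bsub>L\<^esub>"
  shows "\<exists>u\<in>A. u \<noteq> \<zero>\<^bsub>L\<^esub> \<and> (\<forall>\<phi>\<in>ring_hom (L\<lparr>carrier := A\<rparr>) k. \<phi> u \<noteq> \<zero>\<^bsub>k\<^esub> \<longrightarrow>
    (\<exists>\<psi>\<in>ring_hom (L\<lparr>carrier := generate_ring L (A \<union> F)\<rparr>) k. (\<forall>a\<in>A. \<psi> a = \<phi> a) \<and> \<psi> v \<noteq> \<zero>\<^bsub>k\<^esub>))"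
  using F v
proof (induction F arbitrary: v rule: finite_induct)
  case empty
  interpret L: field L by fact
  have "generate_ring L A = A" using L.generate_ring_subring[OF A] .
  then show ?case using empty by auto
next
  case (insert x F)
  interpret L: field L by fact
  let ?B = "generate_ring L (A \<union> F)"
  have AL: "A \<subseteq> carrier L" using subringE(1)[OF A] .
  have AF: "A \<union> F \<subseteq> carrier L" using AL insert.prems by auto
  have B: "subring ?B L" using L.generate_ring_is_subring[OF AF] .
  interpret S: subring_adjoin L k ?B "L\<lparr>carrier := ?B\<rparr>" "UP (L\<lparr>carrier := ?B\<rparr>)"
    using subring_adjoin_intro[OF L k B] by simp_all
  have x: "x \<in> carrier L" using insert.prems by simp
  have C: "S.adjoin x = generate_ring L (A \<union> insert x F)"
    using S.adjoin_eq_generate_ring[OF x] L.generate_ring_union[OF AF, of "{x}"] x by simp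
  obtain u where u: "u \<in> ?B" "u \<noteq> \<zero>\<^bsub>L\<^esub>"
    "\<And>\<phi>. \<phi> \<in> ring_hom (L\<lparr>carrier := ?B\<rparr>) k \<Longrightarrow> \<phi> u \<noteq> \<zero>\<^bsub>k\<^esub> \<Longrightarrow>
      \<exists>\<psi>\<in>ring_hom (L\<lparr>carrier := S.adjoin x\<rparr>) k. (\<forall>a\<in>?B. \<psi> a = \<phi> a) \<and> \<psi> v \<noteq> \<zero>\<^bsub>k\<^esub>"
    using S.extend_one_step[OF x, of v] insert.prems unfolding C by metis
  obtain u0 where u0: "u0 \<in> A" "u0 \<noteq> \<zero>\<^bsub>L\<^esub>"
    "\<And>\<phi>. \<phi> \<in> ring_hom (L\<lparr>carrier := A\<rparr>) k \<Longrightarrow> \<phi> u0 \<noteq> \<zero>\<^bsub>k\<^esub> \<Longrightarrow>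
      \<exists>\<psi>\<in>ring_hom (L\<lparr>carrier := ?B\<rparr>) k. (\<forall>a\<in>A. \<psi> a = \<phi> a) \<and> \<psi> u \<noteq> \<zero>\<^bsub>k\<^esub>"
    using insert.IH[OF _ u(1,2)] insert.prems by blast
  have AB: "A \<subseteq> ?B" by (auto intro: generate_ring.incl)
  show ?case
  proof (intro bexI[of _ u0] conjI ballI impI u0(1,2))
    fix \<phi> assume "\<phi> \<in> ring_hom (L\<lparr>carrier := A\<rparr>) k" "\<phi> u0 \<noteq> \<zero>\<^bsub>k\<^esub>"
    then obtain \<psi> where \<psi>: "\<psi> \<in> ring_hom (L\<lparr>carrier := ?B\<rparr>) k" "\<forall>a\<in>A. \<psi> a = \<phi> a" "\<psi> u \<noteq> \<zero>\<^bsub>k\<^esub>"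
      using u0(3) by blast
    then obtain \<chi> where "\<chi> \<in> ring_hom (L\<lparr>carrier := S.adjoin x\<rparr>) k" "\<forall>a\<in>?B. \<chi> a = \<psi> a" "\<chi> v \<noteq> \<zero>\<^bsub>k\<^esub>"
      using u(3) by blast
    then show "\<exists>\<psi>\<in>ring_hom (L\<lparr>carrier := generate_ring L (A \<union> insert x F)\<rparr>) k.
        (\<forall>a\<in>A. \<psi> a = \<phi> a) \<and> \<psi> v \<noteq> \<zero>\<^bsub>k\<^esub>"
      unfolding C using \<psi> AB by (metis subsetD)
  qed
qed

text \<open>Let \<open>A\<close> be generated by \<open>k\<close> and \<open>E\<close>, and let \<open>x = \<alpha> [^] (p ^ n)\<close> be transcendental over \<open>A\<close> or
  separable of degree at least two. The elements that have to survive are chosen from the top down: a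
  nonzero \<open>v \<in> A[x]\<close> whose survival allows an extension to all of \<open>M\<close>, then a nonzero \<open>u \<in> A\<close> for
  \<open>v\<close>, then a nonzero constant for \<open>u\<close>. The homomorphisms are extended from the bottom up, from
  \<open>k\<close> to \<open>A\<close>, in two ways to \<open>A[x]\<close>, and then to the whole ring. As they differ at \<open>x\<close>, they differ
  at \<open>\<alpha>\<close>.\<close>

theorem separating_points:
  fixes L (structure) and k (structure)
  assumes L: "field L" and k: "algebraically_closed k" and \<iota>: "\<iota> \<in> ring_hom k L"
    and char: "ring_char k = p" "p > 0" and K: "subfield K L" "\<iota> ` carrier k \<subseteq> K"
    and E: "finite E" "E \<subseteq> K" and M: "finite M" "M \<subseteq> carrier L"
    and \<alpha>: "\<alpha> \<in> M" "\<And>n::nat. \<alpha> [^]\<^bsub>L\<^esub> (p ^ n) \<notin> K"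
  shows "\<exists>\<phi>\<in>ring_hom (L\<lparr>carrier := generate_ring L (\<iota> ` carrier k \<union> E \<union> M)\<rparr>) k.
    \<exists>\<psi>\<in>ring_hom (L\<lparr>carrier := generate_ring L (\<iota> ` carrier k \<union> E \<union> M)\<rparr>) k.
      (\<forall>c\<in>carrier k. \<phi> (\<iota> c) = c \<and> \<psi> (\<iota> c) = c) \<and> (\<forall>e\<in>E. \<phi> e = \<psi> e) \<and> \<phi> \<alpha> \<noteq> \<psi> \<alpha>"
proof -
  interpret L: field L by fact
  interpret k: algebraically_closed k by fact
  interpret \<iota>: ring_hom_cring k L \<iota> by unfold_locales (rule \<iota>)
  let ?I = "\<iota> ` carrier k"
  have inj: "inj_on \<iota> (carrier k)" using field_hom_inj[OF k.field_axioms L \<iota>] .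
  have A0: "subring ?I L" using \<iota>.ring.img_is_subring[OF k.carrier_is_subring] .
  define \<phi>0 where "\<phi>0 = inv_into (carrier k) \<iota>"
  have \<phi>0: "\<phi>0 (\<iota> c) = c" if "c \<in> carrier k" for c
    unfolding \<phi>0_def using inj that by simp
  have \<phi>0_hom: "\<phi>0 \<in> ring_hom (L\<lparr>carrier := ?I\<rparr>) k"
  proof (rule ring_hom_memI)
    show "\<phi>0 \<one>\<^bsub>L\<lparr>carrier := ?I\<rparr>\<^esub> = \<one>\<^bsub>k\<^esub>" using \<phi>0[of "\<one>\<^bsub>k\<^esub>"] by simp
  next
    fix x y assume "x \<in> carrier (L\<lparr>carrier := ?I\<rparr>)" "y \<in> carrier (L\<lparr>carrier := ?I\<rparr>)"
    then obtain c d where "c \<in> carrier k" "x = \<iota> c" "d \<in> carrier k" "y = \<iota> d" by auto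
    then show "\<phi>0 (x \<otimes>\<^bsub>L\<lparr>carrier := ?I\<rparr>\<^esub> y) = \<phi>0 x \<otimes>\<^bsub>k\<^esub> \<phi>0 y"
      "\<phi>0 (x \<oplus>\<^bsub>L\<lparr>carrier := ?I\<rparr>\<^esub> y) = \<phi>0 x \<oplus>\<^bsub>k\<^esub> \<phi>0 y"
      using \<phi>0[of "c \<otimes>\<^bsub>k\<^esub> d"] \<phi>0[of "c \<oplus>\<^bsub>k\<^esub> d"] \<phi>0 by auto
  qed (use \<phi>0 in auto)
  have KL: "K \<subseteq> carrier L" using subfieldE(3)[OF K(1)] .
  have \<alpha>L: "\<alpha> \<in> carrier L" using \<alpha>(1) M by blast
  have gen0: "?I \<union> E \<subseteq> carrier L" using K E KL by blast
  let ?A = "generate_ring L (?I \<union> E)"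
  have A: "subring ?A L" using L.generate_ring_is_subring[OF gen0] .
  have AK: "?A \<subseteq> K"
    using L.generate_ring_min_subring1[OF gen0 subfieldE(1)[OF K(1)]] K E by blast
  interpret S: subring_adjoin L k ?A "L\<lparr>carrier := ?A\<rparr>" "UP (L\<lparr>carrier := ?A\<rparr>)"
    using subring_adjoin_intro[OF L k A] by simp_all
  have charL: "ring_char L = p" using ring_char_field_hom[OF k.field_axioms L \<iota>] char by simp
  have nfrac: "b \<otimes>\<^bsub>L\<^esub> \<alpha> [^]\<^bsub>L\<^esub> (p ^ n) \<noteq> a" if "a \<in> ?A" "b \<in> ?A" "b \<noteq> \<zero>\<^bsub>L\<^esub>" for n :: nat and a b
  proof
    assume eq: "b \<otimes>\<^bsub>L\<^esub> \<alpha> [^]\<^bsub>L\<^esub> (p ^ n) = a"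
    have ab: "a \<in> K" "b \<in> K" using that AK by auto
    have "inv\<^bsub>L\<^esub> b \<in> K" using L.subfield_m_inv(1)[OF K(1), of b] ab that by auto
    moreover have "\<alpha> [^]\<^bsub>L\<^esub> (p ^ n) = inv\<^bsub>L\<^esub> b \<otimes>\<^bsub>L\<^esub> a"
    proof -
      have "inv\<^bsub>L\<^esub> b \<otimes>\<^bsub>L\<^esub> b = \<one>\<^bsub>L\<^esub>" "inv\<^bsub>L\<^esub> b \<in> carrier L"
        using that ab KL L.field_Units L.Units_l_inv L.Units_inv_closed by auto
      then show ?thesis using eq ab KL \<alpha>L
        by (metis L.l_one L.m_assoc L.nat_pow_closed subsetD)
    qed
    ultimately show False using \<alpha>(2)[of n] subringE(6)[OF subfieldE(1)[OF K(1)], of "inv\<^bsub>L\<^esub> b" a] ab by simp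
  qed
  \<comment> \<open>Both kinds of powers of \<open>\<alpha>\<close> yield the same statement about pairs of extensions, so the cases
    merge here.\<close>
  obtain n where two: "\<And>v. v \<in> S.adjoin (\<alpha> [^]\<^bsub>L\<^esub> (p ^ n :: nat)) \<Longrightarrow> v \<noteq> \<zero>\<^bsub>L\<^esub> \<Longrightarrow>
    \<exists>u\<in>?A. u \<noteq> \<zero>\<^bsub>L\<^esub> \<and> (\<forall>\<phi>\<in>ring_hom (L\<lparr>carrier := ?A\<rparr>) k. \<phi> u \<noteq> \<zero>\<^bsub>k\<^esub> \<longrightarrow>
      S.two_ext (\<alpha> [^]\<^bsub>L\<^esub> (p ^ n :: nat)) v \<phi>)"
  proof (rule S.exists_separable_power[OF \<alpha>L charL char(2) nfrac])
    fix n assume tr: "\<And>f. f \<in> carrier (UP (L\<lparr>carrier := ?A\<rparr>)) \<Longrightarrow> S.ev (\<alpha> [^]\<^bsub>L\<^esub> (p ^ n :: nat)) f = \<zero>\<^bsub>L\<^esub> \<Longrightarrow>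
        f = \<zero>\<^bsub>UP (L\<lparr>carrier := ?A\<rparr>)\<^esub>"
    show thesis
      by (rule that[of n], rule S.extend_transcendental[OF L.nat_pow_closed[OF \<alpha>L] tr]) blast+
  next
    fix n f assume f: "S.min_relation (\<alpha> [^]\<^bsub>L\<^esub> (p ^ n :: nat)) f" "2 \<le> deg (L\<lparr>carrier := ?A\<rparr>) f"
      "S.R.formal_deriv f \<noteq> \<zero>\<^bsub>UP (L\<lparr>carrier := ?A\<rparr>)\<^esub>"
    show thesis
      by (rule that[of n], rule S.extend_separable[OF f(1) L.nat_pow_closed[OF \<alpha>L] f(2,3)]) blast+
  qed
  define x where "x = \<alpha> [^]\<^bsub>L\<^esub> (p ^ n :: nat)"
  have x: "x \<in> carrier L" unfolding x_def using \<alpha>L by simp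
  let ?B = "S.adjoin x"
  have Bgen: "?B = generate_ring L (insert x ?A)" using S.adjoin_eq_generate_ring[OF x] .
  have AxL: "insert x ?A \<subseteq> carrier L" using x AK KL by blast
  have B: "subring ?B L" unfolding Bgen using L.generate_ring_is_subring[OF AxL] .
  let ?C = "generate_ring L (?B \<union> M)" and ?C' = "generate_ring L (?I \<union> E \<union> M)"
  have AB: "?A \<subseteq> ?B" unfolding Bgen by (auto intro: generate_ring.incl)
  have BC: "?B \<subseteq> ?C" by (auto intro: generate_ring.incl)
  have BM: "?B \<union> M \<subseteq> carrier L" using subringE(1)[OF B] M by blast
  have C'C: "?C' \<subseteq> ?C"
  proof -
    have "?I \<union> E \<subseteq> ?A" "?B \<union> M \<subseteq> ?C" by (auto intro: generate_ring.incl)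
    then have "?I \<union> E \<union> M \<subseteq> ?C" using AB by blast
    moreover have "?I \<union> E \<union> M \<subseteq> carrier L" using gen0 M by blast
    ultimately show ?thesis
      using L.generate_ring_min_subring1 L.generate_ring_is_subring[OF BM] by blast
  qed
  have "\<one>\<^bsub>L\<^esub> \<in> ?C" "\<one>\<^bsub>L\<^esub> \<noteq> \<zero>\<^bsub>L\<^esub>" by (auto intro: generate_ring.one)
  then obtain v where v: "v \<in> ?B" "v \<noteq> \<zero>\<^bsub>L\<^esub>"
    "\<And>\<phi>. \<phi> \<in> ring_hom (L\<lparr>carrier := ?B\<rparr>) k \<Longrightarrow> \<phi> v \<noteq> \<zero>\<^bsub>k\<^esub> \<Longrightarrow>
      \<exists>\<psi>\<in>ring_hom (L\<lparr>carrier := ?C\<rparr>) k. \<forall>a\<in>?B. \<psi> a = \<phi> a"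
    using extend_to_finitely_generated[OF L k B M, of "\<one>\<^bsub>L\<^esub>"] by blast
  obtain u where u: "u \<in> ?A" "u \<noteq> \<zero>\<^bsub>L\<^esub>"
    "\<And>\<phi>. \<phi> \<in> ring_hom (L\<lparr>carrier := ?A\<rparr>) k \<Longrightarrow> \<phi> u \<noteq> \<zero>\<^bsub>k\<^esub> \<Longrightarrow> S.two_ext x v \<phi>"
    using two[of v] v(1,2) unfolding x_def[symmetric] by blast
  have EL: "E \<subseteq> carrier L" using E KL by blast
  obtain u0 where u0: "u0 \<in> ?I" "u0 \<noteq> \<zero>\<^bsub>L\<^esub>"
    "\<And>\<phi>. \<phi> \<in> ring_hom (L\<lparr>carrier := ?I\<rparr>) k \<Longrightarrow> \<phi> u0 \<noteq> \<zero>\<^bsub>k\<^esub> \<Longrightarrow>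
      \<exists>\<psi>\<in>ring_hom (L\<lparr>carrier := ?A\<rparr>) k. (\<forall>a\<in>?I. \<psi> a = \<phi> a) \<and> \<psi> u \<noteq> \<zero>\<^bsub>k\<^esub>"
    using extend_to_finitely_generated[OF L k A0 E(1) EL u(1,2)] by blast
  have "\<phi>0 u0 \<noteq> \<zero>\<^bsub>k\<^esub>" using u0(1,2) \<phi>0 by auto
  then obtain \<phi> where \<phi>: "\<phi> \<in> ring_hom (L\<lparr>carrier := ?A\<rparr>) k" "\<forall>a\<in>?I. \<phi> a = \<phi>0 a" "\<phi> u \<noteq> \<zero>\<^bsub>k\<^esub>"
    using u0(3)[OF \<phi>0_hom] by blast
  obtain \<psi>1 \<psi>2 where \<psi>: "\<psi>1 \<in> ring_hom (L\<lparr>carrier := ?B\<rparr>) k" "\<psi>2 \<in> ring_hom (L\<lparr>carrier := ?B\<rparr>) k"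
    "\<forall>a\<in>?A. \<psi>1 a = \<phi> a \<and> \<psi>2 a = \<phi> a" "\<psi>1 x \<noteq> \<psi>2 x" "\<psi>1 v \<noteq> \<zero>\<^bsub>k\<^esub>" "\<psi>2 v \<noteq> \<zero>\<^bsub>k\<^esub>"
    using u(3)[OF \<phi>(1,3)] by blast
  obtain \<chi>1 where \<chi>1: "\<chi>1 \<in> ring_hom (L\<lparr>carrier := ?C\<rparr>) k" "\<forall>a\<in>?B. \<chi>1 a = \<psi>1 a"
    using v(3)[OF \<psi>(1,5)] by blast
  obtain \<chi>2 where \<chi>2: "\<chi>2 \<in> ring_hom (L\<lparr>carrier := ?C\<rparr>) k" "\<forall>a\<in>?B. \<chi>2 a = \<psi>2 a"
    using v(3)[OF \<psi>(2,6)] by blast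
  have xB: "x \<in> ?B" unfolding Bgen by (auto intro: generate_ring.incl)
  have restrict: "\<chi> \<in> ring_hom (L\<lparr>carrier := ?C'\<rparr>) k" if "\<chi> \<in> ring_hom (L\<lparr>carrier := ?C\<rparr>) k" for \<chi>
    using that subsetD[OF C'C] unfolding ring_hom_def by (simp add: Pi_iff)
  have on_A: "\<chi>1 a = \<phi> a \<and> \<chi>2 a = \<phi> a" if "a \<in> ?A" for a
    using \<chi>1(2) \<chi>2(2) \<psi>(3) AB that by (metis subsetD)
  have A0A: "?I \<subseteq> ?A" and EA: "E \<subseteq> ?A" by (auto intro: generate_ring.incl)
  show ?thesis
  proof (rule bexI[of _ \<chi>1], rule bexI[of _ \<chi>2], intro conjI ballI)
    show "\<chi>1 \<in> ring_hom (L\<lparr>carrier := ?C'\<rparr>) k" "\<chi>2 \<in> ring_hom (L\<lparr>carrier := ?C'\<rparr>) k"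
      using restrict \<chi>1(1) \<chi>2(1) by auto
    show "\<chi>1 (\<iota> c) = c" "\<chi>2 (\<iota> c) = c" if "c \<in> carrier k" for c
      using on_A[of "\<iota> c"] \<phi>(2) \<phi>0[OF that] A0A that by auto
    show "\<chi>1 e = \<chi>2 e" if "e \<in> E" for e using on_A[of e] EA that by auto
    show "\<chi>1 \<alpha> \<noteq> \<chi>2 \<alpha>"
    proof
      assume eq: "\<chi>1 \<alpha> = \<chi>2 \<alpha>"
      have \<alpha>C: "\<alpha> \<in> ?C" using \<alpha>(1) by (auto intro: generate_ring.incl)
      have pw: "\<chi> (\<alpha> [^]\<^bsub>L\<^esub> m) = \<chi> \<alpha> [^]\<^bsub>k\<^esub> m" if \<chi>: "\<chi> \<in> ring_hom (L\<lparr>carrier := ?C\<rparr>) k" for \<chi> and m :: nat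
      proof (induction m)
        case 0
        then show ?case using ring_hom_one[OF \<chi>] by simp
      next
        case (Suc m)
        have "\<alpha> [^]\<^bsub>L\<^esub> m \<in> ?C"
          by (induction m) (auto intro: generate_ring.intros \<alpha>C)
        then show ?case using ring_hom_mult[OF \<chi>, of "\<alpha> [^]\<^bsub>L\<^esub> m" \<alpha>] \<alpha>C Suc by simp
      qed
      have "\<chi>1 x = \<chi>2 x" unfolding x_def using pw[OF \<chi>1(1)] pw[OF \<chi>2(1)] eq by simp
      then show False using \<chi>1(2) \<chi>2(2) xB \<psi>(4) by simp
    qed
  qed
qed

section \<open>Prime and maximal ideals\<close>

text \<open>The common part of the existence of primes that avoid the powers of \<open>x\<close> and of maximal
  ideals, which is the case \<open>x = \<one>\<close>.\<close>

lemma (in cring) exists_ideal_maximal_avoiding: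
  assumes I: "ideal I R" and avoid: "\<And>n::nat. x [^] n \<notin> I"
  shows "\<exists>J. ideal J R \<and> I \<subseteq> J \<and> (\<forall>n::nat. x [^] n \<notin> J) \<and>
    (\<forall>J'. ideal J' R \<longrightarrow> J \<subseteq> J' \<longrightarrow> (\<forall>n::nat. x [^] n \<notin> J') \<longrightarrow> J' = J)"
proof -
  define F where "F = {J. ideal J R \<and> I \<subseteq> J \<and> (\<forall>n::nat. x [^] n \<notin> J)}"
  have "\<exists>M\<in>F. \<forall>Z\<in>F. M \<subseteq> Z \<longrightarrow> Z = M"
  proof (rule subset_Zorn_nonempty)
    show "F \<noteq> {}" using I avoid unfolding F_def by blast
  next
    fix C assume C: "C \<noteq> {}" "subset.chain F C"
    then have "subset.chain {I. ideal I R} C" unfolding subset.chain_def F_def by blast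
    then have "ideal (\<Union>C) R" using chain_Union_is_ideal[of C] C(1) by simp
    moreover have "C \<subseteq> F" using C(2) unfolding subset.chain_def by blast
    ultimately show "\<Union>C \<in> F" using C(1) unfolding F_def by blast
  qed
  then obtain M where M: "M \<in> F" "\<And>Z. Z \<in> F \<Longrightarrow> M \<subseteq> Z \<Longrightarrow> Z = M" by blast
  then show ?thesis unfolding F_def by (intro exI[of _ M]) blast
qed

lemma (in cring) exists_primeideal_avoiding:
  assumes I: "ideal I R" and x: "x \<in> carrier R" and avoid: "\<And>n::nat. x [^] n \<notin> I"
  obtains P where "primeideal P R" "I \<subseteq> P" "x \<notin> P"
proof -
  obtain J where J: "ideal J R" "I \<subseteq> J" "\<And>n::nat. x [^] n \<notin> J"
    "\<And>J'. ideal J' R \<Longrightarrow> J \<subseteq> J' \<Longrightarrow> \<forall>n::nat. x [^] n \<notin> J' \<Longrightarrow> J' = J"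
    using exists_ideal_maximal_avoiding[OF I avoid] by blast
  interpret J: ideal J R by fact
  have meet: "\<exists>n::nat. \<exists>j\<in>J. \<exists>r\<in>carrier R. x [^] n = j \<oplus> r \<otimes> a" if a: "a \<in> carrier R" "a \<notin> J" for a
  proof -
    let ?J' = "J <+>\<^bsub>R\<^esub> PIdl a"
    have "ideal ?J' R" using add_ideals[OF J(1) cgenideal_ideal[OF a(1)]] .
    moreover have "J \<subseteq> ?J'"
    proof
      fix j assume "j \<in> J"
      moreover have "\<zero> \<in> PIdl a" using a unfolding cgenideal_def by (auto intro!: exI[of _ \<zero>])
      ultimately show "j \<in> ?J'" unfolding set_add_def' using J.a_Hcarr
        by (intro UN_I[of j] UN_I[of \<zero>]) auto
    qed
    moreover have "a \<in> ?J'"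
      unfolding set_add_def' using J.zero_closed cgenideal_self[OF a(1)] l_zero[OF a(1)]
      by (intro UN_I[of \<zero>] UN_I[of a]) auto
    ultimately obtain n :: nat where "x [^] n \<in> ?J'" using J(4)[of ?J'] a(2) by auto
    then show ?thesis unfolding set_add_def' cgenideal_def by blast
  qed
  have "primeideal J R"
  proof (rule primeidealI[OF J(1)])
    show "cring R" by (rule is_cring)
    show "carrier R \<noteq> J" using J(3)[of 0] by auto
    fix a b assume a: "a \<in> carrier R" and b: "b \<in> carrier R" and ab: "a \<otimes> b \<in> J"
    show "a \<in> J \<or> b \<in> J"
    proof (rule ccontr)
      assume "\<not> (a \<in> J \<or> b \<in> J)"
      then obtain n m :: nat and j i r s where
        n: "j \<in> J" "r \<in> carrier R" "x [^] n = j \<oplus> r \<otimes> a" and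
        m: "i \<in> J" "s \<in> carrier R" "x [^] m = i \<oplus> s \<otimes> b"
        using meet[OF a] meet[OF b] by blast
      have c: "j \<in> carrier R" "i \<in> carrier R" using n m J.a_Hcarr by auto
      have "x [^] (n + m) = (j \<oplus> r \<otimes> a) \<otimes> (i \<oplus> s \<otimes> b)"
        using nat_pow_mult[OF x, of n m] n m by simp
      also have "\<dots> = (i \<oplus> s \<otimes> b) \<otimes> j \<oplus> (r \<otimes> a \<otimes> i \<oplus> (r \<otimes> s) \<otimes> (a \<otimes> b))"
        using a b c n(2) m(2) by algebra
      also have "\<dots> \<in> J"
        using a b c n m ab J.I_l_closed J.a_closed by auto
      finally show False using J(3) by blast
    qed
  qed
  then show thesis using that J(2) J(3)[of 1] x by (metis nat_pow_eone)
qed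

lemma (in cring) exists_maximalideal:
  assumes I: "ideal I R" and "\<one> \<notin> I"
  obtains M where "maximalideal M R" "I \<subseteq> M"
proof -
  have avoid: "\<one> [^] (n::nat) \<notin> I" for n using assms(2) by simp
  obtain M where M: "ideal M R" "I \<subseteq> M" "\<And>n::nat. \<one> [^] n \<notin> M"
    "\<And>J'. ideal J' R \<Longrightarrow> M \<subseteq> J' \<Longrightarrow> \<forall>n::nat. \<one> [^] n \<notin> J' \<Longrightarrow> J' = M"
    using exists_ideal_maximal_avoiding[OF I avoid] by blast
  have "maximalideal M R"
  proof (rule maximalidealI[OF M(1)])
    show "carrier R \<noteq> M" using M(3)[of 0] by auto
    fix J assume J: "ideal J R" "M \<subseteq> J" "J \<subseteq> carrier R"
    show "J = M \<or> J = carrier R"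
    proof (cases "\<one> \<in> J")
      case True
      then show ?thesis using ideal.one_imp_carrier[OF J(1)] by blast
    next
      case False
      then show ?thesis using M(4)[OF J(1,2)] by simp
    qed
  qed
  with that M show thesis by blast
qed

lemma local_ring_max_ideal:
  assumes "is_local_ring R"
  shows "cring R" "maximalideal (max_ideal R) R"
proof -
  show "cring R" using assms unfolding is_local_ring_def by blast
  show "maximalideal (max_ideal R) R"
    unfolding max_ideal_def by (rule theI') (use assms in \<open>simp add: is_local_ring_def\<close>)
qed

lemma local_ring_nonunits:
  assumes "is_local_ring R" and a: "a \<in> carrier R"
  shows "a \<in> max_ideal R \<longleftrightarrow> (\<forall>b\<in>carrier R. a \<otimes>\<^bsub>R\<^esub> b \<noteq> \<one>\<^bsub>R\<^esub>)"
proof -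
  interpret R: cring R using local_ring_max_ideal(1)[OF assms(1)] .
  interpret m: maximalideal "max_ideal R" R using local_ring_max_ideal(2)[OF assms(1)] .
  show ?thesis
  proof
    assume a': "a \<in> max_ideal R"
    show "\<forall>b\<in>carrier R. a \<otimes>\<^bsub>R\<^esub> b \<noteq> \<one>\<^bsub>R\<^esub>"
      using m.I_r_closed[OF a'] m.one_imp_carrier m.I_notcarr by metis
  next
    assume nu: "\<forall>b\<in>carrier R. a \<otimes>\<^bsub>R\<^esub> b \<noteq> \<one>\<^bsub>R\<^esub>"
    then have "\<one>\<^bsub>R\<^esub> \<notin> PIdl\<^bsub>R\<^esub> a"
      unfolding cgenideal_def using a by (auto simp: R.m_comm)
    then obtain M where M: "maximalideal M R" "PIdl\<^bsub>R\<^esub> a \<subseteq> M"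
      by (rule R.exists_maximalideal[OF R.cgenideal_ideal[OF a]])
    then have "M = max_ideal R" using assms(1) m.maximalideal_axioms unfolding is_local_ring_def by blast
    then show "a \<in> max_ideal R" using M(2) R.cgenideal_self[OF a] by blast
  qed
qed

section \<open>Germs and invertibility\<close>

text \<open>The operations on classes of fractions and of germs are unions over all representatives; these
  two rules evaluate such a union once it is known not to depend on the representatives.\<close>

lemma UN_const:
  assumes "(U, s) \<in> A" and "\<And>U s. (U, s) \<in> A \<Longrightarrow> f U s = C"
  shows "(\<Union>(U, s)\<in>A. f U s) = C"
  using assms by (intro SUP_eq_const) auto

lemma UN_UN_const:
  assumes "(U, s) \<in> A" "(V, t) \<in> B"
    and "\<And>U s V t. (U, s) \<in> A \<Longrightarrow> (V, t) \<in> B \<Longrightarrow> f U s V t = C"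
  shows "(\<Union>(U, s)\<in>A. \<Union>(V, t)\<in>B. f U s V t) = C"
  by (rule UN_const[OF assms(1)], rule UN_const[OF assms(2)], rule assms(3))

context ringed_space
begin

definition sec_at where
  "sec_at x U s \<longleftrightarrow> openin (rs_top \<X>) U \<and> x \<in> U \<and> s \<in> carrier (rs_sec \<X> U)"

lemma res_closed:
  "openin (rs_top \<X>) U \<Longrightarrow> openin (rs_top \<X>) V \<Longrightarrow> V \<subseteq> U \<Longrightarrow> s \<in> carrier (rs_sec \<X> U) \<Longrightarrow>
    rs_res \<X> U V s \<in> carrier (rs_sec \<X> V)"
  using ring_hom_closed[OF res_hom] .

lemma germ_self: "sec_at x U s \<Longrightarrow> (U, s) \<in> germ \<X> x U s"
  unfolding germ_def sec_at_def by auto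

lemma germ_memD:
  assumes "(V, t) \<in> germ \<X> x U s"
  shows "sec_at x V t"
    "\<exists>W. openin (rs_top \<X>) W \<and> x \<in> W \<and> W \<subseteq> U \<inter> V \<and> rs_res \<X> U W s = rs_res \<X> V W t"
  using assms unfolding germ_def sec_at_def by auto

lemma germ_eqI:
  assumes s: "sec_at x U s" and t: "sec_at x V t"
    and W: "openin (rs_top \<X>) W" "x \<in> W" "W \<subseteq> U \<inter> V" "rs_res \<X> U W s = rs_res \<X> V W t"
  shows "germ \<X> x U s = germ \<X> x V t"
proof -
  have "germ \<X> x U s \<subseteq> germ \<X> x V t"
    if s: "sec_at x U s" and t: "sec_at x V t"
    and W: "openin (rs_top \<X>) W" "x \<in> W" "W \<subseteq> U \<inter> V" "rs_res \<X> U W s = rs_res \<X> V W t"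
  for U V W s t
  proof (rule subrelI)
    fix V' t' assume "(V', t') \<in> germ \<X> x U s"
    then obtain W' where V': "sec_at x V' t'" and
      W': "openin (rs_top \<X>) W'" "x \<in> W'" "W' \<subseteq> U \<inter> V'" "rs_res \<X> U W' s = rs_res \<X> V' W' t'"
      using germ_memD by metis
    have o: "openin (rs_top \<X>) (W \<inter> W')" using W W' by blast
    have "rs_res \<X> V (W \<inter> W') t = rs_res \<X> W (W \<inter> W') (rs_res \<X> V W t)"
      using res_comp[of V W "W \<inter> W'" t] W o t unfolding sec_at_def by auto
    also have "\<dots> = rs_res \<X> U (W \<inter> W') s"
      using res_comp[of U W "W \<inter> W'" s] W o s unfolding sec_at_def by auto
    also have "\<dots> = rs_res \<X> W' (W \<inter> W') (rs_res \<X> U W' s)"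
      using res_comp[of U W' "W \<inter> W'" s] W' o s unfolding sec_at_def by auto
    also have "\<dots> = rs_res \<X> V' (W \<inter> W') t'"
      using res_comp[of V' W' "W \<inter> W'" t'] W' o V' unfolding sec_at_def by auto
    finally show "(V', t') \<in> germ \<X> x V t"
      unfolding germ_def using V' W W' o unfolding sec_at_def by blast
  qed
  from this[OF s t W] this[OF t s W(1,2)] W show ?thesis by (metis Int_commute antisym)
qed

lemma germ_eqD:
  assumes "sec_at x U s" "sec_at x V t" "germ \<X> x U s = germ \<X> x V t"
  obtains W where "openin (rs_top \<X>) W" "x \<in> W" "W \<subseteq> U \<inter> V" "rs_res \<X> U W s = rs_res \<X> V W t"
  using germ_memD(2)[of V t x U s] germ_self[OF assms(2)] assms(3) by auto

lemma sec_at_res: "sec_at x U s \<Longrightarrow> openin (rs_top \<X>) V \<Longrightarrow> V \<subseteq> U \<Longrightarrow> x \<in> V \<Longrightarrow> sec_at x V (rs_res \<X> U V s)"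
  unfolding sec_at_def using res_closed by auto

lemma germ_res:
  assumes s: "sec_at x U s" and V: "openin (rs_top \<X>) V" "V \<subseteq> U" "x \<in> V"
  shows "germ \<X> x V (rs_res \<X> U V s) = germ \<X> x U s"
proof (rule germ_eqI[OF sec_at_res[OF s V] s V(1,3)])
  show "V \<subseteq> V \<inter> U" using V by auto
  show "rs_res \<X> V V (rs_res \<X> U V s) = rs_res \<X> U V s"
    using res_id[OF V(1)] sec_at_res[OF s V] unfolding sec_at_def by auto
qed

lemma sec_atD: "sec_at x U s \<Longrightarrow> openin (rs_top \<X>) U" "sec_at x U s \<Longrightarrow> x \<in> U"
  "sec_at x U s \<Longrightarrow> s \<in> carrier (rs_sec \<X> U)"
  unfolding sec_at_def by auto

lemma stalk_carrierE:
  assumes "A \<in> carrier (stalk \<X> x)"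
  obtains U s where "sec_at x U s" "A = germ \<X> x U s"
  using assms unfolding stalk_def sec_at_def by auto

lemma germ_closed: "sec_at x U s \<Longrightarrow> germ \<X> x U s \<in> carrier (stalk \<X> x)"
  unfolding stalk_def sec_at_def by auto

text \<open>The operations of the stalk are unions over all pairs of representatives. Any operation on sections
  that commutes with restriction gives the same germ for each of these pairs, so it can be computed
  on a common neighbourhood; addition and multiplication are the two instances.\<close>

lemma germ_union:
  assumes s: "sec_at x U s" and t: "sec_at x U t"
    and cl: "\<And>V a b. openin (rs_top \<X>) V \<Longrightarrow> a \<in> carrier (rs_sec \<X> V) \<Longrightarrow> b \<in> carrier (rs_sec \<X> V) \<Longrightarrow>
      m V a b \<in> carrier (rs_sec \<X> V)"
    and hom: "\<And>V W a b. openin (rs_top \<X>) V \<Longrightarrow> openin (rs_top \<X>) W \<Longrightarrow> W \<subseteq> V \<Longrightarrow>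
      a \<in> carrier (rs_sec \<X> V) \<Longrightarrow> b \<in> carrier (rs_sec \<X> V) \<Longrightarrow>
      rs_res \<X> V W (m V a b) = m W (rs_res \<X> V W a) (rs_res \<X> V W b)"
  shows "(\<Union>(U', s')\<in>germ \<X> x U s. \<Union>(V', t')\<in>germ \<X> x U t.
      germ \<X> x (U' \<inter> V') (m (U' \<inter> V') (rs_res \<X> U' (U' \<inter> V') s') (rs_res \<X> V' (U' \<inter> V') t')))
    = germ \<X> x U (m U s t)" (is "?L = ?R")
proof -
  have U: "openin (rs_top \<X>) U" "x \<in> U" using s sec_atD by auto
  have st: "sec_at x U (m U s t)" using s t cl unfolding sec_at_def by auto
  have eq: "germ \<X> x (U' \<inter> V') (m (U' \<inter> V') (rs_res \<X> U' (U' \<inter> V') s') (rs_res \<X> V' (U' \<inter> V') t')) = ?R"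
    if s': "(U', s') \<in> germ \<X> x U s" and t': "(V', t') \<in> germ \<X> x U t" for U' s' V' t'
  proof -
    obtain W where W: "openin (rs_top \<X>) W" "x \<in> W" "W \<subseteq> U \<inter> U'" "rs_res \<X> U W s = rs_res \<X> U' W s'"
      using germ_memD[OF s'] by auto
    obtain W' where W': "openin (rs_top \<X>) W'" "x \<in> W'" "W' \<subseteq> U \<inter> V'" "rs_res \<X> U W' t = rs_res \<X> V' W' t'"
      using germ_memD[OF t'] by auto
    have sa: "sec_at x U' s'" "sec_at x V' t'" using germ_memD s' t' by auto
    let ?N = "U' \<inter> V'" and ?O = "W \<inter> W'"
    have N: "openin (rs_top \<X>) ?N" "x \<in> ?N" using sa unfolding sec_at_def by auto
    have O: "openin (rs_top \<X>) ?O" "x \<in> ?O" "?O \<subseteq> ?N" "?O \<subseteq> U" using W W' by auto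
    have r: "rs_res \<X> U' ?N s' \<in> carrier (rs_sec \<X> ?N)" "rs_res \<X> V' ?N t' \<in> carrier (rs_sec \<X> ?N)"
      using sa N res_closed unfolding sec_at_def by auto
    have e1: "rs_res \<X> ?N ?O (rs_res \<X> U' ?N s') = rs_res \<X> U ?O s"
    proof -
      have "rs_res \<X> ?N ?O (rs_res \<X> U' ?N s') = rs_res \<X> U' ?O s'"
        using res_comp[of U' ?N ?O s'] sa N O unfolding sec_at_def by auto
      also have "\<dots> = rs_res \<X> W ?O (rs_res \<X> U' W s')"
        using res_comp[of U' W ?O s'] sa W O unfolding sec_at_def by auto
      also have "\<dots> = rs_res \<X> U ?O s"
        using res_comp[of U W ?O s] s W O unfolding sec_at_def by auto
      finally show ?thesis .
    qed
    have e2: "rs_res \<X> ?N ?O (rs_res \<X> V' ?N t') = rs_res \<X> U ?O t"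
    proof -
      have "rs_res \<X> ?N ?O (rs_res \<X> V' ?N t') = rs_res \<X> V' ?O t'"
        using res_comp[of V' ?N ?O t'] sa N O unfolding sec_at_def by auto
      also have "\<dots> = rs_res \<X> W' ?O (rs_res \<X> V' W' t')"
        using res_comp[of V' W' ?O t'] sa W' O unfolding sec_at_def by auto
      also have "\<dots> = rs_res \<X> U ?O t"
        using res_comp[of U W' ?O t] t W' O unfolding sec_at_def by auto
      finally show ?thesis .
    qed
    show ?thesis
    proof (rule germ_eqI[OF _ st O(1,2)])
      show "sec_at x ?N (m ?N (rs_res \<X> U' ?N s') (rs_res \<X> V' ?N t'))"
        using N r cl unfolding sec_at_def by auto
      show "?O \<subseteq> ?N \<inter> U" using O by auto
      show "rs_res \<X> ?N ?O (m ?N (rs_res \<X> U' ?N s') (rs_res \<X> V' ?N t')) = rs_res \<X> U ?O (m U s t)"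
        using hom[OF N(1) O(1,3) r] hom[OF U(1) O(1,4), of s t] s t e1 e2 unfolding sec_at_def by simp
    qed
  qed
  show ?thesis by (rule UN_UN_const[OF germ_self[OF s] germ_self[OF t] eq])
qed

lemma stalk_mult_germ:
  assumes s: "sec_at x U s" and t: "sec_at x U t"
  shows "germ \<X> x U s \<otimes>\<^bsub>stalk \<X> x\<^esub> germ \<X> x U t = germ \<X> x U (s \<otimes>\<^bsub>rs_sec \<X> U\<^esub> t)"
proof -
  have "germ \<X> x U s \<otimes>\<^bsub>stalk \<X> x\<^esub> germ \<X> x U t
    = (\<Union>(U', s')\<in>germ \<X> x U s. \<Union>(V', t')\<in>germ \<X> x U t. germ \<X> x (U' \<inter> V')
        ((\<lambda>V. monoid.mult (rs_sec \<X> V)) (U' \<inter> V') (rs_res \<X> U' (U' \<inter> V') s') (rs_res \<X> V' (U' \<inter> V') t')))"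
    by (simp add: stalk_def)
  also have "\<dots> = germ \<X> x U (s \<otimes>\<^bsub>rs_sec \<X> U\<^esub> t)"
  proof (rule germ_union[OF s t])
    fix V a b assume V: "openin (rs_top \<X>) V" "a \<in> carrier (rs_sec \<X> V)" "b \<in> carrier (rs_sec \<X> V)"
    then interpret cring "rs_sec \<X> V" using sec_cring by blast
    show "a \<otimes>\<^bsub>rs_sec \<X> V\<^esub> b \<in> carrier (rs_sec \<X> V)" using V by blast
    show "rs_res \<X> V W (a \<otimes>\<^bsub>rs_sec \<X> V\<^esub> b) = rs_res \<X> V W a \<otimes>\<^bsub>rs_sec \<X> W\<^esub> rs_res \<X> V W b"
      if "openin (rs_top \<X>) W" "W \<subseteq> V" for W
      using ring_hom_mult[OF res_hom[OF V(1) that]] V by blast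
  qed
  finally show ?thesis .
qed

lemma stalk_add_germ:
  assumes s: "sec_at x U s" and t: "sec_at x U t"
  shows "germ \<X> x U s \<oplus>\<^bsub>stalk \<X> x\<^esub> germ \<X> x U t = germ \<X> x U (s \<oplus>\<^bsub>rs_sec \<X> U\<^esub> t)"
proof -
  have "germ \<X> x U s \<oplus>\<^bsub>stalk \<X> x\<^esub> germ \<X> x U t
    = (\<Union>(U', s')\<in>germ \<X> x U s. \<Union>(V', t')\<in>germ \<X> x U t. germ \<X> x (U' \<inter> V')
        ((\<lambda>V. add (rs_sec \<X> V)) (U' \<inter> V') (rs_res \<X> U' (U' \<inter> V') s') (rs_res \<X> V' (U' \<inter> V') t')))"
    by (simp add: stalk_def)
  also have "\<dots> = germ \<X> x U (s \<oplus>\<^bsub>rs_sec \<X> U\<^esub> t)"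
  proof (rule germ_union[OF s t])
    fix V a b assume V: "openin (rs_top \<X>) V" "a \<in> carrier (rs_sec \<X> V)" "b \<in> carrier (rs_sec \<X> V)"
    then interpret cring "rs_sec \<X> V" using sec_cring by blast
    show "a \<oplus>\<^bsub>rs_sec \<X> V\<^esub> b \<in> carrier (rs_sec \<X> V)" using V by blast
    show "rs_res \<X> V W (a \<oplus>\<^bsub>rs_sec \<X> V\<^esub> b) = rs_res \<X> V W a \<oplus>\<^bsub>rs_sec \<X> W\<^esub> rs_res \<X> V W b"
      if "openin (rs_top \<X>) W" "W \<subseteq> V" for W
      using ring_hom_add[OF res_hom[OF V(1) that]] V by blast
  qed
  finally show ?thesis .
qed

lemma one_sec_at: "openin (rs_top \<X>) U \<Longrightarrow> x \<in> U \<Longrightarrow> sec_at x U \<one>\<^bsub>rs_sec \<X> U\<^esub>"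
  using sec_cring[of U] cring.cring_simprules(6) unfolding sec_at_def by blast

lemma germ_one:
  assumes "openin (rs_top \<X>) U" "x \<in> U"
  shows "germ \<X> x U \<one>\<^bsub>rs_sec \<X> U\<^esub> = \<one>\<^bsub>stalk \<X> x\<^esub>"
proof -
  have sub: "U \<subseteq> rs_points \<X>" using openin_subset[OF assms(1)] .
  have "rs_res \<X> (rs_points \<X>) U \<one>\<^bsub>rs_sec \<X> (rs_points \<X>)\<^esub> = \<one>\<^bsub>rs_sec \<X> U\<^esub>"
    using ring_hom_one[OF res_hom[OF _ assms(1) sub]] by simp
  moreover have "sec_at x (rs_points \<X>) \<one>\<^bsub>rs_sec \<X> (rs_points \<X>)\<^esub>"
    using one_sec_at[OF openin_topspace] sub assms(2) by blast
  ultimately have "germ \<X> x U \<one>\<^bsub>rs_sec \<X> U\<^esub> = germ \<X> x (rs_points \<X>) \<one>\<^bsub>rs_sec \<X> (rs_points \<X>)\<^esub>"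
    using germ_res[OF _ assms(1) sub assms(2)] by metis
  then show ?thesis by (simp add: stalk_def)
qed

lemma germ_ring_hom:
  assumes "openin (rs_top \<X>) U" "x \<in> U"
  shows "germ \<X> x U \<in> ring_hom (rs_sec \<X> U) (stalk \<X> x)"
proof (rule ring_hom_memI)
  have at: "sec_at x U s" if "s \<in> carrier (rs_sec \<X> U)" for s
    using assms that unfolding sec_at_def by blast
  show "germ \<X> x U s \<in> carrier (stalk \<X> x)" if "s \<in> carrier (rs_sec \<X> U)" for s
    using germ_closed[OF at[OF that]] .
  show "germ \<X> x U (s \<otimes>\<^bsub>rs_sec \<X> U\<^esub> t) = germ \<X> x U s \<otimes>\<^bsub>stalk \<X> x\<^esub> germ \<X> x U t"
    "germ \<X> x U (s \<oplus>\<^bsub>rs_sec \<X> U\<^esub> t) = germ \<X> x U s \<oplus>\<^bsub>stalk \<X> x\<^esub> germ \<X> x U t"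
    if "s \<in> carrier (rs_sec \<X> U)" "t \<in> carrier (rs_sec \<X> U)" for s t
    using stalk_mult_germ[OF at at] stalk_add_germ[OF at at] that by simp_all
qed (rule germ_one[OF assms])

text \<open>Invertibility near a point, expressed by sections alone. In a locally ringed space it says that
  the section does not vanish at the point; unlike membership of the germ in the maximal ideal, it
  makes sense verbatim for an open subspace, whose germs are different sets.\<close>

definition inv_at where
  "inv_at x U s \<longleftrightarrow> (\<exists>W t. openin (rs_top \<X>) W \<and> x \<in> W \<and> W \<subseteq> U \<and> t \<in> carrier (rs_sec \<X> W) \<and>
     rs_res \<X> U W s \<otimes>\<^bsub>rs_sec \<X> W\<^esub> t = \<one>\<^bsub>rs_sec \<X> W\<^esub>)"

end

context locally_ringed_space
begin

lemma points_memI: "openin (rs_top \<X>) U \<Longrightarrow> x \<in> U \<Longrightarrow> x \<in> rs_points \<X>"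
  using openin_subset by blast

lemma germ_in_max_ideal_iff:
  assumes s: "sec_at x U s"
  shows "germ \<X> x U s \<in> max_ideal (stalk \<X> x) \<longleftrightarrow> \<not> inv_at x U s"
proof -
  have loc: "is_local_ring (stalk \<X> x)" using stalk_local points_memI[OF sec_atD(1)[OF s] sec_atD(2)[OF s]] by blast
  have "inv_at x U s \<longleftrightarrow> (\<exists>B\<in>carrier (stalk \<X> x). germ \<X> x U s \<otimes>\<^bsub>stalk \<X> x\<^esub> B = \<one>\<^bsub>stalk \<X> x\<^esub>)"
  proof
    assume "inv_at x U s"
    then obtain W t where W: "openin (rs_top \<X>) W" "x \<in> W" "W \<subseteq> U" "t \<in> carrier (rs_sec \<X> W)"
      "rs_res \<X> U W s \<otimes>\<^bsub>rs_sec \<X> W\<^esub> t = \<one>\<^bsub>rs_sec \<X> W\<^esub>" unfolding inv_at_def by blast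
    have t: "sec_at x W t" using W unfolding sec_at_def by blast
    have "germ \<X> x U s \<otimes>\<^bsub>stalk \<X> x\<^esub> germ \<X> x W t = \<one>\<^bsub>stalk \<X> x\<^esub>"
      using germ_res[OF s W(1,3,2)] stalk_mult_germ[OF sec_at_res[OF s W(1,3,2)] t] W germ_one
      by simp
    then show "\<exists>B\<in>carrier (stalk \<X> x). germ \<X> x U s \<otimes>\<^bsub>stalk \<X> x\<^esub> B = \<one>\<^bsub>stalk \<X> x\<^esub>"
      using germ_closed[OF t] by blast
  next
    assume "\<exists>B\<in>carrier (stalk \<X> x). germ \<X> x U s \<otimes>\<^bsub>stalk \<X> x\<^esub> B = \<one>\<^bsub>stalk \<X> x\<^esub>"
    then obtain V t where t: "sec_at x V t"
      and eq: "germ \<X> x U s \<otimes>\<^bsub>stalk \<X> x\<^esub> germ \<X> x V t = \<one>\<^bsub>stalk \<X> x\<^esub>"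
      using stalk_carrierE by metis
    let ?N = "U \<inter> V"
    have N: "openin (rs_top \<X>) ?N" "x \<in> ?N" "?N \<subseteq> U" "?N \<subseteq> V" using s t unfolding sec_at_def by auto
    let ?s = "rs_res \<X> U ?N s" and ?t = "rs_res \<X> V ?N t"
    have st: "sec_at x ?N ?s" "sec_at x ?N ?t" using sec_at_res s t N by auto
    interpret N: cring "rs_sec \<X> ?N" using sec_cring[OF N(1)] .
    have m: "sec_at x ?N (?s \<otimes>\<^bsub>rs_sec \<X> ?N\<^esub> ?t)" using st unfolding sec_at_def by auto
    have "germ \<X> x ?N (?s \<otimes>\<^bsub>rs_sec \<X> ?N\<^esub> ?t) = germ \<X> x ?N \<one>\<^bsub>rs_sec \<X> ?N\<^esub>"
      using eq germ_res[OF s N(1,3,2)] germ_res[OF t N(1,4,2)] stalk_mult_germ[OF st] germ_one[OF N(1,2)]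
      by simp
    then obtain W where W: "openin (rs_top \<X>) W" "x \<in> W" "W \<subseteq> ?N \<inter> ?N"
      "rs_res \<X> ?N W (?s \<otimes>\<^bsub>rs_sec \<X> ?N\<^esub> ?t) = rs_res \<X> ?N W \<one>\<^bsub>rs_sec \<X> ?N\<^esub>"
      using germ_eqD[OF m one_sec_at[OF N(1,2)]] by metis
    have WN: "W \<subseteq> ?N" using W by blast
    note h = res_hom[OF N(1) W(1) WN]
    have "rs_res \<X> ?N W ?s \<otimes>\<^bsub>rs_sec \<X> W\<^esub> rs_res \<X> ?N W ?t = \<one>\<^bsub>rs_sec \<X> W\<^esub>"
      using W(4) ring_hom_mult[OF h sec_atD(3)[OF st(1)] sec_atD(3)[OF st(2)]] ring_hom_one[OF h] by simp
    moreover have "rs_res \<X> ?N W ?s = rs_res \<X> U W s"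
      using res_comp[OF sec_atD(1)[OF s] N(1) W(1) WN N(3) sec_atD(3)[OF s]] .
    moreover have "rs_res \<X> ?N W ?t \<in> carrier (rs_sec \<X> W)"
      using res_closed[OF N(1) W(1) WN sec_atD(3)[OF st(2)]] .
    ultimately show "inv_at x U s" unfolding inv_at_def using W(1,2) WN N(3) by (metis subset_trans)
  qed
  then show ?thesis using local_ring_nonunits[OF loc germ_closed[OF s]] by blast
qed

end

section \<open>Values in residue fields\<close>

context locally_ringed_space
begin

definition val where
  "val x U s = max_ideal (stalk \<X> x) +>\<^bsub>stalk \<X> x\<^esub> germ \<X> x U s"

lemma stalk_max:
  assumes "x \<in> rs_points \<X>"
  shows "cring (stalk \<X> x)" "maximalideal (max_ideal (stalk \<X> x)) (stalk \<X> x)"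
    "ideal (max_ideal (stalk \<X> x)) (stalk \<X> x)"
  using local_ring_max_ideal[OF stalk_local[OF assms]] maximalideal.axioms(1) by auto

lemma residue_field_field:
  assumes "x \<in> rs_points \<X>"
  shows "field (residue_field \<X> x)"
  unfolding residue_field_def
  using maximalideal.quotient_is_field[OF stalk_max(2)[OF assms] stalk_max(1)[OF assms]] .

lemma quotient_hom:
  assumes "x \<in> rs_points \<X>"
  shows "(\<lambda>g. max_ideal (stalk \<X> x) +>\<^bsub>stalk \<X> x\<^esub> g) \<in> ring_hom (stalk \<X> x) (residue_field \<X> x)"
  unfolding residue_field_def using ideal.rcos_ring_hom[OF stalk_max(3)[OF assms]] .

lemma quotient_zero_iff:
  assumes "x \<in> rs_points \<X>" "g \<in> carrier (stalk \<X> x)"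
  shows "max_ideal (stalk \<X> x) +>\<^bsub>stalk \<X> x\<^esub> g = \<zero>\<^bsub>residue_field \<X> x\<^esub> \<longleftrightarrow> g \<in> max_ideal (stalk \<X> x)"
proof -
  interpret m: ideal "max_ideal (stalk \<X> x)" "stalk \<X> x" using stalk_max(3)[OF assms(1)] .
  have "\<zero>\<^bsub>residue_field \<X> x\<^esub> = max_ideal (stalk \<X> x)"
    unfolding residue_field_def FactRing_def by simp
  then show ?thesis
    using m.a_rcos_self[OF assms(2)] m.a_rcos_const by metis
qed

lemma val_hom:
  assumes "openin (rs_top \<X>) U" "x \<in> U"
  shows "val x U \<in> ring_hom (rs_sec \<X> U) (residue_field \<X> x)"
  using ring_hom_trans[OF germ_ring_hom[OF assms] quotient_hom[OF points_memI[OF assms]]]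
  unfolding val_def comp_def .

lemma val_res:
  assumes "sec_at x U s" "openin (rs_top \<X>) V" "V \<subseteq> U" "x \<in> V"
  shows "val x V (rs_res \<X> U V s) = val x U s"
  unfolding val_def germ_res[OF assms] ..

lemma val_zero_iff:
  assumes "sec_at x U s"
  shows "val x U s = \<zero>\<^bsub>residue_field \<X> x\<^esub> \<longleftrightarrow> \<not> inv_at x U s"
  unfolding val_def
  using quotient_zero_iff[OF points_memI[OF sec_atD(1)[OF assms] sec_atD(2)[OF assms]] germ_closed[OF assms]]
    germ_in_max_ideal_iff[OF assms] by simp

lemma residue_fieldE:
  assumes x: "x \<in> rs_points \<X>" and a: "a \<in> carrier (residue_field \<X> x)"
  obtains U s where "sec_at x U s" "a = val x U s"
proof -
  obtain g where "g \<in> carrier (stalk \<X> x)" "a = max_ideal (stalk \<X> x) +>\<^bsub>stalk \<X> x\<^esub> g"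
    using a unfolding residue_field_def FactRing_def A_RCOSETS_def' by auto
  then show thesis using that stalk_carrierE unfolding val_def by metis
qed

end

context lrs_morphism
begin

lemma preim_open: "openin (rs_top \<Y>) V \<Longrightarrow> openin (rs_top \<X>) (preim \<X> f V)"
  unfolding preim_def using base_continuous openin_continuous_map_preimage by blast

lemma base_point: "x \<in> rs_points \<X> \<Longrightarrow> rm_base f x \<in> rs_points \<Y>"
  using base_continuous unfolding continuous_map_def by blast

lemma pull_sec_at:
  assumes "x \<in> rs_points \<X>" "target.sec_at (rm_base f x) V t"
  shows "source.sec_at x (preim \<X> f V) (rm_pull f V t)"
  using assms preim_open ring_hom_closed[OF pull_hom]
  unfolding source.sec_at_def target.sec_at_def preim_def by auto

lemma stalk_map_germ:
  assumes x: "x \<in> rs_points \<X>" and t: "target.sec_at (rm_base f x) V t"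
  shows "stalk_map \<X> f x (germ \<Y> (rm_base f x) V t) = germ \<X> x (preim \<X> f V) (rm_pull f V t)"
  unfolding stalk_map_def
proof (rule UN_const[OF target.germ_self[OF t]])
  fix V' t' assume m: "(V', t') \<in> germ \<Y> (rm_base f x) V t"
  then obtain W where W: "openin (rs_top \<Y>) W" "rm_base f x \<in> W" "W \<subseteq> V \<inter> V'"
    "rs_res \<Y> V W t = rs_res \<Y> V' W t'" and t': "target.sec_at (rm_base f x) V' t'"
    using target.germ_memD[OF m] by blast
  show "germ \<X> x (preim \<X> f V') (rm_pull f V' t') = germ \<X> x (preim \<X> f V) (rm_pull f V t)"
  proof (rule source.germ_eqI[OF pull_sec_at[OF x t'] pull_sec_at[OF x t] preim_open[OF W(1)]])
    show "x \<in> preim \<X> f W" using x W unfolding preim_def by blast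
    show "preim \<X> f W \<subseteq> preim \<X> f V' \<inter> preim \<X> f V" using W unfolding preim_def by blast
    show "rs_res \<X> (preim \<X> f V') (preim \<X> f W) (rm_pull f V' t')
      = rs_res \<X> (preim \<X> f V) (preim \<X> f W) (rm_pull f V t)"
      using pull_natural[of V' W t'] pull_natural[of V W t] W t t'
      unfolding target.sec_at_def by auto
  qed
qed

lemma stalk_map_hom:
  assumes "x \<in> rs_points \<X>"
  shows "stalk_map \<X> f x \<in> ring_hom (stalk \<Y> (rm_base f x)) (stalk \<X> x)"
  using stalk_map_local[OF assms] unfolding local_hom_def by blast

lemma stalk_map_max_ideal:
  assumes "x \<in> rs_points \<X>" "g \<in> carrier (stalk \<Y> (rm_base f x))"
  shows "stalk_map \<X> f x g \<in> max_ideal (stalk \<X> x) \<longleftrightarrow> g \<in> max_ideal (stalk \<Y> (rm_base f x))"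
  using stalk_map_local[OF assms(1)] assms(2) unfolding local_hom_def by blast

text \<open>This is locality of the stalk map, expressed by sections instead of germs.\<close>

lemma inv_at_pull:
  assumes x: "x \<in> rs_points \<X>" and t: "target.sec_at (rm_base f x) V t"
  shows "source.inv_at x (preim \<X> f V) (rm_pull f V t) \<longleftrightarrow> target.inv_at (rm_base f x) V t"
  using source.germ_in_max_ideal_iff[OF pull_sec_at[OF x t]] target.germ_in_max_ideal_iff[OF t]
    stalk_map_max_ideal[OF x target.germ_closed[OF t]] stalk_map_germ[OF x t] by simp

text \<open>The elements of the coset differ by elements of the maximal
  ideal, which the stalk map sends into the maximal ideal, so all terms of the union that defines the residue map are equal.\<close>

lemma residue_map_coset:
  assumes x: "x \<in> rs_points \<X>" and g: "g \<in> carrier (stalk \<Y> (rm_base f x))"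
  shows "residue_map \<X> f x (max_ideal (stalk \<Y> (rm_base f x)) +>\<^bsub>stalk \<Y> (rm_base f x)\<^esub> g)
    = max_ideal (stalk \<X> x) +>\<^bsub>stalk \<X> x\<^esub> stalk_map \<X> f x g"
proof -
  let ?S = "stalk \<Y> (rm_base f x)" and ?T = "stalk \<X> x" and ?\<phi> = "stalk_map \<X> f x"
  let ?m = "max_ideal ?S" and ?n = "max_ideal ?T"
  let ?q = "\<lambda>g. ?n +>\<^bsub>?T\<^esub> g"
  interpret m: ideal ?m ?S using target.stalk_max(3)[OF base_point[OF x]] .
  interpret \<kappa>: field "residue_field \<X> x" using source.residue_field_field[OF x] .
  note q = source.quotient_hom[OF x] and \<phi> = stalk_map_hom[OF x]
  have "?q (?\<phi> h) = ?q (?\<phi> g)" if h: "h \<in> ?m +>\<^bsub>?S\<^esub> g" for h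
  proof -
    obtain a where a: "a \<in> ?m" "h = a \<oplus>\<^bsub>?S\<^esub> g" using h unfolding a_r_coset_def' by auto
    have ac: "a \<in> carrier ?S" using a(1) m.a_Hcarr by blast
    have \<phi>a: "?\<phi> a \<in> carrier ?T" "?\<phi> g \<in> carrier ?T" using ring_hom_closed[OF \<phi>] ac g by auto
    have "?q (?\<phi> a) = \<zero>\<^bsub>residue_field \<X> x\<^esub>"
      using source.quotient_zero_iff[OF x \<phi>a(1)] stalk_map_max_ideal[OF x ac] a(1) by blast
    moreover have "?q (?\<phi> h) = ?q (?\<phi> a) \<oplus>\<^bsub>residue_field \<X> x\<^esub> ?q (?\<phi> g)"
      using ring_hom_add[OF \<phi> ac g] ring_hom_add[OF q \<phi>a] a(2) by simp
    ultimately show ?thesis using ring_hom_closed[OF q \<phi>a(2)] by simp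
  qed
  moreover have "?m +>\<^bsub>?S\<^esub> g \<noteq> {}" using m.a_rcos_self[OF g] by blast
  ultimately show ?thesis
    unfolding residue_map_def by (intro SUP_eq_const)
qed

lemma residue_map_val:
  assumes "x \<in> rs_points \<X>" "target.sec_at (rm_base f x) V t"
  shows "residue_map \<X> f x (target.val (rm_base f x) V t) = source.val x (preim \<X> f V) (rm_pull f V t)"
  unfolding target.val_def source.val_def
  using residue_map_coset[OF assms(1) target.germ_closed[OF assms(2)]] stalk_map_germ[OF assms] by simp

lemma residue_map_hom:
  assumes x: "x \<in> rs_points \<X>"
  shows "residue_map \<X> f x \<in> ring_hom (residue_field \<Y> (rm_base f x)) (residue_field \<X> x)"
proof -
  let ?S = "stalk \<Y> (rm_base f x)" and ?q = "\<lambda>g. max_ideal (stalk \<X> x) +>\<^bsub>stalk \<X> x\<^esub> g"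
  let ?r = "\<lambda>g. max_ideal ?S +>\<^bsub>?S\<^esub> g" and ?\<kappa> = "residue_field \<Y> (rm_base f x)"
  note fx = base_point[OF x]
  interpret S: cring ?S using target.stalk_max(1)[OF fx] .
  note r = target.quotient_hom[OF fx]
    and c = ring_hom_trans[OF stalk_map_hom[OF x] source.quotient_hom[OF x], unfolded comp_def]
    and m = residue_map_coset[OF x]
  have E: "\<exists>g\<in>carrier ?S. a = ?r g" if "a \<in> carrier ?\<kappa>" for a
    using that unfolding residue_field_def FactRing_def A_RCOSETS_def' by auto
  show ?thesis
  proof (rule ring_hom_memI)
    fix a assume "a \<in> carrier ?\<kappa>"
    then show "residue_map \<X> f x a \<in> carrier (residue_field \<X> x)"
      using E m ring_hom_closed[OF c] by fastforce
  next
    fix a b assume "a \<in> carrier ?\<kappa>" "b \<in> carrier ?\<kappa>"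
    then obtain g h where g: "g \<in> carrier ?S" "a = ?r g" and h: "h \<in> carrier ?S" "b = ?r h"
      using E by blast
    show "residue_map \<X> f x (a \<otimes>\<^bsub>?\<kappa>\<^esub> b) = residue_map \<X> f x a \<otimes>\<^bsub>residue_field \<X> x\<^esub> residue_map \<X> f x b"
      using ring_hom_mult[OF r g(1) h(1)] ring_hom_mult[OF c g(1) h(1)] m[OF g(1)] m[OF h(1)]
        m[OF S.m_closed[OF g(1) h(1)]] g(2) h(2) by metis
    show "residue_map \<X> f x (a \<oplus>\<^bsub>?\<kappa>\<^esub> b) = residue_map \<X> f x a \<oplus>\<^bsub>residue_field \<X> x\<^esub> residue_map \<X> f x b"
      using ring_hom_add[OF r g(1) h(1)] ring_hom_add[OF c g(1) h(1)] m[OF g(1)] m[OF h(1)]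
        m[OF S.a_closed[OF g(1) h(1)]] g(2) h(2) by metis
  next
    show "residue_map \<X> f x \<one>\<^bsub>?\<kappa>\<^esub> = \<one>\<^bsub>residue_field \<X> x\<^esub>"
      using ring_hom_one[OF r] ring_hom_one[OF c] m[OF S.one_closed] by metis
  qed
qed

end

section \<open>Sections over the spectrum of a ring\<close>

context primeideal
begin

abbreviation "loc_frac a s \<equiv> fraction R (carrier R - I) a s"
abbreviation "S \<equiv> carrier R - I"

lemma one_S: "\<one> \<in> S"
  using I_notcarr one_imp_carrier by auto

lemma mult_S: "s \<in> S \<Longrightarrow> t \<in> S \<Longrightarrow> s \<otimes> t \<in> S"
  using I_prime by auto

lemma pow_S: "s \<in> S \<Longrightarrow> s [^] (n::nat) \<in> S"
  by (induction n) (use one_S mult_S in auto)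

lemma frac_memI: "a \<in> carrier R \<Longrightarrow> s \<in> S \<Longrightarrow> (a, s) \<in> loc_frac a s"
  unfolding fraction_def using one_S by (auto intro!: bexI[of _ \<one>] simp: a_minus_def r_neg)

lemma frac_memD:
  assumes "(b, t) \<in> loc_frac a s"
  shows "b \<in> carrier R" "t \<in> S" "\<exists>u\<in>S. u \<otimes> (a \<otimes> t \<ominus> b \<otimes> s) = \<zero>"
  using assms unfolding fraction_def by auto

lemma frac_eqI:
  assumes a: "a \<in> carrier R" "s \<in> S" and b: "b \<in> carrier R" "t \<in> S" and u: "u \<in> S"
    and eq: "u \<otimes> (a \<otimes> t \<ominus> b \<otimes> s) = \<zero>"
  shows "loc_frac a s = loc_frac b t"
proof -
  have sub: "loc_frac a s \<subseteq> loc_frac b t"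
    if a: "a \<in> carrier R" "s \<in> S" and b: "b \<in> carrier R" "t \<in> S" and u: "u \<in> S"
      and eq: "u \<otimes> (a \<otimes> t \<ominus> b \<otimes> s) = \<zero>" for a s b t u
  proof (rule subrelI)
    fix c w assume m: "(c, w) \<in> loc_frac a s"
    note cw = frac_memD(1)[OF m] frac_memD(2)[OF m]
    obtain v where v: "v \<in> S" "v \<otimes> (a \<otimes> w \<ominus> c \<otimes> s) = \<zero>" using frac_memD(3)[OF m] by blast
    have car: "a \<in> carrier R" "s \<in> carrier R" "b \<in> carrier R" "t \<in> carrier R" "u \<in> carrier R"
      "v \<in> carrier R" "c \<in> carrier R" "w \<in> carrier R"
      using a b u v cw by auto
    have "(u \<otimes> v \<otimes> s) \<otimes> (b \<otimes> w \<ominus> c \<otimes> t)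
      = (u \<otimes> t) \<otimes> (v \<otimes> (a \<otimes> w \<ominus> c \<otimes> s)) \<ominus> (v \<otimes> w) \<otimes> (u \<otimes> (a \<otimes> t \<ominus> b \<otimes> s))"
      using car by algebra
    also have "\<dots> = \<zero>" unfolding v(2) eq using car by (simp add: a_minus_def)
    finally show "(c, w) \<in> loc_frac b t"
      unfolding fraction_def using cw mult_S[OF mult_S[OF u v(1)] a(2)] by blast
  qed
  have eq': "u \<otimes> (b \<otimes> s \<ominus> a \<otimes> t) = \<zero>"
  proof -
    have car: "a \<in> carrier R" "s \<in> carrier R" "b \<in> carrier R" "t \<in> carrier R" "u \<in> carrier R"
      using a b u by auto
    have "u \<otimes> (b \<otimes> s \<ominus> a \<otimes> t) = \<ominus> (u \<otimes> (a \<otimes> t \<ominus> b \<otimes> s))" using car by algebra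
    then show ?thesis using eq by simp
  qed
  from sub[OF a b u eq] sub[OF b a u eq'] show ?thesis by blast
qed

lemma frac_eqD:
  assumes "a \<in> carrier R" "s \<in> S" "b \<in> carrier R" "t \<in> S" "loc_frac a s = loc_frac b t"
  obtains u where "u \<in> S" "u \<otimes> (a \<otimes> t \<ominus> b \<otimes> s) = \<zero>"
  using frac_memD(3)[of b t a s] frac_memI[OF assms(3,4)] assms(5) by auto

lemma local_at_carrier: "A \<in> carrier (local_at R I) \<longleftrightarrow> (\<exists>a\<in>carrier R. \<exists>s\<in>S. A = loc_frac a s)"
  unfolding localization_def by auto

lemma frac_mult:
  assumes a: "a \<in> carrier R" "s \<in> S" and b: "b \<in> carrier R" "t \<in> S"
  shows "loc_frac a s \<otimes>\<^bsub>local_at R I\<^esub> loc_frac b t = loc_frac (a \<otimes> b) (s \<otimes> t)"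
proof -
  have "(\<Union>(a, s)\<in>loc_frac a s. \<Union>(b, t)\<in>loc_frac b t. loc_frac (a \<otimes> b) (s \<otimes> t)) = loc_frac (a \<otimes> b) (s \<otimes> t)"
  proof (rule UN_UN_const[OF frac_memI[OF a] frac_memI[OF b]])
    fix a' s' b' t' assume m: "(a', s') \<in> loc_frac a s" "(b', t') \<in> loc_frac b t"
    obtain u v where u: "u \<in> S" "u \<otimes> (a \<otimes> s' \<ominus> a' \<otimes> s) = \<zero>" and v: "v \<in> S" "v \<otimes> (b \<otimes> t' \<ominus> b' \<otimes> t) = \<zero>"
      using frac_memD(3)[OF m(1)] frac_memD(3)[OF m(2)] by blast
    note m' = frac_memD(1)[OF m(1)] frac_memD(2)[OF m(1)] frac_memD(1)[OF m(2)] frac_memD(2)[OF m(2)]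
    have car: "a \<in> carrier R" "s \<in> carrier R" "b \<in> carrier R" "t \<in> carrier R" "u \<in> carrier R"
      "v \<in> carrier R" "a' \<in> carrier R" "s' \<in> carrier R" "b' \<in> carrier R" "t' \<in> carrier R"
      using a b u v m' by auto
    have "(u \<otimes> v) \<otimes> ((a' \<otimes> b') \<otimes> (s \<otimes> t) \<ominus> (a \<otimes> b) \<otimes> (s' \<otimes> t'))
      = \<ominus> ((v \<otimes> b' \<otimes> t) \<otimes> (u \<otimes> (a \<otimes> s' \<ominus> a' \<otimes> s)) \<oplus> (u \<otimes> a \<otimes> s') \<otimes> (v \<otimes> (b \<otimes> t' \<ominus> b' \<otimes> t)))"
      using car by algebra
    also have "\<dots> = \<zero>" unfolding u(2) v(2) using car by simp
    finally show "loc_frac (a' \<otimes> b') (s' \<otimes> t') = loc_frac (a \<otimes> b) (s \<otimes> t)"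
      using a b m' mult_S u v by (intro frac_eqI[of _ _ _ _ "u \<otimes> v"]) auto
  qed
  then show ?thesis by (simp add: localization_def)
qed

lemma frac_add:
  assumes a: "a \<in> carrier R" "s \<in> S" and b: "b \<in> carrier R" "t \<in> S"
  shows "loc_frac a s \<oplus>\<^bsub>local_at R I\<^esub> loc_frac b t = loc_frac (a \<otimes> t \<oplus> b \<otimes> s) (s \<otimes> t)"
proof -
  have "(\<Union>(a, s)\<in>loc_frac a s. \<Union>(b, t)\<in>loc_frac b t. loc_frac (a \<otimes> t \<oplus> b \<otimes> s) (s \<otimes> t))
      = loc_frac (a \<otimes> t \<oplus> b \<otimes> s) (s \<otimes> t)"
  proof (rule UN_UN_const[OF frac_memI[OF a] frac_memI[OF b]])
    fix a' s' b' t' assume m: "(a', s') \<in> loc_frac a s" "(b', t') \<in> loc_frac b t"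
    obtain u v where u: "u \<in> S" "u \<otimes> (a \<otimes> s' \<ominus> a' \<otimes> s) = \<zero>" and v: "v \<in> S" "v \<otimes> (b \<otimes> t' \<ominus> b' \<otimes> t) = \<zero>"
      using frac_memD(3)[OF m(1)] frac_memD(3)[OF m(2)] by blast
    note m' = frac_memD(1)[OF m(1)] frac_memD(2)[OF m(1)] frac_memD(1)[OF m(2)] frac_memD(2)[OF m(2)]
    have car: "a \<in> carrier R" "s \<in> carrier R" "b \<in> carrier R" "t \<in> carrier R" "u \<in> carrier R"
      "v \<in> carrier R" "a' \<in> carrier R" "s' \<in> carrier R" "b' \<in> carrier R" "t' \<in> carrier R"
      using a b u v m' by auto
    have "(u \<otimes> v) \<otimes> ((a' \<otimes> t' \<oplus> b' \<otimes> s') \<otimes> (s \<otimes> t) \<ominus> (a \<otimes> t \<oplus> b \<otimes> s) \<otimes> (s' \<otimes> t'))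
      = \<ominus> ((v \<otimes> t \<otimes> t') \<otimes> (u \<otimes> (a \<otimes> s' \<ominus> a' \<otimes> s)) \<oplus> (u \<otimes> s \<otimes> s') \<otimes> (v \<otimes> (b \<otimes> t' \<ominus> b' \<otimes> t)))"
      using car by algebra
    also have "\<dots> = \<zero>" unfolding u(2) v(2) using car by simp
    finally show "loc_frac (a' \<otimes> t' \<oplus> b' \<otimes> s') (s' \<otimes> t') = loc_frac (a \<otimes> t \<oplus> b \<otimes> s) (s \<otimes> t)"
      using a b m' mult_S u v by (intro frac_eqI[of _ _ _ _ "u \<otimes> v"]) auto
  qed
  then show ?thesis by (simp add: localization_def)
qed

lemma local_at_simps: "\<one>\<^bsub>local_at R I\<^esub> = loc_frac \<one> \<one>" "\<zero>\<^bsub>local_at R I\<^esub> = loc_frac \<zero> \<one>"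
  by (simp_all add: localization_def)

lemma frac_eq_zero_iff:
  assumes "a \<in> carrier R" "s \<in> S"
  shows "loc_frac a s = loc_frac \<zero> \<one> \<longleftrightarrow> (\<exists>u\<in>S. u \<otimes> a = \<zero>)"
proof
  assume "loc_frac a s = loc_frac \<zero> \<one>"
  then obtain u where "u \<in> S" "u \<otimes> (a \<otimes> \<one> \<ominus> \<zero> \<otimes> s) = \<zero>"
    using frac_eqD[OF assms zero_closed one_S] by metis
  then show "\<exists>u\<in>S. u \<otimes> a = \<zero>" using assms by (auto simp: a_minus_def)
next
  assume "\<exists>u\<in>S. u \<otimes> a = \<zero>"
  then obtain u where u: "u \<in> S" "u \<otimes> a = \<zero>" by blast
  then have "u \<otimes> (a \<otimes> \<one> \<ominus> \<zero> \<otimes> s) = \<zero>" using assms by (simp add: a_minus_def)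
  then show "loc_frac a s = loc_frac \<zero> \<one>" using frac_eqI[OF assms zero_closed one_S u(1)] by blast
qed

end

context cring
begin

definition basic_open where "basic_open f = {P \<in> prime_spectrum R. f \<notin> P}"

lemma primeD: "P \<in> prime_spectrum R \<Longrightarrow> primeideal P R"
  by (simp add: prime_spectrum_def)

lemma basic_open_open: "f \<in> carrier R \<Longrightarrow> openin (zariski R) (basic_open f)"
  unfolding zariski_def basic_open_def by (rule topology_generated_by_Basis) blast

lemma one_notin_prime: "P \<in> prime_spectrum R \<Longrightarrow> \<one> \<notin> P"
  using primeideal.one_S[OF primeD] by blast

lemma topspace_zariski [simp]: "topspace (zariski R) = prime_spectrum R"
proof -
  have "prime_spectrum R \<subseteq> {P \<in> prime_spectrum R. \<one> \<notin> P}" using one_notin_prime by blast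
  then show ?thesis unfolding zariski_def topology_generated_by_topspace by fastforce
qed

lemma basic_open_mult:
  assumes "f \<in> carrier R" "g \<in> carrier R"
  shows "basic_open (f \<otimes> g) = basic_open f \<inter> basic_open g"
proof -
  have "f \<otimes> g \<in> P \<longleftrightarrow> f \<in> P \<or> g \<in> P" if "P \<in> prime_spectrum R" for P
  proof -
    interpret P: primeideal P R using primeD[OF that] .
    show ?thesis using P.I_prime[OF assms] P.I_l_closed[OF _ assms(1)] P.I_r_closed[OF _ assms(2)] by metis
  qed
  then show ?thesis unfolding basic_open_def by blast
qed

lemma basic_open_basis:
  assumes "openin (zariski R) V" "P \<in> V"
  obtains f where "f \<in> carrier R" "P \<in> basic_open f" "basic_open f \<subseteq> V"
proof -
  let ?B = "{{P \<in> prime_spectrum R. f \<notin> P} | f. f \<in> carrier R}"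
  have "generate_topology_on ?B V"
    using assms(1) unfolding zariski_def openin_topology_generated_by_iff .
  then have "\<forall>P\<in>V. \<exists>f\<in>carrier R. P \<in> basic_open f \<and> basic_open f \<subseteq> V"
  proof induction
    case (Int a b)
    show ?case
    proof
      fix P assume "P \<in> a \<inter> b"
      then obtain f g where "f \<in> carrier R" "P \<in> basic_open f" "basic_open f \<subseteq> a"
        "g \<in> carrier R" "P \<in> basic_open g" "basic_open g \<subseteq> b" using Int.IH by blast
      then show "\<exists>f\<in>carrier R. P \<in> basic_open f \<and> basic_open f \<subseteq> a \<inter> b"
        by (intro bexI[of _ "f \<otimes> g"]) (auto simp: basic_open_mult)
    qed
  next
    case (Basis s)
    then show ?case unfolding basic_open_def by blast
  qed (blast, meson UnionE Union_upper subset_trans)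
  then show thesis using that assms(2) by blast
qed

definition spec_const where
  "spec_const U a = (\<lambda>P\<in>U. fraction R (carrier R - P) a \<one>)"

lemma spec_const_closed:
  assumes U: "openin (zariski R) U" and a: "a \<in> carrier R"
  shows "spec_const U a \<in> carrier (spec_sec R U)"
proof -
  have P: "P \<in> prime_spectrum R" if "P \<in> U" for P using openin_subset[OF U] that by auto
  have "spec_const U a \<in> (\<Pi>\<^sub>E P\<in>U. carrier (local_at R P))"
  proof (rule PiE_I)
    fix P assume PU: "P \<in> U"
    interpret P: primeideal P R using primeD[OF P[OF PU]] .
    show "spec_const U a P \<in> carrier (local_at R P)"
      unfolding P.local_at_carrier using a P.one_S PU by (auto simp: spec_const_def)
  qed (simp add: spec_const_def)
  moreover have "\<forall>P\<in>U. \<exists>V. openin (zariski R) V \<and> P \<in> V \<and> V \<subseteq> U \<and>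
      (\<exists>c\<in>carrier R. \<exists>b\<in>carrier R. \<forall>Q\<in>V. b \<notin> Q \<and> spec_const U a Q = fraction R (carrier R - Q) c b)"
    using U a one_notin_prime[OF P] unfolding spec_const_def by fastforce
  ultimately show ?thesis unfolding spec_sec_def by simp
qed

lemma spec_sec_simps:
  "s \<otimes>\<^bsub>spec_sec R U\<^esub> t = (\<lambda>P\<in>U. s P \<otimes>\<^bsub>local_at R P\<^esub> t P)"
  "s \<oplus>\<^bsub>spec_sec R U\<^esub> t = (\<lambda>P\<in>U. s P \<oplus>\<^bsub>local_at R P\<^esub> t P)"
  "\<one>\<^bsub>spec_sec R U\<^esub> = (\<lambda>P\<in>U. \<one>\<^bsub>local_at R P\<^esub>)"
  "\<zero>\<^bsub>spec_sec R U\<^esub> = (\<lambda>P\<in>U. \<zero>\<^bsub>local_at R P\<^esub>)"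
  by (simp_all add: spec_sec_def)

lemma spec_secD:
  assumes "s \<in> carrier (spec_sec R U)" "P \<in> U"
  obtains V a b where "openin (zariski R) V" "P \<in> V" "V \<subseteq> U" "a \<in> carrier R" "b \<in> carrier R"
    "\<And>Q. Q \<in> V \<Longrightarrow> b \<notin> Q \<and> s Q = fraction R (carrier R - Q) a b"
proof -
  have "\<exists>V. openin (zariski R) V \<and> P \<in> V \<and> V \<subseteq> U \<and>
      (\<exists>a\<in>carrier R. \<exists>b\<in>carrier R. \<forall>Q\<in>V. b \<notin> Q \<and> s Q = fraction R (carrier R - Q) a b)"
    using assms unfolding spec_sec_def by simp
  then show thesis using that by blast
qed

lemma spec_const_hom:
  assumes U: "openin (zariski R) U"
  shows "spec_const U \<in> ring_hom R (spec_sec R U)"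
proof (rule ring_hom_memI)
  have P: "P \<in> prime_spectrum R" if "P \<in> U" for P using openin_subset[OF U] that by auto
  show "spec_const U a \<in> carrier (spec_sec R U)" if "a \<in> carrier R" for a
    using spec_const_closed[OF U that] .
  fix a b assume ab: "a \<in> carrier R" "b \<in> carrier R"
  show "spec_const U (a \<otimes> b) = spec_const U a \<otimes>\<^bsub>spec_sec R U\<^esub> spec_const U b"
    unfolding spec_sec_simps
  proof (rule extensionalityI[of _ U])
    fix Q assume Q: "Q \<in> U"
    interpret Q: primeideal Q R using primeD[OF P[OF Q]] .
    show "spec_const U (a \<otimes> b) Q = (\<lambda>P\<in>U. spec_const U a P \<otimes>\<^bsub>local_at R P\<^esub> spec_const U b P) Q"
      using Q ab Q.frac_mult[OF ab(1) Q.one_S ab(2) Q.one_S] by (simp add: spec_const_def)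
  qed (auto simp: spec_const_def)
  show "spec_const U (a \<oplus> b) = spec_const U a \<oplus>\<^bsub>spec_sec R U\<^esub> spec_const U b"
    unfolding spec_sec_simps
  proof (rule extensionalityI[of _ U])
    fix Q assume Q: "Q \<in> U"
    interpret Q: primeideal Q R using primeD[OF P[OF Q]] .
    show "spec_const U (a \<oplus> b) Q = (\<lambda>P\<in>U. spec_const U a P \<oplus>\<^bsub>local_at R P\<^esub> spec_const U b P) Q"
      using Q ab Q.frac_add[OF ab(1) Q.one_S ab(2) Q.one_S] by (simp add: spec_const_def)
  qed (auto simp: spec_const_def)
next
  show "spec_const U \<one> = \<one>\<^bsub>spec_sec R U\<^esub>"
    unfolding spec_sec_simps spec_const_def by (simp add: localization_def)
qed

text \<open>One power of \<open>g\<close> serves all primes at once because the spectrum is quasi-compact. Instead of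
  choosing a finite cover by basic open sets, consider the set \<open>J\<close> of all \<open>a\<close> such that one power of
  \<open>g\<close> kills the section at all primes without \<open>a\<close>. It is an ideal, since a prime without \<open>a + b\<close>
  misses \<open>a\<close> or \<open>b\<close>, and since exponents can be added. If it were proper, it would lie in a maximal
  ideal \<open>M\<close>. Near \<open>M\<close>, on the basic open set of some \<open>h\<close>, the section is a fraction \<open>c / e\<close>.
  It vanishes at every prime without \<open>g h\<close>, so no such prime contains the annihilator of \<open>c\<close>; hence
  some power of \<open>g h\<close> kills \<open>c\<close>. But then \<open>h \<in> J\<close>, although \<open>h \<notin> M\<close>.\<close>

lemma spec_section_torsion:
  assumes s: "s \<in> carrier (spec_sec R (prime_spectrum R))" and g: "g \<in> carrier R"
    and van: "\<And>P. P \<in> basic_open g \<Longrightarrow> s P = \<zero>\<^bsub>local_at R P\<^esub>"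
  obtains N :: nat where
    "spec_const (prime_spectrum R) (g [^] N) \<otimes>\<^bsub>spec_sec R (prime_spectrum R)\<^esub> s
      = \<zero>\<^bsub>spec_sec R (prime_spectrum R)\<^esub>"
proof -
  define kills where "kills N P \<longleftrightarrow> (\<exists>c\<in>carrier R. \<exists>e\<in>carrier R - P. \<exists>u\<in>carrier R - P.
    s P = fraction R (carrier R - P) c e \<and> u \<otimes> (g [^] N \<otimes> c) = \<zero>)" for N :: nat and P
  have kills_mono: "kills (N + M) P" if k: "kills N P" for N M P
  proof -
    obtain c e u where c: "c \<in> carrier R" "e \<in> carrier R - P" "u \<in> carrier R - P"
      "s P = fraction R (carrier R - P) c e" "u \<otimes> (g [^] N \<otimes> c) = \<zero>"
      using k unfolding kills_def by blast
    have "u \<otimes> (g [^] (N + M) \<otimes> c) = g [^] M \<otimes> (u \<otimes> (g [^] N \<otimes> c))"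
    proof -
      have u: "u \<in> carrier R" using c(3) by blast
      have "u \<otimes> ((y \<otimes> z) \<otimes> c) = z \<otimes> (u \<otimes> (y \<otimes> c))" if "y \<in> carrier R" "z \<in> carrier R" for y z
        using that u c(1) by algebra
      then show ?thesis using g nat_pow_mult[OF g, of N M] by (metis nat_pow_closed)
    qed
    then have "u \<otimes> (g [^] (N + M) \<otimes> c) = \<zero>" using c g by simp
    then show ?thesis using c unfolding kills_def by blast
  qed
  define J where "J = {a \<in> carrier R. \<exists>N. \<forall>P\<in>basic_open a. kills N P}"
  have J: "ideal J R"
  proof (rule idealI)
    show "ring R" by (rule ring_axioms)
    have zero: "basic_open \<zero> = {}"
      unfolding basic_open_def using primeideal.axioms(1)[OF primeD] ideal.axioms(1)
        additive_subgroup.zero_closed by blast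
    have neg: "basic_open (\<ominus> a) = basic_open a" if "a \<in> carrier R" for a
    proof -
      have "\<ominus> a \<in> P \<longleftrightarrow> a \<in> P" if "P \<in> prime_spectrum R" for P
      proof -
        interpret P: primeideal P R using primeD[OF that] .
        show ?thesis using P.a_inv_closed \<open>a \<in> carrier R\<close> by (metis minus_minus)
      qed
      then show ?thesis unfolding basic_open_def by blast
    qed
    have add: "basic_open (a \<oplus> b) \<subseteq> basic_open a \<union> basic_open b" for a b
    proof
      fix P assume P: "P \<in> basic_open (a \<oplus> b)"
      then interpret P: primeideal P R using primeD unfolding basic_open_def by blast
      show "P \<in> basic_open a \<union> basic_open b" using P P.a_closed unfolding basic_open_def by blast
    qed
    show "subgroup J (add_monoid R)"
    proof (rule subgroup.intro)
      show "\<one>\<^bsub>add_monoid R\<^esub> \<in> J" unfolding J_def by (simp add: zero)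
      show "x \<otimes>\<^bsub>add_monoid R\<^esub> y \<in> J" if xy: "x \<in> J" "y \<in> J" for x y
      proof -
        obtain N M where "\<forall>P\<in>basic_open x. kills N P" "\<forall>P\<in>basic_open y. kills M P"
          using xy unfolding J_def by blast
        then have "\<forall>P\<in>basic_open (x \<oplus> y). kills (N + M) P"
          using add[of x y] kills_mono[of N _ M] kills_mono[of M _ N] by (auto simp: add.commute)
        then show ?thesis using that unfolding J_def by auto
      qed
      show "inv\<^bsub>add_monoid R\<^esub> x \<in> J" if "x \<in> J" for x
        using that neg unfolding J_def by (auto simp: a_inv_def[symmetric])
    qed (auto simp: J_def)
    show "x \<otimes> a \<in> J" "a \<otimes> x \<in> J" if "a \<in> J" "x \<in> carrier R" for a x
      using that basic_open_mult unfolding J_def by auto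
  qed
  have "\<one> \<in> J"
  proof (rule ccontr)
    assume "\<one> \<notin> J"
    then obtain M where M: "maximalideal M R" "J \<subseteq> M" using exists_maximalideal[OF J] by blast
    have MP: "M \<in> prime_spectrum R" using maximalideal_prime[OF M(1)] by (simp add: prime_spectrum_def)
    obtain V c e where V: "openin (zariski R) V" "M \<in> V" and c: "c \<in> carrier R" "e \<in> carrier R"
      and sV: "\<And>Q. Q \<in> V \<Longrightarrow> e \<notin> Q \<and> s Q = fraction R (carrier R - Q) c e"
      using spec_secD[OF s MP] by metis
    obtain h where h: "h \<in> carrier R" "M \<in> basic_open h" "basic_open h \<subseteq> V"
      using basic_open_basis[OF V] by blast
    have ann: "ideal {r \<in> carrier R. c \<otimes> r \<in> {\<zero>}} R"
      using ideal.helper_max_prime[OF zeroideal is_cring c(1)] .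
    have "\<exists>N::nat. c \<otimes> (g \<otimes> h) [^] N = \<zero>"
    proof (rule ccontr)
      assume "\<not> ?thesis"
      then have av: "(g \<otimes> h) [^] N \<notin> {r \<in> carrier R. c \<otimes> r \<in> {\<zero>}}" for N :: nat by simp
      have gh: "g \<otimes> h \<in> carrier R" using g h by simp
      obtain P where P: "primeideal P R" "{r \<in> carrier R. c \<otimes> r \<in> {\<zero>}} \<subseteq> P" "g \<otimes> h \<notin> P"
        using exists_primeideal_avoiding[OF ann gh av] by blast
      interpret P: primeideal P R using P(1) .
      have "P \<in> basic_open (g \<otimes> h)" using P unfolding basic_open_def prime_spectrum_def by blast
      then have Pg: "P \<in> basic_open g" "P \<in> V" using basic_open_mult[OF g h(1)] h(3) by auto
      have "P.loc_frac c e = P.loc_frac \<zero> \<one>" "e \<in> P.S"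
        using sV[OF Pg(2)] van[OF Pg(1)] c P.local_at_simps by auto
      then obtain u where "u \<in> P.S" "u \<otimes> c = \<zero>" using P.frac_eq_zero_iff c(1) by blast
      then show False using P(2) c(1) m_comm by auto
    qed
    then obtain N :: nat where N: "c \<otimes> (g \<otimes> h) [^] N = \<zero>" by blast
    have "kills N P" if P: "P \<in> basic_open h" for P
    proof -
      interpret P: primeideal P R using P primeD unfolding basic_open_def by blast
      have "h [^] N \<in> P.S" using P.pow_S P h(1) unfolding basic_open_def by blast
      moreover have "h [^] N \<otimes> (g [^] N \<otimes> c) = \<zero>"
        using N c g h by (simp add: nat_pow_distrib m_ac)
      ultimately show ?thesis using c sV[of P] h(3) P unfolding kills_def by blast
    qed
    then have "h \<in> J" using h(1) unfolding J_def by blast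
    then show False using M(2) h(2) unfolding basic_open_def by blast
  qed
  then obtain N where N: "\<forall>P\<in>basic_open \<one>. kills N P" unfolding J_def by blast
  show thesis
  proof (rule that[of N])
    show "spec_const (prime_spectrum R) (g [^] N) \<otimes>\<^bsub>spec_sec R (prime_spectrum R)\<^esub> s
      = \<zero>\<^bsub>spec_sec R (prime_spectrum R)\<^esub>"
      unfolding spec_sec_simps
    proof (rule restrict_ext)
      fix P assume P: "P \<in> prime_spectrum R"
      interpret P: primeideal P R using primeD[OF P] .
      have "kills N P" using N P one_notin_prime unfolding basic_open_def by blast
      then obtain c e u where c: "c \<in> carrier R" "e \<in> P.S" "u \<in> P.S"
        "s P = P.loc_frac c e" "u \<otimes> (g [^] N \<otimes> c) = \<zero>" unfolding kills_def by blast
      have "P.loc_frac (g [^] N \<otimes> c) (\<one> \<otimes> e) = P.loc_frac \<zero> \<one>"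
        using P.frac_eq_zero_iff[of "g [^] N \<otimes> c" "\<one> \<otimes> e"] P.mult_S[OF P.one_S c(2)] c g by blast
      then show "spec_const (prime_spectrum R) (g [^] N) P \<otimes>\<^bsub>local_at R P\<^esub> s P = \<zero>\<^bsub>local_at R P\<^esub>"
        using P.frac_mult[OF _ P.one_S c(1,2), of "g [^] N"] c(4) g P
        by (simp add: spec_const_def P.local_at_simps)
    qed
  qed
qed

end

section \<open>Affine charts\<close>

lemma primeideal_vimage:
  assumes R: "cring R" and h: "h \<in> ring_hom R S" and Q: "primeideal Q S"
  shows "primeideal {a \<in> carrier R. h a \<in> Q} R"
proof -
  interpret R: cring R by fact
  interpret Q: primeideal Q S by fact
  interpret h: ring_hom_ring R S h
    by (rule ring_hom_ringI2[OF R.ring_axioms Q.ring_axioms h])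
  show ?thesis
  proof (rule primeidealI)
    show "ideal {a \<in> carrier R. h a \<in> Q} R" using h.ideal_vimage[OF Q.ideal_axioms] .
    show "cring R" by fact
    have "\<one>\<^bsub>S\<^esub> \<notin> Q" using Q.one_imp_carrier Q.I_notcarr by metis
    then show "carrier R \<noteq> {a \<in> carrier R. h a \<in> Q}" using h.hom_one R.one_closed by (metis (no_types, lifting) mem_Collect_eq)
  qed (use Q.I_prime in auto)
qed

context ringed_space
begin

definition inv_locus where "inv_locus U s = {w \<in> U. inv_at w U s}"

lemma inv_locus_open:
  assumes "openin (rs_top \<X>) U"
  shows "openin (rs_top \<X>) (inv_locus U s)"
proof (subst openin_subopen, intro ballI)
  fix w assume "w \<in> inv_locus U s"
  then obtain W t where W: "openin (rs_top \<X>) W" "w \<in> W" "W \<subseteq> U" "t \<in> carrier (rs_sec \<X> W)"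
    "rs_res \<X> U W s \<otimes>\<^bsub>rs_sec \<X> W\<^esub> t = \<one>\<^bsub>rs_sec \<X> W\<^esub>" unfolding inv_locus_def inv_at_def by blast
  then have "W \<subseteq> inv_locus U s" unfolding inv_locus_def inv_at_def by blast
  with W show "\<exists>T. openin (rs_top \<X>) T \<and> w \<in> T \<and> T \<subseteq> inv_locus U s" by blast
qed

text \<open>The three properties of an affine scheme that the proof uses, in terms of global sections: a
  section near a point is a fraction of global sections on the whole locus where the denominator is
  invertible; primes of the ring of global sections come from points; points are separated by the
  vanishing of global sections. They refer to invertibility only, so they are easy to transport along
  isomorphisms.\<close>

definition affine_like where
  "affine_like \<longleftrightarrow>
    (let G = rs_points \<X>; \<Gamma> = carrier (rs_sec \<X> G) in
     (\<forall>z V t. sec_at z V t \<longrightarrow> (\<exists>c\<in>\<Gamma>. \<exists>g\<in>\<Gamma>. inv_at z G g \<and> inv_locus G g \<subseteq> V \<and>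
       rs_res \<X> V (inv_locus G g) t \<otimes>\<^bsub>rs_sec \<X> (inv_locus G g)\<^esub> rs_res \<X> G (inv_locus G g) g
         = rs_res \<X> G (inv_locus G g) c)) \<and>
     (\<forall>Q. primeideal Q (rs_sec \<X> G) \<longrightarrow> (\<exists>z\<in>G. \<forall>s\<in>\<Gamma>. inv_at z G s \<longleftrightarrow> s \<notin> Q)) \<and>
     (\<forall>z\<in>G. \<forall>w\<in>G. (\<forall>s\<in>\<Gamma>. inv_at z G s \<longleftrightarrow> inv_at w G s) \<longrightarrow> z = w))"

end

lemma Spec_simps [simp]:
  "rs_top (Spec R) = zariski R" "rs_sec (Spec R) = spec_sec R" "rs_res (Spec R) = (\<lambda>U V s. restrict s V)"
  by (simp_all add: Spec_def)

locale spec_scheme = cring R + Z: locally_ringed_space "Spec R" for R (structure)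
begin

abbreviation Sp where "Sp \<equiv> prime_spectrum R"

lemma points [simp]: "rs_points (Spec R) = Sp"
  by simp

lemma Sp_open: "openin (zariski R) Sp"
  using openin_topspace[of "zariski R"] by simp

lemma restrict_spec_const: "W \<subseteq> U \<Longrightarrow> restrict (spec_const U a) W = spec_const W a"
  unfolding spec_const_def by (simp add: restrict_restrict Int_absorb1)

lemma inv_at_spec_const:
  assumes U: "openin (zariski R) U" "P \<in> U" and a: "a \<in> carrier R"
  shows "Z.inv_at P U (spec_const U a) \<longleftrightarrow> a \<notin> P"
proof
  have prime: "Q \<in> Sp" if "Q \<in> U" for Q using openin_subset[OF U(1)] that by auto
  interpret P: primeideal P R using primeD[OF prime[OF U(2)]] .
  {
    assume "Z.inv_at P U (spec_const U a)"
    then obtain W t where W: "openin (zariski R) W" "P \<in> W" "W \<subseteq> U" "t \<in> carrier (spec_sec R W)"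
      "spec_const W a \<otimes>\<^bsub>spec_sec R W\<^esub> t = \<one>\<^bsub>spec_sec R W\<^esub>"
      unfolding Z.inv_at_def using restrict_spec_const by auto
    obtain c e where c: "c \<in> carrier R" "e \<in> P.S" "t P = P.loc_frac c e"
      using spec_secD[OF W(4,2)] W(2) by (metis DiffI)
    have "(spec_const W a \<otimes>\<^bsub>spec_sec R W\<^esub> t) P = \<one>\<^bsub>spec_sec R W\<^esub> P" using W(5) by simp
    then have "P.loc_frac a \<one> \<otimes>\<^bsub>local_at R P\<^esub> P.loc_frac c e = P.loc_frac \<one> \<one>"
      using W(2) c(3) by (simp add: spec_sec_simps spec_const_def P.local_at_simps)
    then have "P.loc_frac (a \<otimes> c) (\<one> \<otimes> e) = P.loc_frac \<one> \<one>"
      using P.frac_mult[OF a P.one_S c(1,2)] by simp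
    then obtain u where u: "u \<in> P.S" "u \<otimes> (a \<otimes> c \<otimes> \<one> \<ominus> \<one> \<otimes> (\<one> \<otimes> e)) = \<zero>"
      using P.frac_eqD[OF m_closed[OF a c(1)] P.mult_S[OF P.one_S c(2)] one_closed P.one_S] by metis
    show "a \<notin> P"
    proof
      assume "a \<in> P"
      then have "u \<otimes> (a \<otimes> c) \<in> P" using P.I_l_closed P.I_r_closed u c by blast
      moreover have "u \<otimes> (a \<otimes> c) = u \<otimes> e"
      proof -
        have car: "u \<in> carrier R" "e \<in> carrier R" using u c by auto
        have "u \<otimes> (a \<otimes> c) = u \<otimes> (a \<otimes> c \<otimes> \<one> \<ominus> \<one> \<otimes> (\<one> \<otimes> e)) \<oplus> u \<otimes> e"
          using car a c(1) by algebra
        then show ?thesis using u(2) car by simp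
      qed
      ultimately show False using P.mult_S[OF u(1) c(2)] by simp
    qed
  next
    assume aP: "a \<notin> P"
    let ?W = "U \<inter> basic_open a"
    have W: "openin (zariski R) ?W" using U(1) basic_open_open[OF a] by blast
    have WP: "primeideal Q R" "a \<in> carrier R - Q" if "Q \<in> ?W" for Q
      using that primeD a unfolding basic_open_def by auto
    define t where "t = (\<lambda>Q\<in>?W. fraction R (carrier R - Q) \<one> a)"
    have "t \<in> (\<Pi>\<^sub>E P\<in>?W. carrier (local_at R P))"
    proof (rule PiE_I)
      fix Q assume Q: "Q \<in> ?W"
      interpret Q: primeideal Q R using WP(1)[OF Q] .
      show "t Q \<in> carrier (local_at R Q)"
        unfolding Q.local_at_carrier using WP(2)[OF Q] Q by (auto simp: t_def)
    qed (auto simp: t_def)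
    moreover have "\<forall>P\<in>?W. \<exists>V. openin (zariski R) V \<and> P \<in> V \<and> V \<subseteq> ?W \<and>
      (\<exists>c\<in>carrier R. \<exists>b\<in>carrier R. \<forall>Q\<in>V. b \<notin> Q \<and> t Q = fraction R (carrier R - Q) c b)"
    proof
      fix Q assume "Q \<in> ?W"
      then show "\<exists>V. openin (zariski R) V \<and> Q \<in> V \<and> V \<subseteq> ?W \<and>
        (\<exists>c\<in>carrier R. \<exists>b\<in>carrier R. \<forall>Q\<in>V. b \<notin> Q \<and> t Q = fraction R (carrier R - Q) c b)"
        using W a WP(2) by (intro exI[of _ ?W] conjI bexI[of _ \<one>] bexI[of _ a]) (auto simp: t_def)
    qed
    ultimately have t: "t \<in> carrier (spec_sec R ?W)" unfolding spec_sec_def by simp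
    have "spec_const ?W a \<otimes>\<^bsub>spec_sec R ?W\<^esub> t = \<one>\<^bsub>spec_sec R ?W\<^esub>"
      unfolding spec_sec_simps
    proof (rule restrict_ext)
      fix Q assume Q: "Q \<in> ?W"
      interpret Q: primeideal Q R using WP(1)[OF Q] .
      have "Q.loc_frac (a \<otimes> \<one>) (\<one> \<otimes> a) = Q.loc_frac \<one> \<one>"
        using a WP(2)[OF Q] Q.one_S by (intro Q.frac_eqI[of _ _ _ _ \<one>]) (auto simp: a_minus_def r_neg)
      then show "spec_const ?W a Q \<otimes>\<^bsub>local_at R Q\<^esub> t Q = \<one>\<^bsub>local_at R Q\<^esub>"
        using Q.frac_mult[OF a Q.one_S one_closed WP(2)[OF Q]] Q
        by (simp add: spec_const_def t_def Q.local_at_simps)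
    qed
    moreover have "P \<in> ?W" using U(2) aP prime[OF U(2)] unfolding basic_open_def by blast
    ultimately show "Z.inv_at P U (spec_const U a)"
      unfolding Z.inv_at_def using W t restrict_spec_const[of ?W U a]
      by (intro exI[of _ ?W] exI[of _ t]) auto
  }
qed

lemma inv_locus_spec_const: "a \<in> carrier R \<Longrightarrow> Z.inv_locus Sp (spec_const Sp a) = basic_open a"
  using inv_at_spec_const[OF Sp_open] unfolding Z.inv_locus_def basic_open_def by auto

text \<open>If \<open>t\<close> is \<open>c / e\<close> on the basic open set of \<open>f\<close>, then it is \<open>(c f) / (e f)\<close> on the basic
  open set of \<open>e f\<close>, which is exactly the locus where the denominator is invertible.\<close>

lemma local_fraction:
  assumes t: "Z.sec_at P V t"
  obtains c g where "c \<in> carrier R" "g \<in> carrier R" "g \<notin> P" "basic_open g \<subseteq> V"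
    "restrict t (basic_open g) \<otimes>\<^bsub>spec_sec R (basic_open g)\<^esub> spec_const (basic_open g) g
      = spec_const (basic_open g) c"
proof -
  have V: "openin (zariski R) V" "P \<in> V" "t \<in> carrier (spec_sec R V)"
    using t unfolding Z.sec_at_def by auto
  obtain N c e where N: "openin (zariski R) N" "P \<in> N" "N \<subseteq> V" and c: "c \<in> carrier R" "e \<in> carrier R"
    and tN: "\<And>Q. Q \<in> N \<Longrightarrow> e \<notin> Q \<and> t Q = fraction R (carrier R - Q) c e"
    using spec_secD[OF V(3,2)] by metis
  obtain f where f: "f \<in> carrier R" "P \<in> basic_open f" "basic_open f \<subseteq> N"
    using basic_open_basis[OF N(1,2)] by blast
  let ?g = "e \<otimes> f" and ?c = "c \<otimes> f"
  have sub: "basic_open ?g \<subseteq> N" using basic_open_mult[OF c(2) f(1)] f(3) by auto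
  have g: "?g \<notin> P"
    using basic_open_mult[OF c(2) f(1)] f(2) tN[OF N(2)] unfolding basic_open_def by blast
  have "restrict t (basic_open ?g) \<otimes>\<^bsub>spec_sec R (basic_open ?g)\<^esub> spec_const (basic_open ?g) ?g
      = spec_const (basic_open ?g) ?c"
    unfolding spec_sec_simps
  proof (rule extensionalityI[of _ "basic_open ?g"])
    fix Q assume Q: "Q \<in> basic_open ?g"
    interpret Q: primeideal Q R using Q primeD unfolding basic_open_def by blast
    have e: "e \<in> Q.S" "t Q = Q.loc_frac c e" using tN[of Q] Q sub c by auto
    have car: "c \<otimes> ?g \<in> carrier R" "?c \<in> carrier R" "?g \<in> carrier R" using c f by auto
    have "\<one> \<otimes> (c \<otimes> ?g \<otimes> \<one> \<ominus> ?c \<otimes> (e \<otimes> \<one>)) = \<zero>" using c f(1) by algebra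
    then have "Q.loc_frac (c \<otimes> ?g) (e \<otimes> \<one>) = Q.loc_frac ?c \<one>"
      using Q.frac_eqI[OF car(1) Q.mult_S[OF e(1) Q.one_S] car(2) Q.one_S Q.one_S] by blast
    then show "(\<lambda>P\<in>basic_open ?g. restrict t (basic_open ?g) P \<otimes>\<^bsub>local_at R P\<^esub>
        spec_const (basic_open ?g) ?g P) Q = spec_const (basic_open ?g) ?c Q"
      using Q.frac_mult[OF c(1) e(1) car(3) Q.one_S] e(2) Q by (simp add: spec_const_def)
  qed (auto simp: spec_const_def)
  then show thesis using that[of ?c ?g] c f g sub N(3) by blast
qed

text \<open>The point is the prime \<open>P\<close> of ring elements that belong to \<open>Q\<close> as sections. To compare the two at a
  global section \<open>s\<close> that need not come from the ring, write \<open>s\<close> near \<open>P\<close> as \<open>c / g\<close>. By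
  \<open>spec_section_torsion\<close> a power of \<open>g\<close> kills \<open>s g - c\<close>, and this power is not in \<open>Q\<close>, so
  \<open>s g - c \<in> Q\<close>. Hence both \<open>s \<in> Q\<close> and the vanishing of \<open>s\<close> at \<open>P\<close> amount to \<open>c \<in> P\<close>. This avoids
  the identification of the global sections with the ring.\<close>

lemma prime_of_sections_is_point:
  assumes Q: "primeideal Q (spec_sec R Sp)"
  shows "\<exists>P\<in>Sp. \<forall>s\<in>carrier (spec_sec R Sp). Z.inv_at P Sp s \<longleftrightarrow> s \<notin> Q"
proof -
  interpret Q: primeideal Q "spec_sec R Sp" by fact
  let ?G = "spec_sec R Sp"
  note hom = spec_const_hom[OF Sp_open]
  define P where "P = {a \<in> carrier R. spec_const Sp a \<in> Q}"
  have "primeideal P R" unfolding P_def by (rule primeideal_vimage[OF is_cring hom Q])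
  then have P: "P \<in> Sp" by (simp add: prime_spectrum_def)
  interpret \<kappa>: field "residue_field (Spec R) P" using Z.residue_field_field P by simp
  interpret v: ring_hom_ring ?G "residue_field (Spec R) P" "Z.val P Sp"
    using ring_hom_ringI2[OF Q.ring_axioms \<kappa>.ring_axioms] Z.val_hom[of Sp P] Sp_open P by simp
  have "Z.inv_at P Sp s \<longleftrightarrow> s \<notin> Q" if s: "s \<in> carrier ?G" for s
  proof -
    have "Z.sec_at P Sp s" unfolding Z.sec_at_def using Sp_open P s by simp
    then obtain c g where c: "c \<in> carrier R" "g \<in> carrier R" "g \<notin> P" "basic_open g \<subseteq> Sp" and
      eq: "restrict s (basic_open g) \<otimes>\<^bsub>spec_sec R (basic_open g)\<^esub> spec_const (basic_open g) g
        = spec_const (basic_open g) c"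
      by (rule local_fraction)
    let ?D = "basic_open g" and ?\<gamma> = "spec_const Sp g" and ?\<sigma> = "spec_const Sp c"
    have D: "openin (zariski R) ?D" "P \<in> ?D" using basic_open_open[OF c(2)] c(3) P
      unfolding basic_open_def by auto
    have cl: "?\<gamma> \<in> carrier ?G" "?\<sigma> \<in> carrier ?G" using spec_const_closed[OF Sp_open] c by auto
    have rh: "(\<lambda>s. restrict s ?D) \<in> ring_hom ?G (spec_sec R ?D)"
      using Z.res_hom[of Sp ?D] Sp_open D c(4) by simp
    interpret D: cring "spec_sec R ?D" using Z.sec_cring[of ?D] D(1) by simp
    interpret r: ring_hom_ring ?G "spec_sec R ?D" "\<lambda>s. restrict s ?D"
      by (rule ring_hom_ringI2[OF Q.ring_axioms D.ring_axioms rh])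
    define d where "d = s \<otimes>\<^bsub>?G\<^esub> ?\<gamma> \<ominus>\<^bsub>?G\<^esub> ?\<sigma>"
    have d: "d \<in> carrier ?G" unfolding d_def using s cl by simp
    have rd: "restrict d ?D = \<zero>\<^bsub>spec_sec R ?D\<^esub>"
    proof -
      have "restrict d ?D = restrict s ?D \<otimes>\<^bsub>spec_sec R ?D\<^esub> restrict ?\<gamma> ?D \<ominus>\<^bsub>spec_sec R ?D\<^esub> restrict ?\<sigma> ?D"
        unfolding d_def a_minus_def using s cl r.hom_mult r.hom_add r.hom_a_inv by simp
      also have "\<dots> = \<zero>\<^bsub>spec_sec R ?D\<^esub>"
        using eq restrict_spec_const[OF c(4)] r.hom_closed[OF cl(2)] by (simp add: D.r_neg a_minus_def)
      finally show ?thesis .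
    qed
    have "d P' = \<zero>\<^bsub>local_at R P'\<^esub>" if "P' \<in> ?D" for P'
      using fun_cong[OF rd, of P'] that by (simp add: spec_sec_simps)
    then obtain N :: nat where N: "spec_const Sp (g [^] N) \<otimes>\<^bsub>?G\<^esub> d = \<zero>\<^bsub>?G\<^esub>"
      using spec_section_torsion[OF d c(2)] by blast
    have gN: "spec_const Sp (g [^] N) \<notin> Q"
    proof -
      interpret P: primeideal P R using primeD[OF P] .
      have "g [^] N \<notin> P" using P.pow_S[of g N] c by blast
      then show ?thesis unfolding P_def using c by simp
    qed
    have "d \<in> Q"
      using Q.I_prime[of "spec_const Sp (g [^] N)" d] N gN d spec_const_closed[OF Sp_open, of "g [^] N"] c
        Q.zero_closed by auto
    then have "s \<otimes>\<^bsub>?G\<^esub> ?\<gamma> \<in> Q \<longleftrightarrow> ?\<sigma> \<in> Q"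
    proof -
      have "s \<otimes>\<^bsub>?G\<^esub> ?\<gamma> = d \<oplus>\<^bsub>?G\<^esub> ?\<sigma>" "?\<sigma> = s \<otimes>\<^bsub>?G\<^esub> ?\<gamma> \<oplus>\<^bsub>?G\<^esub> (\<ominus>\<^bsub>?G\<^esub> \<one>\<^bsub>?G\<^esub>) \<otimes>\<^bsub>?G\<^esub> d"
        unfolding d_def using s cl by algebra+
      moreover have "(\<ominus>\<^bsub>?G\<^esub> \<one>\<^bsub>?G\<^esub>) \<otimes>\<^bsub>?G\<^esub> d \<in> Q" using Q.I_l_closed[OF \<open>d \<in> Q\<close>] by simp
      ultimately show ?thesis
        using \<open>d \<in> Q\<close> additive_subgroup.a_closed[OF Q.additive_subgroup_axioms] by metis
    qed
    moreover have "?\<gamma> \<notin> Q" using c unfolding P_def by blast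
    ultimately have sQ: "s \<in> Q \<longleftrightarrow> c \<in> P"
      using Q.I_prime[OF s cl(1)] Q.I_r_closed[OF _ cl(1)] c(1) unfolding P_def by blast
    have sat: "Z.sec_at P Sp t" if "t \<in> carrier ?G" for t unfolding Z.sec_at_def using Sp_open P that by simp
    have vD: "Z.val P ?D (restrict t ?D) = Z.val P Sp t" if "t \<in> carrier ?G" for t
      using Z.val_res[OF sat[OF that], of ?D] D c(4) by simp
    interpret vd: ring_hom_ring "spec_sec R ?D" "residue_field (Spec R) P" "Z.val P ?D"
      using ring_hom_ringI2[OF D.ring_axioms \<kappa>.ring_axioms] Z.val_hom[of ?D P] D by simp
    have "Z.val P Sp s \<otimes>\<^bsub>residue_field (Spec R) P\<^esub> Z.val P Sp ?\<gamma> = Z.val P Sp ?\<sigma>"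
      using eq vd.hom_mult[OF r.hom_closed[OF s] r.hom_closed[OF cl(1)]] vD[OF s] vD[OF cl(1)] vD[OF cl(2)]
        restrict_spec_const[OF c(4)] by metis
    moreover have "Z.val P Sp ?\<gamma> \<noteq> \<zero>\<^bsub>residue_field (Spec R) P\<^esub>"
      using Z.val_zero_iff[OF sat[OF cl(1)]] inv_at_spec_const[OF Sp_open P c(2)] c(3) by blast
    ultimately have "Z.val P Sp s = \<zero>\<^bsub>residue_field (Spec R) P\<^esub> \<longleftrightarrow> Z.val P Sp ?\<sigma> = \<zero>\<^bsub>residue_field (Spec R) P\<^esub>"
      using \<kappa>.integral_iff[OF v.hom_closed[OF s] v.hom_closed[OF cl(1)]] by auto
    then have "Z.inv_at P Sp s \<longleftrightarrow> c \<notin> P"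
      using Z.val_zero_iff[OF sat[OF s]] Z.val_zero_iff[OF sat[OF cl(2)]] inv_at_spec_const[OF Sp_open P c(1)]
      by blast
    with sQ show ?thesis by blast
  qed
  with P show ?thesis by blast
qed

lemma affine_like: "Z.affine_like"
  unfolding Z.affine_like_def Let_def points
proof (intro conjI allI impI ballI)
  fix P V t assume t: "Z.sec_at P V t"
  then obtain c g where c: "c \<in> carrier R" "g \<in> carrier R" "g \<notin> P" "basic_open g \<subseteq> V"
    "restrict t (basic_open g) \<otimes>\<^bsub>spec_sec R (basic_open g)\<^esub> spec_const (basic_open g) g
      = spec_const (basic_open g) c"
    by (rule local_fraction)
  have P: "P \<in> Sp" using t openin_subset[of "zariski R" V] unfolding Z.sec_at_def by auto
  have sub: "basic_open g \<subseteq> Sp" unfolding basic_open_def by blast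
  show "\<exists>c\<in>carrier (rs_sec (Spec R) Sp). \<exists>g\<in>carrier (rs_sec (Spec R) Sp). Z.inv_at P Sp g \<and>
      Z.inv_locus Sp g \<subseteq> V \<and>
      rs_res (Spec R) V (Z.inv_locus Sp g) t \<otimes>\<^bsub>rs_sec (Spec R) (Z.inv_locus Sp g)\<^esub>
        rs_res (Spec R) Sp (Z.inv_locus Sp g) g = rs_res (Spec R) Sp (Z.inv_locus Sp g) c"
    using c inv_at_spec_const[OF Sp_open P c(2)] inv_locus_spec_const[OF c(2)]
      spec_const_closed[OF Sp_open] restrict_spec_const[OF sub]
    by (intro bexI[of _ "spec_const Sp c"] bexI[of _ "spec_const Sp g"]) auto
next
  fix Q assume "primeideal Q (rs_sec (Spec R) Sp)"
  then show "\<exists>z\<in>Sp. \<forall>s\<in>carrier (rs_sec (Spec R) Sp). Z.inv_at z Sp s = (s \<notin> Q)"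
    using prime_of_sections_is_point by simp
next
  fix P Q assume PQ: "P \<in> Sp" "Q \<in> Sp"
    and eq: "\<forall>s\<in>carrier (rs_sec (Spec R) Sp). Z.inv_at P Sp s = Z.inv_at Q Sp s"
  have "a \<in> P \<longleftrightarrow> a \<in> Q" if "a \<in> carrier R" for a
    using eq spec_const_closed[OF Sp_open that] inv_at_spec_const[OF Sp_open PQ(1) that]
      inv_at_spec_const[OF Sp_open PQ(2) that] by auto
  moreover have "P \<subseteq> carrier R" "Q \<subseteq> carrier R"
    using PQ primeD primeideal.axioms(1) ideal.axioms(1) additive_subgroup.a_subset by blast+
  ultimately show "P = Q" by blast
qed

end

lemma affine_like_transfer:
  assumes f: "lrs_morphism \<Z> \<S> f" and g: "lrs_morphism \<S> \<Z> g"
    and gf: "rm_eq \<Z> \<Z> (rm_comp \<S> g f) rm_id" and fg: "rm_eq \<S> \<S> (rm_comp \<Z> f g) rm_id"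
    and S: "ringed_space.affine_like \<S>"
  shows "ringed_space.affine_like \<Z>"
proof -
  interpret f: lrs_morphism \<Z> \<S> f by fact
  interpret g: lrs_morphism \<S> \<Z> g by fact
  let ?Z = "rs_points \<Z>" and ?S = "rs_points \<S>"
  have gf_pt: "rm_base g (rm_base f z) = z" if "z \<in> ?Z" for z
    using gf that unfolding rm_eq_def rm_comp_def rm_id_def by simp
  have fg_pt: "rm_base f (rm_base g P) = P" if "P \<in> ?S" for P
    using fg that unfolding rm_eq_def rm_comp_def rm_id_def by simp
  have gf_pull: "rm_pull f (preim \<S> g V) (rm_pull g V t) = t"
    if "openin (rs_top \<Z>) V" "t \<in> carrier (rs_sec \<Z> V)" for V t
    using gf that unfolding rm_eq_def rm_comp_def rm_id_def by simp
  have preZ: "preim \<Z> f ?S = ?Z" and preS: "preim \<S> g ?Z = ?S"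
    using f.base_point g.base_point unfolding preim_def by blast+
  have preV: "preim \<Z> f (preim \<S> g V) = V" if V: "openin (rs_top \<Z>) V" for V
    using openin_subset[OF V] f.base_point gf_pt unfolding preim_def by auto
  note like = S[unfolded f.target.affine_like_def Let_def]
  have S1: "\<exists>c\<in>carrier (rs_sec \<S> ?S). \<exists>g\<in>carrier (rs_sec \<S> ?S). f.target.inv_at z ?S g \<and>
      f.target.inv_locus ?S g \<subseteq> V \<and>
      rs_res \<S> V (f.target.inv_locus ?S g) t \<otimes>\<^bsub>rs_sec \<S> (f.target.inv_locus ?S g)\<^esub>
        rs_res \<S> ?S (f.target.inv_locus ?S g) g = rs_res \<S> ?S (f.target.inv_locus ?S g) c"
    if "f.target.sec_at z V t" for z V t
    by (rule like[THEN conjunct1, rule_format, OF that])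
  have S2: "\<exists>z\<in>?S. \<forall>s\<in>carrier (rs_sec \<S> ?S). f.target.inv_at z ?S s \<longleftrightarrow> s \<notin> Q"
    if "primeideal Q (rs_sec \<S> ?S)" for Q
    by (rule like[THEN conjunct2, THEN conjunct1, rule_format, OF that])
  have S3: "z = w" if "z \<in> ?S" "w \<in> ?S"
    "\<And>s. s \<in> carrier (rs_sec \<S> ?S) \<Longrightarrow> f.target.inv_at z ?S s \<longleftrightarrow> f.target.inv_at w ?S s" for z w
    by (rule like[THEN conjunct2, THEN conjunct2, rule_format]) (use that in auto)
  have So: "openin (rs_top \<S>) ?S" and Zo: "openin (rs_top \<Z>) ?Z" by simp_all
  have fpull: "rm_pull f ?S s \<in> carrier (rs_sec \<Z> ?Z)" if "s \<in> carrier (rs_sec \<S> ?S)" for s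
    using ring_hom_closed[OF f.pull_hom[OF So] that] preZ by simp
  have gpull: "rm_pull g ?Z s \<in> carrier (rs_sec \<S> ?S)" if "s \<in> carrier (rs_sec \<Z> ?Z)" for s
    using ring_hom_closed[OF g.pull_hom[OF Zo] that] preS by simp
  have finv: "f.source.inv_at z ?Z (rm_pull f ?S s) \<longleftrightarrow> f.target.inv_at (rm_base f z) ?S s"
    if "z \<in> ?Z" "s \<in> carrier (rs_sec \<S> ?S)" for z s
    using f.inv_at_pull[OF that(1), of ?S s] preZ f.base_point[OF that(1)] that(2) So
    unfolding f.target.sec_at_def by simp
  have ginv: "f.target.inv_at P ?S (rm_pull g ?Z s) \<longleftrightarrow> f.source.inv_at (rm_base g P) ?Z s"
    if "P \<in> ?S" "s \<in> carrier (rs_sec \<Z> ?Z)" for P s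
    using g.inv_at_pull[OF that(1), of ?Z s] preS g.base_point[OF that(1)] that(2) Zo
    unfolding f.source.sec_at_def by simp
  show ?thesis unfolding f.source.affine_like_def Let_def
  proof (intro conjI allI impI ballI)
    fix z V t assume t: "f.source.sec_at z V t"
    note V = f.source.sec_atD(1)[OF t] f.source.sec_atD(2)[OF t] f.source.sec_atD(3)[OF t]
    have z: "z \<in> ?Z" using f.source.points_memI[OF V(1,2)] .
    let ?V' = "preim \<S> g V"
    have t': "f.target.sec_at (rm_base f z) ?V' (rm_pull g V t)"
      using g.pull_sec_at[OF f.base_point[OF z]] gf_pt[OF z] t by simp
    obtain c' e' where ce: "c' \<in> carrier (rs_sec \<S> ?S)" "e' \<in> carrier (rs_sec \<S> ?S)"
      "f.target.inv_at (rm_base f z) ?S e'" "f.target.inv_locus ?S e' \<subseteq> ?V'"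
      and eq: "rs_res \<S> ?V' (f.target.inv_locus ?S e') (rm_pull g V t)
          \<otimes>\<^bsub>rs_sec \<S> (f.target.inv_locus ?S e')\<^esub> rs_res \<S> ?S (f.target.inv_locus ?S e') e'
        = rs_res \<S> ?S (f.target.inv_locus ?S e') c'"
      using S1[OF t'] by blast
    let ?D = "f.target.inv_locus ?S e'"
    let ?c = "rm_pull f ?S c'" and ?e = "rm_pull f ?S e'"
    have D: "openin (rs_top \<S>) ?D" "?D \<subseteq> ?S"
      using f.target.inv_locus_open[OF So] unfolding f.target.inv_locus_def by auto
    have loc: "f.source.inv_locus ?Z ?e = preim \<Z> f ?D"
      unfolding f.source.inv_locus_def f.target.inv_locus_def preim_def
      using finv[OF _ ce(2)] f.base_point by blast
    have sub: "preim \<Z> f ?D \<subseteq> V"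
    proof
      fix w assume "w \<in> preim \<Z> f ?D"
      then have "w \<in> ?Z" "rm_base f w \<in> ?V'" using ce(4) unfolding preim_def by auto
      then show "w \<in> V" using gf_pt unfolding preim_def by auto
    qed
    have V': "openin (rs_top \<S>) ?V'" using g.preim_open[OF V(1)] .
    have t'c: "rm_pull g V t \<in> carrier (rs_sec \<S> ?V')" using f.target.sec_atD(3)[OF t'] .
    have r: "rs_res \<S> ?V' ?D (rm_pull g V t) \<in> carrier (rs_sec \<S> ?D)"
      "rs_res \<S> ?S ?D e' \<in> carrier (rs_sec \<S> ?D)"
      using f.target.res_closed[OF V' D(1) ce(4) t'c] f.target.res_closed[OF So D ce(2)] by auto
    have "rs_res \<Z> V (preim \<Z> f ?D) t \<otimes>\<^bsub>rs_sec \<Z> (preim \<Z> f ?D)\<^esub> rs_res \<Z> ?Z (preim \<Z> f ?D) ?e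
        = rs_res \<Z> ?Z (preim \<Z> f ?D) ?c"
      using arg_cong[OF eq, of "rm_pull f ?D"] ring_hom_mult[OF f.pull_hom[OF D(1)] r]
        f.pull_natural[OF V' D(1) ce(4) t'c] f.pull_natural[OF So D ce(1)] f.pull_natural[OF So D ce(2)]
        gf_pull[OF V(1,3)] preV[OF V(1)] preZ by simp
    then show "\<exists>c\<in>carrier (rs_sec \<Z> ?Z). \<exists>g\<in>carrier (rs_sec \<Z> ?Z). f.source.inv_at z ?Z g \<and>
        f.source.inv_locus ?Z g \<subseteq> V \<and>
        rs_res \<Z> V (f.source.inv_locus ?Z g) t \<otimes>\<^bsub>rs_sec \<Z> (f.source.inv_locus ?Z g)\<^esub>
          rs_res \<Z> ?Z (f.source.inv_locus ?Z g) g = rs_res \<Z> ?Z (f.source.inv_locus ?Z g) c"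
      using finv[OF z ce(2)] ce(3) fpull[OF ce(1)] fpull[OF ce(2)] sub
      by (intro bexI[of _ ?c] bexI[of _ ?e]) (simp_all add: loc)
  next
    fix Q assume Q: "primeideal Q (rs_sec \<Z> ?Z)"
    let ?Q' = "{s \<in> carrier (rs_sec \<S> ?S). rm_pull f ?S s \<in> Q}"
    have "primeideal ?Q' (rs_sec \<S> ?S)"
      using primeideal_vimage[OF f.target.sec_cring[OF So] _ Q] f.pull_hom[OF So] preZ by simp
    then obtain P where P: "P \<in> ?S" "\<And>s. s \<in> carrier (rs_sec \<S> ?S) \<Longrightarrow> f.target.inv_at P ?S s \<longleftrightarrow> s \<notin> ?Q'"
      using S2 by blast
    have "f.source.inv_at (rm_base g P) ?Z s \<longleftrightarrow> s \<notin> Q" if s: "s \<in> carrier (rs_sec \<Z> ?Z)" for s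
      using ginv[OF P(1) s] P(2)[OF gpull[OF s]] gf_pull[OF Zo s] preS gpull[OF s] by simp
    then show "\<exists>z\<in>?Z. \<forall>s\<in>carrier (rs_sec \<Z> ?Z). f.source.inv_at z ?Z s = (s \<notin> Q)"
      using g.base_point[OF P(1)] by blast
  next
    fix z w assume zw: "z \<in> ?Z" "w \<in> ?Z"
      and eq: "\<forall>s\<in>carrier (rs_sec \<Z> ?Z). f.source.inv_at z ?Z s = f.source.inv_at w ?Z s"
    have "rm_base f z = rm_base f w"
      using S3[OF f.base_point[OF zw(1)] f.base_point[OF zw(2)]] finv[OF zw(1)] finv[OF zw(2)] eq fpull
      by blast
    then show "z = w" using gf_pt[OF zw(1)] gf_pt[OF zw(2)] by metis
  qed
qed

lemma open_subspace_simps [simp]: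
  "rs_top (open_subspace \<X> U) = subtopology (rs_top \<X>) U"
  "rs_sec (open_subspace \<X> U) = rs_sec \<X>" "rs_res (open_subspace \<X> U) = rs_res \<X>"
  by (simp_all add: open_subspace_def)

context locally_ringed_space
begin

lemma affine_chart:
  assumes aff: "affine_open \<X> U"
  shows affine_chart_open: "openin (rs_top \<X>) U"
    and affine_chart_fraction: "\<And>z V t. sec_at z V t \<Longrightarrow> V \<subseteq> U \<Longrightarrow>
      \<exists>c\<in>carrier (rs_sec \<X> U). \<exists>g\<in>carrier (rs_sec \<X> U). inv_at z U g \<and>
        (\<forall>w\<in>U. inv_at w U g \<longrightarrow> w \<in> V \<and>
          val w V t \<otimes>\<^bsub>residue_field \<X> w\<^esub> val w U g = val w U c)"
    and affine_chart_prime: "\<And>Q. primeideal Q (rs_sec \<X> U) \<Longrightarrow>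
      \<exists>z\<in>U. \<forall>s\<in>carrier (rs_sec \<X> U). inv_at z U s \<longleftrightarrow> s \<notin> Q"
    and affine_chart_point_eq: "\<And>z w. z \<in> U \<Longrightarrow> w \<in> U \<Longrightarrow>
      (\<And>s. s \<in> carrier (rs_sec \<X> U) \<Longrightarrow> inv_at z U s \<longleftrightarrow> inv_at w U s) \<Longrightarrow> z = w"
proof -
  show U: "openin (rs_top \<X>) U" using aff unfolding affine_open_def by blast
  let ?Z = "open_subspace \<X> U"
  obtain A :: "'b ring" and f g where A: "cring A" and
    fg: "lrs_morphism ?Z (Spec A) f" "lrs_morphism (Spec A) ?Z g"
    "rm_eq ?Z ?Z (rm_comp (Spec A) g f) rm_id" "rm_eq (Spec A) (Spec A) (rm_comp ?Z f g) rm_id"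
    using aff unfolding affine_open_def affine_scheme_def lrs_isomorphic_def by blast
  interpret Z: locally_ringed_space ?Z using fg(1) unfolding lrs_morphism_def by blast
  interpret S: spec_scheme A
    using A fg(1) unfolding lrs_morphism_def spec_scheme_def by blast
  have like: "Z.affine_like" using affine_like_transfer[OF fg S.affine_like] .
  have pts: "topspace (subtopology (rs_top \<X>) U) = U" using openin_subset[OF U] by auto
  have op: "openin (rs_top ?Z) W \<longleftrightarrow> openin (rs_top \<X>) W \<and> W \<subseteq> U" for W
    using openin_open_subtopology[OF U] by simp
  have inv: "Z.inv_at z V s \<longleftrightarrow> inv_at z V s" if "V \<subseteq> U" for z V s
    unfolding Z.inv_at_def inv_at_def op using that by auto
  have loc: "Z.inv_locus U s = inv_locus U s" for s
    unfolding Z.inv_locus_def inv_locus_def using inv by blast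
  have sec: "Z.sec_at z V s \<longleftrightarrow> sec_at z V s" if "V \<subseteq> U" for z V s
    unfolding Z.sec_at_def sec_at_def op using that by auto
  note like' = like[unfolded Z.affine_like_def Let_def open_subspace_simps pts]
  show "\<exists>c\<in>carrier (rs_sec \<X> U). \<exists>g\<in>carrier (rs_sec \<X> U). inv_at z U g \<and>
        (\<forall>w\<in>U. inv_at w U g \<longrightarrow> w \<in> V \<and> val w V t \<otimes>\<^bsub>residue_field \<X> w\<^esub> val w U g = val w U c)"
    if t: "sec_at z V t" and VU: "V \<subseteq> U" for z V t
  proof -
    have "Z.sec_at z V t" using sec[OF VU] t by blast
    then obtain c g where c: "c \<in> carrier (rs_sec \<X> U)" "g \<in> carrier (rs_sec \<X> U)"
      "inv_at z U g" "inv_locus U g \<subseteq> V" and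
      eq: "rs_res \<X> V (inv_locus U g) t \<otimes>\<^bsub>rs_sec \<X> (inv_locus U g)\<^esub> rs_res \<X> U (inv_locus U g) g
        = rs_res \<X> U (inv_locus U g) c"
      using like'[THEN conjunct1, rule_format, of z V t] unfolding inv[OF order_refl] loc by blast
    let ?D = "inv_locus U g"
    have D: "openin (rs_top \<X>) ?D" "?D \<subseteq> U" using inv_locus_open[OF U] unfolding inv_locus_def by auto
    have "w \<in> V \<and> val w V t \<otimes>\<^bsub>residue_field \<X> w\<^esub> val w U g = val w U c"
      if w: "w \<in> U" "inv_at w U g" for w
    proof -
      have wD: "w \<in> ?D" using w unfolding inv_locus_def by blast
      have wV: "w \<in> V" using wD c(4) by blast
      have s: "sec_at w V t" "sec_at w U g" "sec_at w U c"
        using wV sec_atD(1)[OF t] sec_atD(3)[OF t] c w U unfolding sec_at_def by auto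
      have r: "rs_res \<X> V ?D t \<in> carrier (rs_sec \<X> ?D)" "rs_res \<X> U ?D g \<in> carrier (rs_sec \<X> ?D)"
        using res_closed[OF sec_atD(1)[OF t] D(1) c(4) sec_atD(3)[OF t]] res_closed[OF U D c(2)] by auto
      show ?thesis
        using arg_cong[OF eq, of "val w ?D"] ring_hom_mult[OF val_hom[OF D(1) wD] r]
          val_res[OF s(1) D(1) c(4) wD] val_res[OF s(2) D wD] val_res[OF s(3) D wD] wV by simp
    qed
    then show ?thesis using c by blast
  qed
  show "\<exists>z\<in>U. \<forall>s\<in>carrier (rs_sec \<X> U). inv_at z U s \<longleftrightarrow> s \<notin> Q"
    if "primeideal Q (rs_sec \<X> U)" for Q
    using like'[THEN conjunct2, THEN conjunct1, rule_format, OF that] unfolding inv[OF order_refl] .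
  show "z = w" if "z \<in> U" "w \<in> U"
    "\<And>s. s \<in> carrier (rs_sec \<X> U) \<Longrightarrow> inv_at z U s \<longleftrightarrow> inv_at w U s" for z w
    by (rule like'[THEN conjunct2, THEN conjunct2, rule_format]) (use that in \<open>simp_all add: inv\<close>)
qed

end

section \<open>Finitely generated charts over a field\<close>

lemma (in field) prime_spectrum_field: "prime_spectrum R = {{\<zero>}}"
proof -
  have "P = {\<zero>}" if P: "primeideal P R" for P
  proof -
    have "ideal P R" "carrier R \<noteq> P" using P primeideal.I_notcarr primeideal.axioms(1) by auto
    then show ?thesis using all_ideals by blast
  qed
  then show ?thesis using zeroprimeideal unfolding prime_spectrum_def by blast
qed

lemma (in field) spec_section_const:
  assumes s: "s \<in> carrier (spec_sec R (prime_spectrum R))"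
  shows "\<exists>c\<in>carrier R. s = spec_const (prime_spectrum R) c"
proof -
  let ?P = "{\<zero>}"
  have P: "?P \<in> prime_spectrum R" using prime_spectrum_field by simp
  interpret P: primeideal ?P R using primeD[OF P] .
  obtain V c e where c: "c \<in> carrier R" "e \<in> carrier R" "e \<noteq> \<zero>" "s ?P = P.loc_frac c e"
    using spec_secD[OF s P] by (metis singleton_iff)
  have e: "inv e \<in> carrier R" "inv e \<otimes> e = \<one>" using c field_Units by auto
  have "\<one> \<otimes> (c \<otimes> \<one> \<ominus> c \<otimes> inv e \<otimes> e) = \<zero>"
    using c e by (simp add: m_assoc a_minus_def r_neg)
  then have "s ?P = P.loc_frac (c \<otimes> inv e) \<one>"
    using P.frac_eqI[of c e "c \<otimes> inv e" \<one> \<one>] c e P.one_S by auto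
  moreover have "s \<in> extensional (prime_spectrum R)"
    using s unfolding spec_sec_def by (auto simp: PiE_def)
  ultimately have "s = spec_const (prime_spectrum R) (c \<otimes> inv e)"
    unfolding spec_const_def prime_spectrum_field by (intro ext) (auto simp: extensional_def)
  then show ?thesis using c e by blast
qed

definition structure_const where
  "structure_const k a c = rm_pull a (prime_spectrum k) (cring.spec_const k (prime_spectrum k) c)"

lemma structure_const_hom:
  assumes k: "field k" and a: "lrs_morphism \<X> (Spec k) a"
  shows "structure_const k a \<in> ring_hom k (rs_sec \<X> (rs_points \<X>))"
    "preim \<X> a (prime_spectrum k) = rs_points \<X>"
proof -
  interpret k: field k by fact
  interpret a: lrs_morphism \<X> "Spec k" a by fact
  have o: "openin (zariski k) (prime_spectrum k)" using openin_topspace[of "zariski k"] by simp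
  show pre: "preim \<X> a (prime_spectrum k) = rs_points \<X>"
    using a.base_point unfolding preim_def by auto
  have "rm_pull a (prime_spectrum k) \<in> ring_hom (spec_sec k (prime_spectrum k)) (rs_sec \<X> (rs_points \<X>))"
    using a.pull_hom[of "prime_spectrum k"] o unfolding pre by simp
  moreover have "structure_const k a = rm_pull a (prime_spectrum k) \<circ> k.spec_const (prime_spectrum k)"
    by (simp add: fun_eq_iff structure_const_def)
  ultimately show "structure_const k a \<in> ring_hom k (rs_sec \<X> (rs_points \<X>))"
    using ring_hom_trans[OF k.spec_const_hom[OF o]] by simp
qed

text \<open>The spectrum of a field has one point and its sections are the constants, so the affine cover of
  the base in the definition of finite type amounts to the whole base.\<close>

lemma finite_type_chart:
  assumes k: "field k" and a: "lrs_morphism \<X> (Spec k) a" and ft: "finite_type \<X> (Spec k) a"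
    and x: "x \<in> rs_points \<X>"
  obtains U F where "affine_open \<X> U" "x \<in> U" "finite F" "F \<subseteq> carrier (rs_sec \<X> U)"
    "generate_ring (rs_sec \<X> U)
      ((\<lambda>c. rs_res \<X> (rs_points \<X>) U (structure_const k a c)) ` carrier k \<union> F) = carrier (rs_sec \<X> U)"
proof -
  interpret k: field k by fact
  interpret a: lrs_morphism \<X> "Spec k" a by fact
  obtain \<V> where \<V>: "\<Union>\<V> = rs_points (Spec k)"
    and ch: "\<forall>V\<in>\<V>. \<exists>\<U>. finite \<U> \<and> (\<forall>U\<in>\<U>. affine_open \<X> U) \<and> \<Union>\<U> = preim \<X> a V \<and>
         (\<forall>U\<in>\<U>. finitely_generated_algebra (rs_sec (Spec k) V) (rs_sec \<X> U)
                    (rs_res \<X> (preim \<X> a V) U \<circ> rm_pull a V))"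
    using ft unfolding finite_type_def by (elim exE conjE)
  have ax: "rm_base a x \<in> prime_spectrum k" using a.base_point[OF x] by simp
  then obtain V where V: "V \<in> \<V>" "rm_base a x \<in> V" using \<V> by auto
  have "V \<subseteq> prime_spectrum k" using V(1) \<V> by auto
  then have VS: "V = prime_spectrum k" using V(2) ax unfolding k.prime_spectrum_field by auto
  note pre = structure_const_hom(2)[OF k a]
  obtain U where U: "affine_open \<X> U" "x \<in> U"
    and fg: "finitely_generated_algebra (rs_sec (Spec k) V) (rs_sec \<X> U)
                    (rs_res \<X> (preim \<X> a V) U \<circ> rm_pull a V)"
  proof -
    obtain \<U> where \<U>: "\<forall>U\<in>\<U>. affine_open \<X> U" "\<Union>\<U> = preim \<X> a V" and
      fg: "\<forall>U\<in>\<U>. finitely_generated_algebra (rs_sec (Spec k) V) (rs_sec \<X> U)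
                    (rs_res \<X> (preim \<X> a V) U \<circ> rm_pull a V)"
      using bspec[OF ch V(1)] by (elim exE conjE)
    obtain U where "U \<in> \<U>" "x \<in> U" using \<U>(2) x pre unfolding VS by blast
    then show thesis using that[of U] \<U>(1) fg by simp
  qed
  have im: "(rs_res \<X> (preim \<X> a V) U \<circ> rm_pull a V) ` carrier (rs_sec (Spec k) V)
      = (\<lambda>c. rs_res \<X> (rs_points \<X>) U (structure_const k a c)) ` carrier k"
  proof -
    have o: "openin (zariski k) (prime_spectrum k)" using openin_topspace[of "zariski k"] by simp
    have "carrier (rs_sec (Spec k) V) = k.spec_const V ` carrier k"
      using k.spec_section_const k.spec_const_closed[OF o] unfolding VS by auto
    then show ?thesis unfolding VS pre structure_const_def comp_def by (simp add: image_image)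
  qed
  from fg obtain F where "finite F" "F \<subseteq> carrier (rs_sec \<X> U)"
    "generate_ring (rs_sec \<X> U)
      ((\<lambda>c. rs_res \<X> (rs_points \<X>) U (structure_const k a c)) ` carrier k \<union> F) = carrier (rs_sec \<X> U)"
    unfolding finitely_generated_algebra_def im by blast
  with U that show thesis by blast
qed

section \<open>Injective morphisms between schemes of finite type\<close>

lemma (in ring_hom_ring) hom_generate_ring:
  assumes H: "H \<subseteq> carrier R" and C: "subring C S" "h ` H \<subseteq> C"
  shows "h ` generate_ring R H \<subseteq> C"
proof
  fix y assume "y \<in> h ` generate_ring R H"
  then obtain r where "r \<in> generate_ring R H" "y = h r" by blast
  moreover have "r \<in> carrier R \<and> h r \<in> C" if "r \<in> generate_ring R H" for r
    using that
  proof induction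
    case one
    then show ?case using subringE(3)[OF C(1)] by simp
  next
    case (incl r)
    then show ?case using H C(2) by blast
  next
    case (a_inv r)
    then show ?case using subringE(5)[OF C(1)] by simp
  next
    case (eng_add r s)
    then show ?case using subringE(7)[OF C(1)] by simp
  next
    case (eng_mult r s)
    then show ?case using subringE(6)[OF C(1)] by simp
  qed
  ultimately show "y \<in> C" by blast
qed

text \<open>Here \<open>\<kappa>\<close> embeds the constants into the global sections, and \<open>F\<close> generates the sections
  over \<open>U\<close> as a \<open>k\<close>-algebra.\<close>

definition chart_at :: "('k, 'm) ring_scheme \<Rightarrow> ('x, 'r) rspace \<Rightarrow> ('k \<Rightarrow> 'r) \<Rightarrow> 'x \<Rightarrow> 'x set \<Rightarrow> 'r set \<Rightarrow> bool" where
  "chart_at k \<X> \<kappa> x U F \<longleftrightarrow> affine_open \<X> U \<and> x \<in> U \<and> finite F \<and> F \<subseteq> carrier (rs_sec \<X> U) \<and>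
    generate_ring (rs_sec \<X> U) ((\<lambda>c. rs_res \<X> (rs_points \<X>) U (\<kappa> c)) ` carrier k \<union> F)
      = carrier (rs_sec \<X> U)"

context locally_ringed_space
begin

text \<open>The kernel of a \<open>k\<close>-homomorphism \<open>\<Phi>\<close> to \<open>k\<close> is prime, so it belongs to a point. The value of
  \<open>s\<close> there is the constant \<open>\<Phi> s\<close>, because \<open>s - \<Phi> s\<close> lies in the kernel.\<close>

lemma k_point_of_chart:
  assumes k: "field k" and \<kappa>: "\<kappa> \<in> ring_hom k (rs_sec \<X> (rs_points \<X>))" and U: "affine_open \<X> U"
    and \<Phi>: "\<Phi> \<in> ring_hom (rs_sec \<X> U) k"
    and \<Phi>\<kappa>: "\<And>c. c \<in> carrier k \<Longrightarrow> \<Phi> (rs_res \<X> (rs_points \<X>) U (\<kappa> c)) = c"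
  shows "\<exists>y. y \<in> U \<and> (\<forall>s\<in>carrier (rs_sec \<X> U). inv_at y U s \<longleftrightarrow> \<Phi> s \<noteq> \<zero>\<^bsub>k\<^esub>) \<and>
    (\<forall>s\<in>carrier (rs_sec \<X> U). val y U s = val y (rs_points \<X>) (\<kappa> (\<Phi> s)))"
proof -
  interpret k: field k by fact
  note Uo = affine_chart_open[OF U]
  interpret B: cring "rs_sec \<X> U" using sec_cring[OF Uo] .
  interpret \<Phi>: ring_hom_ring "rs_sec \<X> U" k \<Phi> by (rule ring_hom_ringI2[OF B.ring_axioms k.ring_axioms \<Phi>])
  have "primeideal {s \<in> carrier (rs_sec \<X> U). \<Phi> s \<in> {\<zero>\<^bsub>k\<^esub>}} (rs_sec \<X> U)"
    by (rule primeideal_vimage[OF B.is_cring \<Phi> k.zeroprimeideal])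
  from affine_chart_prime[OF U this] obtain y where y: "y \<in> U"
    and inv: "\<And>s. s \<in> carrier (rs_sec \<X> U) \<Longrightarrow> inv_at y U s \<longleftrightarrow> \<Phi> s \<noteq> \<zero>\<^bsub>k\<^esub>" by auto
  interpret L: field "residue_field \<X> y" using residue_field_field[OF points_memI[OF Uo y]] .
  interpret v: ring_hom_ring "rs_sec \<X> U" "residue_field \<X> y" "val y U"
    by (rule ring_hom_ringI2[OF B.ring_axioms L.ring_axioms val_hom[OF Uo y]])
  have X: "openin (rs_top \<X>) (rs_points \<X>)" "U \<subseteq> rs_points \<X>" using openin_subset[OF Uo] by auto
  have "val y U s = val y (rs_points \<X>) (\<kappa> (\<Phi> s))" if s: "s \<in> carrier (rs_sec \<X> U)" for s
  proof -
    have c: "\<Phi> s \<in> carrier k" using s by simp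
    let ?c = "rs_res \<X> (rs_points \<X>) U (\<kappa> (\<Phi> s))"
    have \<kappa>c: "\<kappa> (\<Phi> s) \<in> carrier (rs_sec \<X> (rs_points \<X>))" using ring_hom_closed[OF \<kappa> c] .
    have cc: "?c \<in> carrier (rs_sec \<X> U)" using res_closed[OF X(1) Uo X(2) \<kappa>c] .
    have d: "s \<ominus>\<^bsub>rs_sec \<X> U\<^esub> ?c \<in> carrier (rs_sec \<X> U)" using s cc by simp
    have "\<Phi> (s \<ominus>\<^bsub>rs_sec \<X> U\<^esub> ?c) = \<zero>\<^bsub>k\<^esub>"
      using s cc \<Phi>\<kappa>[OF c] c by (simp add: a_minus_def k.r_neg)
    then have "\<not> inv_at y U (s \<ominus>\<^bsub>rs_sec \<X> U\<^esub> ?c)" using inv[OF d] by simp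
    moreover have "sec_at y U (s \<ominus>\<^bsub>rs_sec \<X> U\<^esub> ?c)" using Uo y d unfolding sec_at_def by simp
    ultimately have "val y U (s \<ominus>\<^bsub>rs_sec \<X> U\<^esub> ?c) = \<zero>\<^bsub>residue_field \<X> y\<^esub>" using val_zero_iff by blast
    then have "val y U s \<ominus>\<^bsub>residue_field \<X> y\<^esub> val y U ?c = \<zero>\<^bsub>residue_field \<X> y\<^esub>"
      using s cc by (simp add: a_minus_def)
    then have "val y U s = val y U ?c" using v.hom_closed[OF s] v.hom_closed[OF cc] by simp
    also have "\<dots> = val y (rs_points \<X>) (\<kappa> (\<Phi> s))"
      using val_res[of y "rs_points \<X>" "\<kappa> (\<Phi> s)" U] \<kappa>c X Uo y unfolding sec_at_def by auto
    finally show ?thesis .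
  qed
  with y inv show ?thesis by blast
qed

end

context lrs_morphism
begin

text \<open>The set \<open>E\<close> of values of the pulled back generators lies in the image \<open>K\<close> of the residue field of
  the image point, so \<open>separating_points\<close> applies. The set \<open>M\<close> contains the values of the generators \<open>F\<close>,
  so that the two homomorphisms can be composed with evaluation at \<open>x\<close> to give points of the chart \<open>U\<close>, and it
  contains the inverses of the values of all denominators, so that the denominators do not vanish at these
  points.\<close>

lemma inj_imp_residually_purely_inseparable:
  fixes k :: "('k, 'm) ring_scheme"
  assumes k: "algebraically_closed k" and char: "ring_char k = p" "p > 0"
    and \<kappa>X: "\<kappa>X \<in> ring_hom k (rs_sec \<X> (rs_points \<X>))"
    and \<kappa>Y: "\<kappa>Y \<in> ring_hom k (rs_sec \<Y> (rs_points \<Y>))"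
    and comp: "\<And>c. c \<in> carrier k \<Longrightarrow> rm_pull f (rs_points \<Y>) (\<kappa>Y c) = \<kappa>X c"
    and x: "x \<in> rs_points \<X>"
    and chX: "chart_at k \<X> \<kappa>X x U F" and chY: "chart_at k \<Y> \<kappa>Y (rm_base f x) U' F'"
    and inj: "inj_on (rm_base f) (rs_points \<X>)"
  shows "purely_inseparable (residue_field \<Y> (rm_base f x)) (residue_field \<X> x) (residue_map \<X> f x)"
proof -
  let ?L = "residue_field \<X> x" and ?fx = "rm_base f x"
  let ?K = "residue_map \<X> f x ` carrier (residue_field \<Y> ?fx)"
  interpret k: algebraically_closed k by fact
  interpret L: field ?L using source.residue_field_field[OF x] .
  interpret LY: field "residue_field \<Y> ?fx" using target.residue_field_field[OF base_point[OF x]] .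
  let ?X = "rs_points \<X>" and ?Y = "rs_points \<Y>"
  have Xo: "openin (rs_top \<X>) ?X" and Yo: "openin (rs_top \<Y>) ?Y" by simp_all
  have preY: "preim \<X> f ?Y = ?X" using base_point unfolding preim_def by blast
  have U: "affine_open \<X> U" "x \<in> U" "finite F" "F \<subseteq> carrier (rs_sec \<X> U)"
    "generate_ring (rs_sec \<X> U) ((\<lambda>c. rs_res \<X> ?X U (\<kappa>X c)) ` carrier k \<union> F) = carrier (rs_sec \<X> U)"
    using chX unfolding chart_at_def by auto
  have U': "affine_open \<Y> U'" "?fx \<in> U'" "finite F'" "F' \<subseteq> carrier (rs_sec \<Y> U')"
    "generate_ring (rs_sec \<Y> U') ((\<lambda>c. rs_res \<Y> ?Y U' (\<kappa>Y c)) ` carrier k \<union> F') = carrier (rs_sec \<Y> U')"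
    using chY unfolding chart_at_def by auto
  note Uo = source.affine_chart_open[OF U(1)] and U'o = target.affine_chart_open[OF U'(1)]
  have UX: "U \<subseteq> ?X" and U'Y: "U' \<subseteq> ?Y" using openin_subset[OF Uo] openin_subset[OF U'o] .
  interpret B: cring "rs_sec \<X> U" using source.sec_cring[OF Uo] .
  interpret B': cring "rs_sec \<Y> U'" using target.sec_cring[OF U'o] .
  have homK: "residue_map \<X> f x \<in> ring_hom (residue_field \<Y> ?fx) ?L" using residue_map_hom[OF x] .
  interpret rmap: ring_hom_ring "residue_field \<Y> ?fx" ?L "residue_map \<X> f x"
    by (rule ring_hom_ringI2[OF LY.ring_axioms L.ring_axioms homK])
  have K: "subfield ?K ?L"
    using rmap.img_is_subfield(2)[OF LY.carrier_is_subfield L.one_not_zero] .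
  let ?\<iota> = "\<lambda>y c. source.val y ?X (\<kappa>X c)"
  have \<iota>: "?\<iota> y \<in> ring_hom k (residue_field \<X> y)" if "y \<in> ?X" for y
    using ring_hom_trans[OF \<kappa>X source.val_hom[OF Xo that]] unfolding comp_def .
  have \<iota>K: "?\<iota> x ` carrier k \<subseteq> ?K"
  proof
    fix z assume "z \<in> ?\<iota> x ` carrier k"
    then obtain c where c: "c \<in> carrier k" "z = source.val x ?X (\<kappa>X c)" by blast
    have at: "target.sec_at ?fx ?Y (\<kappa>Y c)"
      using ring_hom_closed[OF \<kappa>Y c(1)] base_point[OF x] unfolding target.sec_at_def by simp
    have "z = residue_map \<X> f x (target.val ?fx ?Y (\<kappa>Y c))"
      using residue_map_val[OF x at] comp[OF c(1)] preY c(2) by simp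
    moreover have "target.val ?fx ?Y (\<kappa>Y c) \<in> carrier (residue_field \<Y> ?fx)"
      using ring_hom_closed[OF target.val_hom[OF Yo base_point[OF x]] ring_hom_closed[OF \<kappa>Y c(1)]] .
    ultimately show "z \<in> ?K" by blast
  qed
  have charL: "ring_char ?L = p"
    using ring_char_field_hom[OF k.field_axioms L.field_axioms \<iota>[OF x]] char by simp
  have p1: "max 1 (ring_char ?L) = p" using charL char(2) by simp
  have "\<exists>n::nat. \<alpha> [^]\<^bsub>?L\<^esub> (p ^ n) \<in> ?K" if \<alpha>: "\<alpha> \<in> carrier ?L" for \<alpha>
  proof (rule ccontr)
    assume "\<not> ?thesis"
    then have insep: "\<alpha> [^]\<^bsub>?L\<^esub> (p ^ n) \<notin> ?K" for n :: nat by blast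
    let ?v = "source.val x U"
    interpret v: ring_hom_ring "rs_sec \<X> U" ?L ?v
      by (rule ring_hom_ringI2[OF B.ring_axioms L.ring_axioms source.val_hom[OF Uo U(2)]])
    let ?P = "preim \<X> f U'" and ?V = "U \<inter> preim \<X> f U'"
    have P: "openin (rs_top \<X>) ?P" using preim_open[OF U'o] .
    have V: "openin (rs_top \<X>) ?V" "x \<in> ?V" "?V \<subseteq> U" "?V \<subseteq> ?P"
      using Uo P U(2) U'(2) x unfolding preim_def by auto
    \<comment> \<open>The section \<open>\<one>\<close> is added so that there is at least one fraction: its denominator forces the points
      found below into the preimage of \<open>U'\<close> even if there are no generators.\<close>
    define F1 where "F1 = insert \<one>\<^bsub>rs_sec \<Y> U'\<^esub> F'"
    have F1: "finite F1" "F1 \<subseteq> carrier (rs_sec \<Y> U')" unfolding F1_def using U' by auto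
    let ?t = "\<lambda>s. rs_res \<X> ?P ?V (rm_pull f U' s)"
    have pullc: "rm_pull f U' s \<in> carrier (rs_sec \<X> ?P)" if "s \<in> carrier (rs_sec \<Y> U')" for s
      using ring_hom_closed[OF pull_hom[OF U'o] that] .
    have t_at: "source.sec_at w ?V (?t s)" if "s \<in> carrier (rs_sec \<Y> U')" "w \<in> ?V" for s w
      using source.res_closed[OF P V(1,4) pullc[OF that(1)]] V(1) that(2) unfolding source.sec_at_def by blast
    have t_val: "source.val w ?V (?t s) = source.val w ?P (rm_pull f U' s)"
      if "s \<in> carrier (rs_sec \<Y> U')" "w \<in> ?V" for s w
      using source.val_res[of w ?P "rm_pull f U' s" ?V] pullc[OF that(1)] P V that(2)
      unfolding source.sec_at_def by blast
    have "\<exists>c g. c \<in> carrier (rs_sec \<X> U) \<and> g \<in> carrier (rs_sec \<X> U) \<and> source.inv_at x U g \<and>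
        (\<forall>w\<in>U. source.inv_at w U g \<longrightarrow> w \<in> ?V \<and>
          source.val w ?V (?t s) \<otimes>\<^bsub>residue_field \<X> w\<^esub> source.val w U g = source.val w U c)"
      if "s \<in> F1" for s
      using source.affine_chart_fraction[OF U(1) t_at[OF _ V(2)] V(3), of s] F1 that by blast
    then obtain c g where cg: "\<And>s. s \<in> F1 \<Longrightarrow> c s \<in> carrier (rs_sec \<X> U)"
      "\<And>s. s \<in> F1 \<Longrightarrow> g s \<in> carrier (rs_sec \<X> U)" "\<And>s. s \<in> F1 \<Longrightarrow> source.inv_at x U (g s)"
      and frac: "\<And>s w. s \<in> F1 \<Longrightarrow> w \<in> U \<Longrightarrow> source.inv_at w U (g s) \<Longrightarrow> w \<in> ?V \<and>
          source.val w ?V (?t s) \<otimes>\<^bsub>residue_field \<X> w\<^esub> source.val w U (g s) = source.val w U (c s)"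
      by metis
    obtain c0 g0 where c0: "c0 \<in> carrier (rs_sec \<X> U)" "g0 \<in> carrier (rs_sec \<X> U)" "source.inv_at x U g0"
      and \<alpha>0: "\<alpha> \<otimes>\<^bsub>?L\<^esub> ?v g0 = ?v c0"
    proof -
      obtain W t where t: "source.sec_at x W t" "\<alpha> = source.val x W t"
        using source.residue_fieldE[OF x \<alpha>] by blast
      note W = source.sec_atD(1)[OF t(1)] source.sec_atD(2)[OF t(1)]
      have UW: "openin (rs_top \<X>) (U \<inter> W)" "U \<inter> W \<subseteq> W" "x \<in> U \<inter> W" using Uo U(2) W by auto
      have at: "source.sec_at x (U \<inter> W) (rs_res \<X> W (U \<inter> W) t)" using source.sec_at_res[OF t(1) UW] .
      have "source.val x (U \<inter> W) (rs_res \<X> W (U \<inter> W) t) = \<alpha>" using source.val_res[OF t(1) UW] t(2) by simp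
      then show thesis
        using source.affine_chart_fraction[OF U(1) at] that U(2) by (metis inf_le1)
    qed
    have nz: "?v s \<noteq> \<zero>\<^bsub>?L\<^esub>" if "s \<in> carrier (rs_sec \<X> U)" "source.inv_at x U s" for s
      using source.val_zero_iff[of x U s] that Uo U(2) unfolding source.sec_at_def by blast
    define E where "E = (\<lambda>s. source.val x ?V (?t s)) ` F1"
    define M where "M = ?v ` F \<union> {\<alpha>, inv\<^bsub>?L\<^esub> ?v g0} \<union> (\<lambda>s. inv\<^bsub>?L\<^esub> ?v (g s)) ` F1"
    have E: "finite E" "E \<subseteq> ?K"
    proof -
      show "finite E" unfolding E_def using F1 by simp
      show "E \<subseteq> ?K"
      proof
        fix e assume "e \<in> E"
        then obtain s where s: "s \<in> carrier (rs_sec \<Y> U')" "e = source.val x ?V (?t s)"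
          unfolding E_def using F1 by blast
        have at: "target.sec_at ?fx U' s" using U'o U'(2) s(1) unfolding target.sec_at_def by blast
        have "e = residue_map \<X> f x (target.val ?fx U' s)"
          using residue_map_val[OF x at] t_val[OF s(1) V(2)] s(2) by simp
        moreover have "target.val ?fx U' s \<in> carrier (residue_field \<Y> ?fx)"
          using ring_hom_closed[OF target.val_hom[OF U'o U'(2)] s(1)] .
        ultimately show "e \<in> ?K" by blast
      qed
    qed
    have invL: "inv\<^bsub>?L\<^esub> z \<in> carrier ?L" "inv\<^bsub>?L\<^esub> z \<otimes>\<^bsub>?L\<^esub> z = \<one>\<^bsub>?L\<^esub>"
      if "z \<in> carrier ?L" "z \<noteq> \<zero>\<^bsub>?L\<^esub>" for z
      using that L.field_Units L.Units_inv_closed L.Units_l_inv by auto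
    have M: "finite M" "M \<subseteq> carrier ?L"
    proof -
      show "finite M" unfolding M_def using U(3) F1 by simp
      show "M \<subseteq> carrier ?L"
        unfolding M_def using v.hom_closed U(4) \<alpha> invL(1)[OF v.hom_closed[OF c0(2)] nz[OF c0(2,3)]]
          invL(1)[OF v.hom_closed[OF cg(2)] nz[OF cg(2,3)]] by auto
    qed
    have \<alpha>M: "\<alpha> \<in> M" unfolding M_def by simp
    let ?G = "?\<iota> x ` carrier k \<union> E \<union> M"
    let ?C = "generate_ring ?L ?G"
    obtain \<phi> \<psi> where \<phi>: "\<phi> \<in> ring_hom (?L\<lparr>carrier := ?C\<rparr>) k" and \<psi>: "\<psi> \<in> ring_hom (?L\<lparr>carrier := ?C\<rparr>) k"
      and \<phi>\<psi>: "\<forall>c\<in>carrier k. \<phi> (?\<iota> x c) = c \<and> \<psi> (?\<iota> x c) = c" "\<forall>e\<in>E. \<phi> e = \<psi> e" "\<phi> \<alpha> \<noteq> \<psi> \<alpha>"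
      using separating_points[OF L.field_axioms k \<iota>[OF x] char K \<iota>K E M \<alpha>M insep] by (elim bexE conjE)
    have \<phi>\<iota>: "\<phi> (?\<iota> x c) = c" and \<psi>\<iota>: "\<psi> (?\<iota> x c) = c" if "c \<in> carrier k" for c using \<phi>\<psi>(1) that by blast+
    have eqE: "\<phi> e = \<psi> e" if "e \<in> E" for e using \<phi>\<psi>(2) that by blast
    note neq = \<phi>\<psi>(3)
    have GL: "?G \<subseteq> carrier ?L" 
      by (intro Un_least subset_trans[OF \<iota>K subfieldE(3)[OF K]] subset_trans[OF E(2) subfieldE(3)[OF K]] M(2))
    have C: "subring ?C ?L" using L.generate_ring_is_subring[OF GL] .
    have GC: "?G \<subseteq> ?C" by (rule subsetI, rule generate_ring.incl)
    have constU: "rs_res \<X> ?X U (\<kappa>X c) \<in> carrier (rs_sec \<X> U)"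
      "source.val y U (rs_res \<X> ?X U (\<kappa>X c)) = ?\<iota> y c" if "c \<in> carrier k" "y \<in> U" for c y
      using source.res_closed[OF Xo Uo UX ring_hom_closed[OF \<kappa>X that(1)]]
        source.val_res[of y ?X "\<kappa>X c" U] ring_hom_closed[OF \<kappa>X that(1)] Uo UX that(2) Xo
      unfolding source.sec_at_def by auto
    have vC: "?v s \<in> ?C" if "s \<in> carrier (rs_sec \<X> U)" for s
    proof -
      have sub: "(\<lambda>c. rs_res \<X> ?X U (\<kappa>X c)) ` carrier k \<union> F \<subseteq> carrier (rs_sec \<X> U)"
        by (intro Un_least image_subsetI constU(1)[OF _ U(2)] U(4))
      have "?v ` ((\<lambda>c. rs_res \<X> ?X U (\<kappa>X c)) ` carrier k \<union> F) \<subseteq> ?G"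
        unfolding M_def image_Un image_image using constU(2)[OF _ U(2)] by auto
      from v.hom_generate_ring[OF sub C subset_trans[OF this GC]] show ?thesis
        unfolding U(5) using that by (simp add: image_subset_iff)
    qed
    have pt: "\<exists>y. y \<in> U \<and> (\<forall>s\<in>carrier (rs_sec \<X> U). source.inv_at y U s \<longleftrightarrow> \<chi> (?v s) \<noteq> \<zero>\<^bsub>k\<^esub>) \<and>
        (\<forall>s\<in>carrier (rs_sec \<X> U). source.val y U s = ?\<iota> y (\<chi> (?v s)))"
      if \<chi>: "\<chi> \<in> ring_hom (?L\<lparr>carrier := ?C\<rparr>) k" and \<chi>\<iota>: "\<And>c. c \<in> carrier k \<Longrightarrow> \<chi> (?\<iota> x c) = c" for \<chi>
    proof -
      have "?v \<in> ring_hom (rs_sec \<X> U) (?L\<lparr>carrier := ?C\<rparr>)"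
        by (rule ring_hom_memI) (use vC in auto)
      then have h: "(\<lambda>s. \<chi> (?v s)) \<in> ring_hom (rs_sec \<X> U) k"
        using ring_hom_trans[OF _ \<chi>] unfolding comp_def by blast
      show ?thesis
        using source.k_point_of_chart[OF k.field_axioms \<kappa>X U(1) h] constU(2)[OF _ U(2)] \<chi>\<iota> by simp
    qed
    have frac_val: "\<chi> z \<otimes>\<^bsub>k\<^esub> \<chi> (?v g') = \<chi> (?v c') \<and> \<chi> (?v g') \<noteq> \<zero>\<^bsub>k\<^esub> \<and> \<chi> z \<in> carrier k \<and> \<chi> (?v g') \<in> carrier k"
      if \<chi>: "\<chi> \<in> ring_hom (?L\<lparr>carrier := ?C\<rparr>) k" and z: "z \<in> ?C" and g': "g' \<in> carrier (rs_sec \<X> U)"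
        "source.inv_at x U g'" "inv\<^bsub>?L\<^esub> ?v g' \<in> ?C" and eq: "z \<otimes>\<^bsub>?L\<^esub> ?v g' = ?v c'" for \<chi> z g' c'
    proof -
      have "\<chi> (inv\<^bsub>?L\<^esub> ?v g') \<otimes>\<^bsub>k\<^esub> \<chi> (?v g') = \<one>\<^bsub>k\<^esub>"
        using ring_hom_mult[OF \<chi>, of "inv\<^bsub>?L\<^esub> ?v g'" "?v g'"] ring_hom_one[OF \<chi>] g'(3) vC[OF g'(1)]
          invL(2)[OF v.hom_closed[OF g'(1)] nz[OF g'(1,2)]] by simp
      moreover have "\<chi> (inv\<^bsub>?L\<^esub> ?v g') \<in> carrier k" "\<chi> (?v g') \<in> carrier k" "\<chi> z \<in> carrier k"
        using ring_hom_closed[OF \<chi>] g'(3) vC[OF g'(1)] z by simp_all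
      moreover have "\<chi> z \<otimes>\<^bsub>k\<^esub> \<chi> (?v g') = \<chi> (?v c')"
        using ring_hom_mult[OF \<chi>, of z "?v g'"] z vC[OF g'(1)] eq by simp
      ultimately show ?thesis by auto
    qed
    obtain y1 where y1: "y1 \<in> U" "\<forall>s\<in>carrier (rs_sec \<X> U). source.inv_at y1 U s \<longleftrightarrow> \<phi> (?v s) \<noteq> \<zero>\<^bsub>k\<^esub>"
      "\<forall>s\<in>carrier (rs_sec \<X> U). source.val y1 U s = ?\<iota> y1 (\<phi> (?v s))"
      using pt[OF \<phi> \<phi>\<iota>] by blast
    obtain y2 where y2: "y2 \<in> U" "\<forall>s\<in>carrier (rs_sec \<X> U). source.inv_at y2 U s \<longleftrightarrow> \<psi> (?v s) \<noteq> \<zero>\<^bsub>k\<^esub>"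
      "\<forall>s\<in>carrier (rs_sec \<X> U). source.val y2 U s = ?\<iota> y2 (\<psi> (?v s))"
      using pt[OF \<psi> \<psi>\<iota>] by blast
    have invC: "inv\<^bsub>?L\<^esub> ?v g0 \<in> ?C" "\<And>s. s \<in> F1 \<Longrightarrow> inv\<^bsub>?L\<^esub> ?v (g s) \<in> ?C"
      by (rule subsetD[OF GC], simp add: M_def)+
    have EC: "source.val x ?V (?t s) \<in> ?C" if "s \<in> F1" for s 
      by (rule subsetD[OF GC]) (use that in \<open>simp add: E_def\<close>)
    \<comment> \<open>At the point given by \<open>\<chi>\<close>, numerator and denominator of the fraction of \<open>s\<close> have the constant
      values prescribed by \<open>\<chi>\<close>. Cancelling the denominator, the pullback of \<open>s\<close> has the constant value
      \<open>\<chi> e\<close>, where \<open>e \<in> E\<close> is its value at \<open>x\<close>.\<close>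
    have at_pt: "y \<in> ?V \<and> source.val y ?P (rm_pull f U' s) = ?\<iota> y (\<chi> (source.val x ?V (?t s)))"
      if \<chi>: "\<chi> \<in> ring_hom (?L\<lparr>carrier := ?C\<rparr>) k" and y: "y \<in> U"
        "\<forall>s\<in>carrier (rs_sec \<X> U). source.inv_at y U s \<longleftrightarrow> \<chi> (?v s) \<noteq> \<zero>\<^bsub>k\<^esub>"
        "\<forall>s\<in>carrier (rs_sec \<X> U). source.val y U s = ?\<iota> y (\<chi> (?v s))" and s: "s \<in> F1" for \<chi> y s
    proof -
      have yX: "y \<in> ?X" using y(1) UX by blast
      interpret Ly: field "residue_field \<X> y" using source.residue_field_field[OF yX] .
      have sU: "s \<in> carrier (rs_sec \<Y> U')" using s F1 by blast
      have fx: "source.val x ?V (?t s) \<otimes>\<^bsub>?L\<^esub> ?v (g s) = ?v (c s)" using frac[OF s U(2) cg(3)[OF s]] by blast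
      note fv = frac_val[OF \<chi> EC[OF s] cg(2)[OF s] cg(3)[OF s] invC(2)[OF s] fx]
      have gy: "source.inv_at y U (g s)" using y(2) cg(2)[OF s] fv by blast
      have yV: "y \<in> ?V" and fy: "source.val y ?V (?t s) \<otimes>\<^bsub>residue_field \<X> y\<^esub> source.val y U (g s) = source.val y U (c s)"
        using frac[OF s y(1) gy] by auto
      let ?e = "\<chi> (source.val x ?V (?t s))"
      have ec: "?e \<in> carrier k" "\<chi> (?v (g s)) \<in> carrier k" using fv by auto
      have "source.val y U (c s) = ?\<iota> y (?e \<otimes>\<^bsub>k\<^esub> \<chi> (?v (g s)))" using y(3) cg(1)[OF s] fv by simp
      also have "\<dots> = ?\<iota> y ?e \<otimes>\<^bsub>residue_field \<X> y\<^esub> source.val y U (g s)"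
        using ring_hom_mult[OF \<iota>[OF yX] ec] y(3) cg(2)[OF s] by simp
      finally have eq: "source.val y ?V (?t s) \<otimes>\<^bsub>residue_field \<X> y\<^esub> source.val y U (g s)
          = ?\<iota> y ?e \<otimes>\<^bsub>residue_field \<X> y\<^esub> source.val y U (g s)" using fy by simp
      have "source.sec_at y U (g s)" using Uo y(1) cg(2)[OF s] unfolding source.sec_at_def by blast
      then have gnz: "source.val y U (g s) \<noteq> \<zero>\<^bsub>residue_field \<X> y\<^esub>" using source.val_zero_iff gy by blast
      have cl: "source.val y U (g s) \<in> carrier (residue_field \<X> y)"
        "source.val y ?V (?t s) \<in> carrier (residue_field \<X> y)" "?\<iota> y ?e \<in> carrier (residue_field \<X> y)"
        using ring_hom_closed[OF source.val_hom[OF Uo y(1)] cg(2)[OF s]]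
          ring_hom_closed[OF source.val_hom[OF V(1) yV] source.sec_atD(3)[OF t_at[OF sU yV]]]
          ring_hom_closed[OF \<iota>[OF yX] ec(1)] .
      have "source.val y ?V (?t s) = ?\<iota> y ?e" using Ly.m_rcancel[OF gnz cl] eq by simp
      then show ?thesis using yV t_val[OF sU yV] by simp
    qed
    have one: "\<one>\<^bsub>rs_sec \<Y> U'\<^esub> \<in> F1" unfolding F1_def by simp
    have yV: "y1 \<in> ?V" "y2 \<in> ?V" using at_pt[OF \<phi> y1 one] at_pt[OF \<psi> y2 one] by auto
    have yX: "y1 \<in> ?X" "y2 \<in> ?X" using y1(1) y2(1) UX by auto
    let ?H = "\<lambda>y s. source.val y ?P (rm_pull f U' s)"
    have Hhom: "?H y \<in> ring_hom (rs_sec \<Y> U') (residue_field \<X> y)" if "y \<in> ?V" for y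
      using ring_hom_trans[OF pull_hom[OF U'o] source.val_hom[OF P, of y]] that V(4) unfolding comp_def by blast
    \<comment> \<open>The functions on the target chart whose pullbacks have the same constant value at \<open>y1\<close> and
      \<open>y2\<close> form a subring, which contains the constants and, as \<open>\<phi>\<close> and \<open>\<psi>\<close> agree on \<open>E\<close>, the generators.\<close>
    have same: "\<exists>\<epsilon>\<in>carrier k. ?H y1 s = ?\<iota> y1 \<epsilon> \<and> ?H y2 s = ?\<iota> y2 \<epsilon>" if s: "s \<in> carrier (rs_sec \<Y> U')" for s
    proof -
      interpret L1: field "residue_field \<X> y1" using source.residue_field_field[OF yX(1)] .
      interpret L2: field "residue_field \<X> y2" using source.residue_field_field[OF yX(2)] .
      interpret H1: ring_hom_ring "rs_sec \<Y> U'" "residue_field \<X> y1" "?H y1"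
        by (rule ring_hom_ringI2[OF B'.ring_axioms L1.ring_axioms Hhom[OF yV(1)]])
      interpret H2: ring_hom_ring "rs_sec \<Y> U'" "residue_field \<X> y2" "?H y2"
        by (rule ring_hom_ringI2[OF B'.ring_axioms L2.ring_axioms Hhom[OF yV(2)]])
      interpret i1: ring_hom_ring k "residue_field \<X> y1" "?\<iota> y1"
        by (rule ring_hom_ringI2[OF k.ring_axioms L1.ring_axioms \<iota>[OF yX(1)]])
      interpret i2: ring_hom_ring k "residue_field \<X> y2" "?\<iota> y2"
        by (rule ring_hom_ringI2[OF k.ring_axioms L2.ring_axioms \<iota>[OF yX(2)]])
      have "s \<in> generate_ring (rs_sec \<Y> U') ((\<lambda>c. rs_res \<Y> ?Y U' (\<kappa>Y c)) ` carrier k \<union> F')"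
        using s U'(5) by simp
      then have "s \<in> carrier (rs_sec \<Y> U') \<and> (\<exists>\<epsilon>\<in>carrier k. ?H y1 s = ?\<iota> y1 \<epsilon> \<and> ?H y2 s = ?\<iota> y2 \<epsilon>)"
      proof induction
        case one
        then show ?case using H1.hom_one H2.hom_one i1.hom_one i2.hom_one by (metis B'.one_closed k.one_closed)
      next
        case (incl s)
        then show ?case
        proof
          assume "s \<in> F'"
          then have sF: "s \<in> F1" "s \<in> carrier (rs_sec \<Y> U')" using F1 unfolding F1_def by auto
          have "\<phi> (source.val x ?V (?t s)) \<in> carrier k"
            using ring_hom_closed[OF \<phi>, of "source.val x ?V (?t s)"] EC[OF sF(1)] by simp
          moreover have "\<phi> (source.val x ?V (?t s)) = \<psi> (source.val x ?V (?t s))"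
            using eqE sF(1) unfolding E_def by blast
          ultimately show ?case using at_pt[OF \<phi> y1 sF(1)] at_pt[OF \<psi> y2 sF(1)] sF(2) by metis
        next
          assume "s \<in> (\<lambda>c. rs_res \<Y> ?Y U' (\<kappa>Y c)) ` carrier k"
          then obtain c where c: "c \<in> carrier k" "s = rs_res \<Y> ?Y U' (\<kappa>Y c)" by blast
          have \<kappa>c: "\<kappa>Y c \<in> carrier (rs_sec \<Y> ?Y)" "\<kappa>X c \<in> carrier (rs_sec \<X> ?X)"
            using ring_hom_closed[OF \<kappa>Y c(1)] ring_hom_closed[OF \<kappa>X c(1)] .
          have PX: "?P \<subseteq> ?X" using openin_subset[OF P] .
          have "rm_pull f U' s = rs_res \<X> ?X ?P (\<kappa>X c)"
            using pull_natural[OF Yo U'o U'Y \<kappa>c(1)] c(2) preY comp[OF c(1)] by simp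
          then have "?H y s = ?\<iota> y c" if "y \<in> ?V" for y
            using source.val_res[of y ?X "\<kappa>X c" ?P] that P PX \<kappa>c(2) Xo unfolding source.sec_at_def by auto
          moreover have "s \<in> carrier (rs_sec \<Y> U')" using target.res_closed[OF Yo U'o U'Y \<kappa>c(1)] c(2) by simp
          ultimately show ?case using c(1) yV by blast
        qed
      next
        case (a_inv s)
        then show ?case using H1.hom_a_inv H2.hom_a_inv i1.hom_a_inv i2.hom_a_inv
          by (metis B'.a_inv_closed k.a_inv_closed)
      next
        case (eng_add s t)
        then obtain \<epsilon> \<delta> where "\<epsilon> \<in> carrier k" "\<delta> \<in> carrier k" "?H y1 s = ?\<iota> y1 \<epsilon>" "?H y2 s = ?\<iota> y2 \<epsilon>"
          "?H y1 t = ?\<iota> y1 \<delta>" "?H y2 t = ?\<iota> y2 \<delta>" by blast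
        then show ?case using eng_add H1.hom_add[of s t] H2.hom_add[of s t] i1.hom_add[of \<epsilon> \<delta>] i2.hom_add[of \<epsilon> \<delta>]
          by (intro conjI bexI[of _ "\<epsilon> \<oplus>\<^bsub>k\<^esub> \<delta>"]) auto
      next
        case (eng_mult s t)
        then obtain \<epsilon> \<delta> where "\<epsilon> \<in> carrier k" "\<delta> \<in> carrier k" "?H y1 s = ?\<iota> y1 \<epsilon>" "?H y2 s = ?\<iota> y2 \<epsilon>"
          "?H y1 t = ?\<iota> y1 \<delta>" "?H y2 t = ?\<iota> y2 \<delta>" by blast
        then show ?case using eng_mult H1.hom_mult[of s t] H2.hom_mult[of s t] i1.hom_mult[of \<epsilon> \<delta>] i2.hom_mult[of \<epsilon> \<delta>]
          by (intro conjI bexI[of _ "\<epsilon> \<otimes>\<^bsub>k\<^esub> \<delta>"]) auto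
      qed
      then show ?thesis by blast
    qed
    have inv_H: "target.inv_at (rm_base f y) U' s \<longleftrightarrow> ?H y s \<noteq> \<zero>\<^bsub>residue_field \<X> y\<^esub>"
      if "y \<in> ?V" "s \<in> carrier (rs_sec \<Y> U')" for y s
    proof -
      have y: "y \<in> ?X" "rm_base f y \<in> U'" "y \<in> ?P" using that(1) unfolding preim_def by auto
      have at: "target.sec_at (rm_base f y) U' s" using U'o y(2) that(2) unfolding target.sec_at_def by blast
      show ?thesis using inv_at_pull[OF y(1) at] source.val_zero_iff[OF pull_sec_at[OF y(1) at]] by blast
    qed
    have \<iota>_zero: "?\<iota> y \<epsilon> = \<zero>\<^bsub>residue_field \<X> y\<^esub> \<longleftrightarrow> \<epsilon> = \<zero>\<^bsub>k\<^esub>" and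
      \<iota>_inj: "\<delta> \<in> carrier k \<Longrightarrow> ?\<iota> y \<epsilon> = ?\<iota> y \<delta> \<Longrightarrow> \<epsilon> = \<delta>" if "y \<in> ?X" "\<epsilon> \<in> carrier k" for y \<epsilon> \<delta>
    proof -
      interpret Ly: field "residue_field \<X> y" using source.residue_field_field[OF that(1)] .
      interpret i: ring_hom_ring k "residue_field \<X> y" "?\<iota> y"
        by (rule ring_hom_ringI2[OF k.ring_axioms Ly.ring_axioms \<iota>[OF that(1)]])
      note inj = field_hom_inj[OF k.field_axioms Ly.field_axioms \<iota>[OF that(1)]]
      show "?\<iota> y \<epsilon> = \<zero>\<^bsub>residue_field \<X> y\<^esub> \<longleftrightarrow> \<epsilon> = \<zero>\<^bsub>k\<^esub>"
        using inj_onD[OF inj _ that(2) k.zero_closed] i.hom_zero by auto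
      show "\<delta> \<in> carrier k \<Longrightarrow> ?\<iota> y \<epsilon> = ?\<iota> y \<delta> \<Longrightarrow> \<epsilon> = \<delta>"
        using inj_onD[OF inj _ that(2)] by blast
    qed
    have "rm_base f y1 = rm_base f y2"
    proof (rule target.affine_chart_point_eq[OF U'(1)])
      show "rm_base f y1 \<in> U'" "rm_base f y2 \<in> U'" using yV unfolding preim_def by auto
      fix s assume s: "s \<in> carrier (rs_sec \<Y> U')"
      obtain \<epsilon> where "\<epsilon> \<in> carrier k" "?H y1 s = ?\<iota> y1 \<epsilon>" "?H y2 s = ?\<iota> y2 \<epsilon>" using same[OF s] by blast
      then show "target.inv_at (rm_base f y1) U' s \<longleftrightarrow> target.inv_at (rm_base f y2) U' s"
        using inv_H[OF yV(1) s] inv_H[OF yV(2) s] \<iota>_zero[OF yX(1)] \<iota>_zero[OF yX(2)] by simp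
    qed
    then have y12: "y1 = y2" using inj_onD[OF inj _ yX] by blast
    have agree: "\<phi> (?v s) = \<psi> (?v s)" if s: "s \<in> carrier (rs_sec \<X> U)" for s
    proof -
      have cl: "\<phi> (?v s) \<in> carrier k" "\<psi> (?v s) \<in> carrier k"
        using ring_hom_closed[OF \<phi>] ring_hom_closed[OF \<psi>] vC[OF s] by simp_all
      have "?\<iota> y1 (\<phi> (?v s)) = ?\<iota> y1 (\<psi> (?v s))" using y1(3) y2(3) s y12 by metis
      then show ?thesis using \<iota>_inj[OF yX(1) cl] by blast
    qed
    have \<alpha>C: "\<alpha> \<in> ?C" by (rule subsetD[OF GC]) (simp add: \<alpha>M)
    note f1 = frac_val[OF \<phi> \<alpha>C c0(2,3) invC(1) \<alpha>0] and f2 = frac_val[OF \<psi> \<alpha>C c0(2,3) invC(1) \<alpha>0]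
    have "\<phi> \<alpha> \<otimes>\<^bsub>k\<^esub> \<phi> (?v g0) = \<psi> \<alpha> \<otimes>\<^bsub>k\<^esub> \<phi> (?v g0)"
      using f1 f2 agree[OF c0(1)] agree[OF c0(2)] by metis
    then have "\<phi> \<alpha> = \<psi> \<alpha>" using k.m_rcancel[of "\<phi> (?v g0)" "\<phi> \<alpha>" "\<psi> \<alpha>"] f1 f2 by simp
    with neq show False by simp
  qed
  then show ?thesis
    unfolding purely_inseparable_def p1 using homK L.field_axioms LY.field_axioms by blast
qed

end

theorem proposition6p1:
  fixes k :: "('k, 'm) ring_scheme" and p :: nat
    and \<X> :: "('x, 'r) rspace" and \<Y> :: "('y, 'q) rspace"
    and a :: "('x, 'r, 'k set, 'k set \<Rightarrow> ('k \<times> 'k) set) rmorph"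
    and b :: "('y, 'q, 'k set, 'k set \<Rightarrow> ('k \<times> 'k) set) rmorph"
    and \<pi> :: "('y, 'q, 'x, 'r) rmorph"
  assumes "algebraically_closed k"
    and "ring_char k = p" and "p > 0"
    and "algebraic_variety k \<X> a"
    and "algebraic_variety k \<Y> b"
    and "morphism_over (Spec k) \<Y> b \<X> a \<pi>"
    and "homeomorphic_map (rs_top \<Y>) (rs_top \<X>) (rm_base \<pi>)"
  shows "radicial \<Y> \<X> \<pi>"
proof -
  interpret k: algebraically_closed k by fact
  have X: "lrs_morphism \<X> (Spec k) a" "finite_type \<X> (Spec k) a"
    and Y: "lrs_morphism \<Y> (Spec k) b" "finite_type \<Y> (Spec k) b"
    using assms(4,5) unfolding algebraic_variety_def by auto
  have \<pi>: "lrs_morphism \<Y> \<X> \<pi>" and over: "rm_eq \<Y> (Spec k) (rm_comp \<X> a \<pi>) b"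
    using assms(6) unfolding morphism_over_def by auto
  interpret \<pi>: lrs_morphism \<Y> \<X> \<pi> by fact
  have img: "rm_base \<pi> ` rs_points \<Y> = rs_points \<X>" and inj: "inj_on (rm_base \<pi>) (rs_points \<Y>)"
    using homeomorphic_imp_surjective_map[OF assms(7)] homeomorphic_imp_injective_map[OF assms(7)] .
  note hX = structure_const_hom[OF k.field_axioms X(1)] and hY = structure_const_hom[OF k.field_axioms Y(1)]
  have comp: "rm_pull \<pi> (rs_points \<X>) (structure_const k a c) = structure_const k b c" if "c \<in> carrier k" for c
  proof -
    have o: "openin (zariski k) (prime_spectrum k)" using openin_topspace[of "zariski k"] by simp
    have "rm_pull (rm_comp \<X> a \<pi>) (prime_spectrum k) t = rm_pull b (prime_spectrum k) t"
      if "t \<in> carrier (spec_sec k (prime_spectrum k))" for t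
      using over o that unfolding rm_eq_def by simp
    from this[OF k.spec_const_closed[OF o that]] show ?thesis
      unfolding structure_const_def rm_comp_def using hX(2) by simp
  qed
  have "residually_purely_inseparable \<Y> \<X> \<pi>"
    unfolding residually_purely_inseparable_def
  proof
    fix y assume y: "y \<in> rs_points \<Y>"
    obtain U F where U: "chart_at k \<Y> (structure_const k b) y U F"
      using finite_type_chart[OF k.field_axioms Y y] unfolding chart_at_def by metis
    obtain U' F' where U': "chart_at k \<X> (structure_const k a) (rm_base \<pi> y) U' F'"
      using finite_type_chart[OF k.field_axioms X \<pi>.base_point[OF y]] unfolding chart_at_def by metis
    show "purely_inseparable (residue_field \<X> (rm_base \<pi> y)) (residue_field \<Y> y) (residue_map \<Y> \<pi> y)"
      by (rule \<pi>.inj_imp_residually_purely_inseparable[OF assms(1-3) hY(1) hX(1) comp y U U' inj])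
  qed
  moreover have "dominant \<Y> \<X> \<pi>" unfolding dominant_def img by simp
  ultimately show ?thesis unfolding radicial_def using inj by blast
qed

end
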